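(* Let $(M,g)$ be a Riemannian manifold of dimension $n\ge 2$ and let $D$ be a domain in $M$. Let $x: U \to 3\mathbb{B}^n$ be a normal coordinate neighborhood in $M$ centered at a point $p \in D$ (in particular, $x(p)=0$). Assume that $U$ is small enough; in particular, $|x|^2$ is an MPSH function on $U$. Let $\rho$ be a negative MPSH function in $D$ such that the function $\rho - \varepsilon |x|^2$ is MPSH on $D \cap U$ and $|\rho| \le B$ in $D \cap x^{-1}(2\mathbb{B}^n)$, for some constants $\varepsilon, B > 0$. Then there exists a constant $C = C(\varepsilon,B) > 0$, independent of $\rho$, such that for every $w \in D \cap x^{-1}(\mathbb{B}^n)$ and every tangent vector $\xi \in T_wM$: $$F_D(w,\xi) \ge C\, |\xi|\, |\rho(w)|^{-1/2}.$$
   Context: All manifolds and metrics are $C^\infty$. $\mathbb{D}$ is the open unit disc in $\mathbb{R}^2\cong\mathbb{C}$ with the standard metric $ds^2$, and $e_1=(1,0)$. A map $u$ from $\mathbb{D}$ to a Riemannian manifold $(M,g)$ is harmonic if it is a critical point of the energy $\int_{\mathbb{D}}|du|^2\,dm$ ($dm$ is Lebesgue measure; such maps are smooth); a smooth map $u$ is conformal if $u^*g=e^{\phi}ds^2$ for some smooth function $\phi$. A conformal harmonic immersed disc in an open set $V\subset M$ is a conformal harmonic immersion $u:\mathbb{D}\to V$ (with respect to $g$). MPSH: an upper semicontinuous function $\rho: V\to[-\infty,+\infty)$ on an open set $V\subset M$ is minimal plurisubharmonic (MPSH) if $\rho\circ u$ is subharmonic on $\mathbb{D}$ for every conformal harmonic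 immersed disc $u:\mathbb{D}\to V$. Kobayashi–Royden pseudometric: for $w\in D$ and $\xi\in T_wM$, $F_D(w,\xi)$ is the infimum of all $\alpha>0$ for which there is a conformal harmonic immersed disc $f:\mathbb{D}\to D$ with $f(0)=w$ and $df(0)e_1=\alpha^{-1}\xi$ (and $F_D(w,0)=0$). $\mathbb{B}^n$ is the open unit ball of $\mathbb{R}^n$, $r\mathbb{B}^n$ is the ball of radius $r$ centered at $0$. $|x|^2$ denotes the function $q\mapsto\sum_j x_j(q)^2$ on $U$, and $|\xi|$ is the Euclidean norm of $\xi$ in the coordinates $x$. The coordinate neighborhood $U$ is not assumed to be contained in $D$. *)

theory Defs
  imports "HOL-Analysis.Analysis"
begin

section \<open>Smooth functions between Euclidean spaces\<close>

text \<open>Only used on open sets \<open>S\<close>. All iterated directional derivatives exist and are continuous.\<close>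

primrec Ck_on :: "nat \<Rightarrow> ('a::euclidean_space \<Rightarrow> 'b::euclidean_space) \<Rightarrow> 'a set \<Rightarrow> bool" where
  "Ck_on 0 = (\<lambda>f S. continuous_on S f)"
| "Ck_on (Suc k) = (\<lambda>f S. (\<forall>x\<in>S. f differentiable (at x)) \<and>
      (\<forall>v. Ck_on k (\<lambda>x. frechet_derivative f (at x) v) S))"

definition smooth_on :: "('a::euclidean_space \<Rightarrow> 'b::euclidean_space) \<Rightarrow> 'a set \<Rightarrow> bool" where
  "smooth_on f S \<longleftrightarrow> (\<forall>k. Ck_on k f S)"


section \<open>Smooth manifolds\<close>

text \<open>A chart is a pair \<open>(V, \<phi>)\<close>; the values of \<open>\<phi>\<close> outside \<open>V\<close> are irrelevant.
  The manifold is the carrier of the topology \<open>T\<close>, and its smooth structure is given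
  by a maximal atlas \<open>A\<close>. The dimension is \<open>CARD('n)\<close>.\<close>

type_synonym ('m, 'n) chart = "'m set \<times> ('m \<Rightarrow> real ^ 'n)"

definition is_chart :: "'m topology \<Rightarrow> ('m, 'n::finite) chart \<Rightarrow> bool" where
  "is_chart T = (\<lambda>(V, \<phi>). openin T V \<and> open (\<phi> ` V) \<and>
     homeomorphic_map (subtopology T V) (top_of_set (\<phi> ` V)) \<phi>)"

definition transition :: "('m, 'n::finite) chart \<Rightarrow> ('m, 'n) chart \<Rightarrow> real ^ 'n \<Rightarrow> real ^ 'n" where
  "transition = (\<lambda>(V, \<phi>) (W, \<psi>). \<psi> \<circ> inv_into V \<phi>)"

definition compatible :: "('m, 'n::finite) chart \<Rightarrow> ('m, 'n) chart \<Rightarrow> bool" where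
  "compatible c d \<longleftrightarrow>
     smooth_on (transition c d) (snd c ` (fst c \<inter> fst d)) \<and>
     smooth_on (transition d c) (snd d ` (fst c \<inter> fst d))"

definition smooth_manifold :: "'m topology \<Rightarrow> ('m, 'n::finite) chart set \<Rightarrow> bool" where
  "smooth_manifold T A \<longleftrightarrow>
     Hausdorff_space T \<and> second_countable T \<and>
     (\<Union>c\<in>A. fst c) = topspace T \<and>
     (\<forall>c\<in>A. is_chart T c) \<and>
     (\<forall>c\<in>A. \<forall>d\<in>A. compatible c d) \<and>
     (\<forall>c. is_chart T c \<and> (\<forall>d\<in>A. compatible c d) \<longrightarrow> c \<in> A)"


section \<open>Tangent vectors and differentials\<close>

text \<open>A tangent vector at \<open>p\<close> is the family of its components in the charts around \<open>p\<close>,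
  transforming by the derivatives of the transition maps; the entries for all other
  arguments are set to \<open>0\<close>, so that equality of tangent vectors is equality of functions
  and the vector space operations are pointwise.\<close>

type_synonym ('m, 'n) tvec = "('m, 'n) chart \<Rightarrow> real ^ 'n"

definition tangent_space :: "('m, 'n::finite) chart set \<Rightarrow> 'm \<Rightarrow> ('m, 'n) tvec set" where
  "tangent_space A p = {v.
     (\<forall>c. \<not> (c \<in> A \<and> p \<in> fst c) \<longrightarrow> v c = 0) \<and>
     (\<forall>c\<in>A. \<forall>d\<in>A. p \<in> fst c \<and> p \<in> fst d \<longrightarrow>
        v d = frechet_derivative (transition c d) (at (snd c p)) (v c))}"

text \<open>The tangent vector at \<open>q\<close> whose components in the chart \<open>c\<close> are \<open>a\<close>; for
  \<open>a = axis i 1\<close> it is the \<open>i\<close>-th coordinate vector of \<open>c\<close>.\<close>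

definition coord_tvec ::
    "('m, 'n::finite) chart set \<Rightarrow> ('m, 'n) chart \<Rightarrow> 'm \<Rightarrow> real ^ 'n \<Rightarrow> ('m, 'n) tvec" where
  "coord_tvec A c q a = (\<lambda>d. if d \<in> A \<and> q \<in> fst d
     then frechet_derivative (transition c d) (at (snd c q)) a else 0)"

definition smooth_map_on ::
    "'m topology \<Rightarrow> ('m, 'n::finite) chart set \<Rightarrow> 'a::euclidean_space set \<Rightarrow> ('a \<Rightarrow> 'm) \<Rightarrow> bool" where
  "smooth_map_on T A S u \<longleftrightarrow>
     continuous_map (top_of_set S) T u \<and>
     (\<forall>(V, \<phi>)\<in>A. smooth_on (\<phi> \<circ> u) {z \<in> S. u z \<in> V})"

definition differential ::
    "('m, 'n::finite) chart set \<Rightarrow> ('a::euclidean_space \<Rightarrow> 'm) \<Rightarrow> 'a \<Rightarrow> 'a \<Rightarrow> ('m, 'n) tvec" where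
  "differential A u z a = (\<lambda>(V, \<phi>). if (V, \<phi>) \<in> A \<and> u z \<in> V
     then frechet_derivative (\<phi> \<circ> u) (at z) a else 0)"


section \<open>Riemannian metrics\<close>

type_synonym ('m, 'n) metric = "'m \<Rightarrow> ('m, 'n) tvec \<Rightarrow> ('m, 'n) tvec \<Rightarrow> real"

text \<open>The matrix \<open>(g\<^sub>i\<^sub>j)\<close> of \<open>g\<close> in the chart \<open>c\<close>, as a function on the image of \<open>c\<close>.\<close>

definition metric_matrix ::
    "('m, 'n::finite) chart set \<Rightarrow> ('m, 'n) metric \<Rightarrow> ('m, 'n) chart \<Rightarrow> real ^ 'n \<Rightarrow> real ^ 'n ^ 'n" where
  "metric_matrix A g c y = (let q = inv_into (fst c) (snd c) y in
     \<chi> i j. g q (coord_tvec A c q (axis i 1)) (coord_tvec A c q (axis j 1)))"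

definition riemannian_metric ::
    "'m topology \<Rightarrow> ('m, 'n::finite) chart set \<Rightarrow> ('m, 'n) metric \<Rightarrow> bool" where
  "riemannian_metric T A g \<longleftrightarrow>
     (\<forall>p\<in>topspace T. \<forall>a\<in>tangent_space A p. \<forall>b\<in>tangent_space A p.
        g p a b = g p b a \<and>
        (\<forall>r s. \<forall>d\<in>tangent_space A p.
           g p (\<lambda>c. r *\<^sub>R a c + s *\<^sub>R b c) d = r * g p a d + s * g p b d) \<and>
        (a \<noteq> (\<lambda>_. 0) \<longrightarrow> g p a a > 0)) \<and>
     (\<forall>c\<in>A. smooth_on (metric_matrix A g c) (snd c ` fst c))"

definition riemannian_manifold ::
    "'m topology \<Rightarrow> ('m, 'n::finite) chart set \<Rightarrow> ('m, 'n) metric \<Rightarrow> bool" where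
  "riemannian_manifold T A g \<longleftrightarrow> smooth_manifold T A \<and> riemannian_metric T A g"


section \<open>Geodesics and normal coordinates\<close>

definition christoffel ::
    "('m, 'n::finite) chart set \<Rightarrow> ('m, 'n) metric \<Rightarrow> ('m, 'n) chart \<Rightarrow> real ^ 'n \<Rightarrow>
     'n \<Rightarrow> 'n \<Rightarrow> 'n \<Rightarrow> real" where
  "christoffel A g c y k i j =
     (let G = metric_matrix A g c;
          dG = (\<lambda>l. frechet_derivative G (at y) (axis l 1))
      in (1/2) * (\<Sum>l\<in>UNIV. matrix_inv (G y) $ k $ l *
           (dG i $ j $ l + dG j $ i $ l - dG l $ i $ j)))"

definition geodesic_on ::
    "'m topology \<Rightarrow> ('m, 'n::finite) chart set \<Rightarrow> ('m, 'n) metric \<Rightarrow> real set \<Rightarrow> (real \<Rightarrow> 'm) \<Rightarrow> bool" where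
  "geodesic_on T A g I \<gamma> \<longleftrightarrow>
     smooth_map_on T A I \<gamma> \<and>
     (\<forall>(V, \<phi>)\<in>A. \<forall>t\<in>I. \<gamma> t \<in> V \<longrightarrow>
        (let \<sigma> = \<phi> \<circ> \<gamma>; d\<sigma> = (\<lambda>s. vector_derivative \<sigma> (at s)) in
         \<forall>k. vector_derivative d\<sigma> (at t) $ k +
           (\<Sum>i\<in>UNIV. \<Sum>j\<in>UNIV.
              christoffel A g (V, \<phi>) (\<sigma> t) k i j * d\<sigma> t $ i * d\<sigma> t $ j) = 0))"

text \<open>\<open>riem_exp T A g p v q\<close>: the vector \<open>v\<close> lies in the domain of \<open>exp\<^sub>p\<close>, and \<open>exp\<^sub>p v = q\<close>.\<close>

definition riem_exp ::
    "'m topology \<Rightarrow> ('m, 'n::finite) chart set \<Rightarrow> ('m, 'n) metric \<Rightarrow> 'm \<Rightarrow> ('m, 'n) tvec \<Rightarrow> 'm \<Rightarrow> bool" where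
  "riem_exp T A g p v q \<longleftrightarrow>
     (\<exists>I \<gamma>. open I \<and> is_interval I \<and> 0 \<in> I \<and> 1 \<in> I \<and> geodesic_on T A g I \<gamma> \<and>
        \<gamma> 0 = p \<and> differential A \<gamma> 0 1 = v \<and> \<gamma> 1 = q)"

text \<open>\<open>x : U \<rightarrow> 3\<bbbB>\<^sup>n\<close> is a normal coordinate neighborhood centered at \<open>p\<close>, with unit of length \<open>s\<close>:
  \<open>x\<^sup>-\<^sup>1(y) = exp\<^sub>p (s \<cdot> \<Sum>\<^sub>i y\<^sub>i e\<^sub>i)\<close> for an orthonormal basis \<open>e\<close> of the tangent space at \<open>p\<close>.
  So \<open>U\<close> is the geodesic ball of radius \<open>3 s\<close>, and \<open>x\<close> are ordinary normal coordinates for the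
  metric \<open>s\<^sup>-\<^sup>2 g\<close> (for \<open>g\<close> itself if \<open>s = 1\<close>). The unit \<open>s\<close> is what permits \<open>U\<close> to be
  small while the image of \<open>x\<close> is the ball of the fixed radius \<open>3\<close>.\<close>

definition normal_coordinates ::
    "'m topology \<Rightarrow> ('m, 'n::finite) chart set \<Rightarrow> ('m, 'n) metric \<Rightarrow> 'm \<Rightarrow> real \<Rightarrow>
     'm set \<Rightarrow> ('m \<Rightarrow> real ^ 'n) \<Rightarrow> bool" where
  "normal_coordinates T A g p s U x \<longleftrightarrow>
     (U, x) \<in> A \<and> x ` U = ball 0 3 \<and> p \<in> U \<and> x p = 0 \<and> s > 0 \<and>
     (\<exists>e. (\<forall>i. e i \<in> tangent_space A p) \<and>
          (\<forall>i j. g p (e i) (e j) = (if i = j then 1 else 0)) \<and>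
          (\<forall>y\<in>ball 0 3.
             riem_exp T A g p (\<lambda>c. s *\<^sub>R (\<Sum>i\<in>UNIV. (y $ i) *\<^sub>R e i c)) (inv_into U x y)))"


section \<open>Conformal harmonic immersed discs\<close>

abbreviation unit_disc :: "complex set" where
  "unit_disc \<equiv> ball 0 1"

definition energy_density ::
    "('m, 'n::finite) chart set \<Rightarrow> ('m, 'n) metric \<Rightarrow> (complex \<Rightarrow> 'm) \<Rightarrow> complex \<Rightarrow> real" where
  "energy_density A g u z =
     g (u z) (differential A u z 1) (differential A u z 1) +
     g (u z) (differential A u z \<i>) (differential A u z \<i>)"

definition energy ::
    "('m, 'n::finite) chart set \<Rightarrow> ('m, 'n) metric \<Rightarrow> complex set \<Rightarrow> (complex \<Rightarrow> 'm) \<Rightarrow> real" where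
  "energy A g K u = set_lebesgue_integral lborel K (energy_density A g u)"

text \<open>Critical points of the energy with respect to smooth compactly supported variations
  \<open>(u\<^sub>t)\<close>, where \<open>u\<^sub>t z = h (t, z)\<close>. The total energy over the disc may be infinite; as
  usual, it is taken over a compact set outside of which the variation is constant in \<open>t\<close>.\<close>

definition harmonic_disc ::
    "'m topology \<Rightarrow> ('m, 'n::finite) chart set \<Rightarrow> ('m, 'n) metric \<Rightarrow> (complex \<Rightarrow> 'm) \<Rightarrow> bool" where
  "harmonic_disc T A g u \<longleftrightarrow>
     smooth_map_on T A unit_disc u \<and>
     (\<forall>\<delta>>0. \<forall>K h.
        compact K \<and> K \<subseteq> unit_disc \<and>
        smooth_map_on T A ({-\<delta><..<\<delta>} \<times> unit_disc) h \<and>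
        (\<forall>z\<in>unit_disc. h (0, z) = u z) \<and>
        (\<forall>t\<in>{-\<delta><..<\<delta>}. \<forall>z\<in>unit_disc - K. h (t, z) = u z) \<longrightarrow>
        ((\<lambda>t. energy A g K (\<lambda>z. h (t, z))) has_real_derivative 0) (at 0))"

definition conformal_disc ::
    "('m, 'n::finite) chart set \<Rightarrow> ('m, 'n) metric \<Rightarrow> (complex \<Rightarrow> 'm) \<Rightarrow> bool" where
  "conformal_disc A g u \<longleftrightarrow>
     (\<exists>f::complex \<Rightarrow> real. smooth_on f unit_disc \<and>
        (\<forall>z\<in>unit_disc. \<forall>a b. g (u z) (differential A u z a) (differential A u z b) =
           exp (f z) * (a \<bullet> b)))"

definition CHI_disc ::
    "'m topology \<Rightarrow> ('m, 'n::finite) chart set \<Rightarrow> ('m, 'n) metric \<Rightarrow> 'm set \<Rightarrow> (complex \<Rightarrow> 'm) \<Rightarrow> bool" where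
  "CHI_disc T A g V u \<longleftrightarrow>
     harmonic_disc T A g u \<and> conformal_disc A g u \<and>
     (\<forall>z\<in>unit_disc. inj (differential A u z)) \<and> u ` unit_disc \<subseteq> V"


section \<open>Minimal plurisubharmonic functions\<close>

text \<open>Functions with values in \<open>[-\<infinity>, \<infinity>)\<close>.\<close>

definition usc_on :: "'a topology \<Rightarrow> 'a set \<Rightarrow> ('a \<Rightarrow> ereal) \<Rightarrow> bool" where
  "usc_on T V v \<longleftrightarrow> (\<forall>q\<in>V. v q < \<infinity>) \<and>
     (\<forall>a. openin (subtopology T V) {q \<in> topspace T \<inter> V. v q < a})"

text \<open>The integral mean over a circle of a function that is bounded above there: the integral
  of the positive part minus that of the negative part (the latter may be infinite); note
  that \<open>e2ennreal\<close> maps negative numbers to \<open>0\<close>.\<close>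

definition circle_mean :: "(complex \<Rightarrow> ereal) \<Rightarrow> complex \<Rightarrow> real \<Rightarrow> ereal" where
  "circle_mean v z r = ereal (1 / (2 * pi)) *
     (enn2ereal (\<integral>\<^sup>+t\<in>{0..2*pi}. e2ennreal (v (z + of_real r * cis t)) \<partial>lborel) -
      enn2ereal (\<integral>\<^sup>+t\<in>{0..2*pi}. e2ennreal (- v (z + of_real r * cis t)) \<partial>lborel))"

text \<open>The constant \<open>-\<infinity>\<close> counts as subharmonic.\<close>

definition subharmonic_on :: "complex set \<Rightarrow> (complex \<Rightarrow> ereal) \<Rightarrow> bool" where
  "subharmonic_on S v \<longleftrightarrow> usc_on euclidean S v \<and>
     (\<forall>z r. r > 0 \<and> cball z r \<subseteq> S \<longrightarrow> v z \<le> circle_mean v z r)"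

definition MPSH ::
    "'m topology \<Rightarrow> ('m, 'n::finite) chart set \<Rightarrow> ('m, 'n) metric \<Rightarrow> 'm set \<Rightarrow> ('m \<Rightarrow> ereal) \<Rightarrow> bool" where
  "MPSH T A g V \<rho> \<longleftrightarrow> usc_on T V \<rho> \<and>
     (\<forall>u. CHI_disc T A g V u \<longrightarrow> subharmonic_on unit_disc (\<rho> \<circ> u))"


section \<open>The Kobayashi--Royden pseudometric\<close>

text \<open>The infimum is taken in the extended reals, where the infimum of the empty set is \<open>\<infinity>\<close>.\<close>

definition kobayashi ::
    "'m topology \<Rightarrow> ('m, 'n::finite) chart set \<Rightarrow> ('m, 'n) metric \<Rightarrow> 'm set \<Rightarrow>
     'm \<Rightarrow> ('m, 'n) tvec \<Rightarrow> ereal" where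
  "kobayashi T A g D w \<xi> = (if \<xi> = (\<lambda>_. 0) then 0 else
     Inf {ereal \<alpha> | \<alpha>. \<alpha> > 0 \<and>
       (\<exists>f. CHI_disc T A g D f \<and> f 0 = w \<and>
            differential A f 0 1 = (\<lambda>c. (1 / \<alpha>) *\<^sub>R \<xi> c))})"

end

theory Submission
  imports Defs
begin

text \<open>Let \<open>f\<close> be a conformal harmonic disc in \<open>D\<close> with \<open>f 0 = w\<close>, let \<open>y\<close> be its expression in a chart and
\<open>l\<close> its conformal factor. The asserted lower bound for the Kobayashi--Royden pseudometric is an upper
bound \<open>l 0 \<le> C \<bar>\<rho> w\<bar>\<close>, which is obtained by Sibony's method. Put \<open>h = (y - y 0) \<bullet> H (y - y 0)\<close>, where
\<open>H\<close> is the matrix of the metric at \<open>w\<close>. In Euclidean space \<open>ln h\<close> is subharmonic, because \<open>y\<close> is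
conformal and harmonic. In a Riemannian chart the same computation has relative errors of order
\<open>sqrt h\<close> (\<open>conformal_laplacian_estimates\<close>); adding a multiple of \<open>sqrt h\<close> to the logarithm absorbs
the unbounded ones. Cutting the result off at \<open>h = r\<^sup>2\<close> costs a negative Laplacian of size at most
\<open>C l / r\<^sup>2\<close>. On the other hand \<open>\<rho> - \<epsilon> \<bar>x\<bar>\<^sup>2\<close> is subharmonic along \<open>f\<close>, and \<open>\<bar>x\<bar>\<^sup>2\<close> has Laplacian at
least \<open>c l\<close> near \<open>p\<close>. So the cost is paid by adding \<open>\<alpha> \<rho>\<close> with \<open>\<alpha>\<close> of order \<open>1 / (\<epsilon> r\<^sup>2)\<close>.

The sum minus \<open>ln \<bar>z\<bar>\<^sup>2\<close> then obeys the maximum principle on the punctured disc. As \<open>\<rho> < 0\<close>, this is a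
Schwarz lemma: \<open>exp (\<alpha> \<rho>) h \<le> C r\<^sup>2 \<bar>z\<bar>\<^sup>2\<close> near \<open>0\<close> (\<open>schwarz_lemma\<close>). Letting \<open>z\<close> tend to \<open>0\<close> gives
\<open>l 0 \<le> C r\<^sup>2 exp (2 \<alpha> \<bar>\<rho> w\<bar>)\<close>. The choice of \<open>r\<^sup>2\<close> proportional to \<open>\<bar>\<rho> w\<bar>\<close> keeps \<open>\<alpha> \<bar>\<rho> w\<bar>\<close> bounded and
turns this into the claim (\<open>disc_derivative_estimate\<close>). Since \<open>\<rho> \<circ> f\<close> is only upper semicontinuous,
Laplacians are compared at a maximum point, where a \<open>C\<^sup>2\<close> function touches \<open>\<rho> \<circ> f\<close> from above
(\<open>laplacian_nonpos_at_touching_point\<close>).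

Three geometric facts feed this argument. The first is that critical points of the energy satisfy the
harmonic map equation in a chart (\<open>harmonic_map_equation\<close>). The second is that a small subdisc of a
conformal harmonic disc is again one (\<open>CHI_disc_rescale\<close>), so that hypotheses on \<open>D \<inter> U\<close> can be used
along a disc that leaves \<open>U\<close>. The third is that geodesics are unique, so that two systems of normal
coordinates at \<open>p\<close>, possibly with different units of length, differ by a dilation and an orthogonal
map (\<open>normal_coordinates_similar\<close>). Therefore all estimates can be made in one fixed chart at \<open>p\<close>, and
\<open>W\<close> is a ball of that chart on which \<open>\<bar>x\<bar>\<^sup>2\<close> has positive Laplacian along every such disc. If \<open>p\<close> has no normal
coordinates at all, the statement is vacuous.\<close>

section \<open>Calculus of smooth functions\<close>

lemma frechet_derivative_cong_open:
  assumes "open S" "x \<in> S" "\<And>y. y \<in> S \<Longrightarrow> f y = g y"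
  shows "frechet_derivative f (at x) = frechet_derivative g (at x)"
proof -
  have "(f has_derivative D) (at x) \<longleftrightarrow> (g has_derivative D) (at x)" for D
    using has_derivative_transform_within_open[OF _ assms(1,2)] assms(3) by metis
  then show ?thesis unfolding frechet_derivative_def by simp
qed

lemma Ck_on_cong:
  assumes "open S" "\<And>y. y \<in> S \<Longrightarrow> f y = g y" "Ck_on k f S"
  shows "Ck_on k g S"
  using assms
proof (induction k arbitrary: f g)
  case 0
  then show ?case by (simp cong: continuous_on_cong)
next
  case (Suc k)
  have "g differentiable (at x)" if "x \<in> S" for x
    using Suc.prems that has_derivative_transform_within_open[OF _ Suc.prems(1) that]
    unfolding differentiable_def Ck_on.simps by metis
  moreover have "Ck_on k (\<lambda>x. frechet_derivative g (at x) v) S" for v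
    by (rule Suc.IH[OF Suc.prems(1), of "\<lambda>x. frechet_derivative f (at x) v"])
      (use Suc.prems frechet_derivative_cong_open[OF Suc.prems(1), of _ f g] in auto)
  ultimately show ?case by simp
qed

lemma Ck_on_subset: "Ck_on k f S \<Longrightarrow> R \<subseteq> S \<Longrightarrow> Ck_on k f R"
  by (induction k arbitrary: f) (auto intro: continuous_on_subset)

text \<open>Variations of a disc are given by one formula near their support and by another one elsewhere;
locality is what makes them smooth.\<close>

lemma Ck_on_local:
  assumes "\<And>x. x \<in> S \<Longrightarrow> \<exists>N. open N \<and> x \<in> N \<and> Ck_on k f (N \<inter> S)"
  shows "Ck_on k f S"
  using assms
proof (induction k arbitrary: f)
  case 0
  have "continuous (at x within S) f" if xS: "x \<in> S" for x
  proof -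
    obtain N where N: "open N" "x \<in> N" "continuous_on (N \<inter> S) f"
      using 0[OF xS] by (metis Ck_on.simps(1))
    then have "continuous (at x within (N \<inter> S)) f"
      using xS by (auto simp: continuous_on_eq_continuous_within)
    moreover have "at x within (N \<inter> S) = at x within S"
      using N(1,2) xS by (intro at_within_nhd[of x N]) auto
    ultimately show ?thesis by simp
  qed
  then show ?case by (simp add: continuous_on_eq_continuous_within)
next
  case (Suc k)
  have "f differentiable (at x)" if "x \<in> S" for x
    using Suc.prems[OF that] that by (metis Ck_on.simps(2) IntI)
  moreover have "Ck_on k (\<lambda>x. frechet_derivative f (at x) v) S" for v
  proof (rule Suc.IH)
    fix x assume "x \<in> S"
    from Suc.prems[OF this]
    show "\<exists>N. open N \<and> x \<in> N \<and> Ck_on k (\<lambda>x. frechet_derivative f (at x) v) (N \<inter> S)"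
      by (metis Ck_on.simps(2))
  qed
  ultimately show ?case by simp
qed

lemma Ck_on_Suc_has_derivative:
  "Ck_on (Suc k) f S \<Longrightarrow> x \<in> S \<Longrightarrow> (f has_derivative frechet_derivative f (at x)) (at x)"
  using frechet_derivative_works Ck_on.simps(2) by metis

lemma Ck_on_Suc_derivative: "Ck_on (Suc k) f S \<Longrightarrow> Ck_on k (\<lambda>x. frechet_derivative f (at x) v) S"
  using Ck_on.simps(2) by metis

text \<open>The recursion in \<open>Ck_on\<close> speaks of the canonical derivative; here any formula for the derivative
may be used instead.\<close>

lemma Ck_on_SucI:
  assumes "open S" "\<And>x. x \<in> S \<Longrightarrow> (f has_derivative D x) (at x)"
    "\<And>v. Ck_on k (\<lambda>x. D x v) S"
  shows "Ck_on (Suc k) f S"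
proof -
  have "Ck_on k (\<lambda>x. frechet_derivative f (at x) v) S" for v
  proof (rule Ck_on_cong[OF assms(1) _ assms(3)[of v]])
    fix x assume "x \<in> S"
    then show "D x v = frechet_derivative f (at x) v"
      using frechet_derivative_at[OF assms(2)] by metis
  qed
  moreover have "f differentiable (at x)" if "x \<in> S" for x
    using assms(2)[OF that] by (rule differentiableI)
  ultimately show ?thesis by simp
qed

lemma Ck_on_Suc_lower: "Ck_on (Suc k) f S \<Longrightarrow> Ck_on k f S"
proof (induction k arbitrary: f)
  case 0
  then have "f differentiable_on S"
    by (simp add: differentiable_on_def differentiable_at_withinI)
  then show ?case by (simp add: differentiable_imp_continuous_on)
next
  case (Suc k)
  have "Ck_on k (\<lambda>x. frechet_derivative f (at x) v) S" for v
    by (rule Suc.IH[OF Ck_on_Suc_derivative[OF Suc.prems]])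
  then show ?case using Suc.prems Ck_on.simps(2) by metis
qed

lemma Ck_on_const: "Ck_on k (\<lambda>x. c) S"
  by (induction k arbitrary: c) auto

lemma Ck_on_bounded_linear:
  assumes L: "bounded_linear L" and "Ck_on k f S" and S: "open S"
  shows "Ck_on k (\<lambda>x. L (f x)) S"
  using assms(2)
proof (induction k arbitrary: f)
  case 0
  then show ?case using L by (simp add: bounded_linear.continuous_on)
next
  case (Suc k)
  show ?case
    by (rule Ck_on_SucI[OF S bounded_linear.has_derivative[OF L Ck_on_Suc_has_derivative[OF Suc.prems]]
          Suc.IH[OF Ck_on_Suc_derivative[OF Suc.prems]]])
qed

lemma Ck_on_add:
  assumes "Ck_on k f S" "Ck_on k g S" and S: "open S"
  shows "Ck_on k (\<lambda>x. f x + g x) S"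
  using assms(1,2)
proof (induction k arbitrary: f g)
  case 0
  then show ?case by (simp add: continuous_on_add)
next
  case (Suc k)
  show ?case
    by (rule Ck_on_SucI[OF S has_derivative_add[OF Ck_on_Suc_has_derivative[OF Suc.prems(1)]
            Ck_on_Suc_has_derivative[OF Suc.prems(2)]]])
      (auto intro: Suc.IH Ck_on_Suc_derivative[OF Suc.prems(1)] Ck_on_Suc_derivative[OF Suc.prems(2)])
qed

lemma Ck_on_sum:
  assumes "finite I" "\<And>i. i \<in> I \<Longrightarrow> Ck_on k (f i) S" "open S"
  shows "Ck_on k (\<lambda>x. \<Sum>i\<in>I. f i x) S"
  using assms by (induction I rule: finite_induct) (simp_all add: Ck_on_const Ck_on_add)

lemma Ck_on_bilinear:
  fixes prod :: "'b::euclidean_space \<Rightarrow> 'c::euclidean_space \<Rightarrow> 'd::euclidean_space"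
    and f :: "'a::euclidean_space \<Rightarrow> 'b"
  assumes B: "bounded_bilinear prod" and "Ck_on k f S" "Ck_on k g S" and S: "open S"
  shows "Ck_on k (\<lambda>x. prod (f x) (g x)) S"
  using assms(2,3)
proof (induction k arbitrary: f g)
  case 0
  then show ?case using B by (simp add: bounded_bilinear.continuous_on)
next
  case (Suc k)
  show ?case
    by (rule Ck_on_SucI[OF S bounded_bilinear.FDERIV[OF B Ck_on_Suc_has_derivative[OF Suc.prems(1)]
            Ck_on_Suc_has_derivative[OF Suc.prems(2)]]])
      (auto intro!: Ck_on_add[OF _ _ S] Suc.IH Ck_on_Suc_derivative[OF Suc.prems(1)]
        Ck_on_Suc_derivative[OF Suc.prems(2)] Ck_on_Suc_lower[OF Suc.prems(1)] Ck_on_Suc_lower[OF Suc.prems(2)])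
qed

lemma linear_euclidean_expand:
  fixes L :: "'b::euclidean_space \<Rightarrow> 'c::real_vector"
  assumes "linear L" shows "L v = (\<Sum>b\<in>Basis. (v \<bullet> b) *\<^sub>R L b)"
proof -
  have "L v = L (\<Sum>b\<in>Basis. (v \<bullet> b) *\<^sub>R b)" by (simp add: euclidean_representation)
  also have "\<dots> = (\<Sum>b\<in>Basis. (v \<bullet> b) *\<^sub>R L b)"
    by (simp add: linear_sum[OF assms] linear_scale[OF assms])
  finally show ?thesis .
qed

text \<open>By the chain rule and an expansion in a basis, a directional derivative of a composition is a sum
of products of functions of one order less, to which the induction hypothesis applies.\<close>

lemma Ck_on_compose:
  fixes f :: "'b::euclidean_space \<Rightarrow> 'c::euclidean_space" and h :: "'a::euclidean_space \<Rightarrow> 'b"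
  assumes "Ck_on k f R" "Ck_on k h S" and S: "open S" and hR: "h ` S \<subseteq> R"
  shows "Ck_on k (\<lambda>x. f (h x)) S"
  using assms(1,2)
proof (induction k arbitrary: f)
  case 0
  then show ?case using hR continuous_on_compose2 by fastforce
next
  case (Suc k)
  let ?D = "\<lambda>x v. \<Sum>b\<in>Basis. (frechet_derivative h (at x) v \<bullet> b) *\<^sub>R frechet_derivative f (at (h x)) b"
  show ?case
  proof (rule Ck_on_SucI[OF S, where D = ?D])
    fix x assume x: "x \<in> S"
    then have hx: "h x \<in> R" using hR by auto
    have f: "(f has_derivative frechet_derivative f (at (h x))) (at (h x))"
      by (rule Ck_on_Suc_has_derivative[OF Suc.prems(1) hx])
    have "(f \<circ> h has_derivative frechet_derivative f (at (h x)) \<circ> frechet_derivative h (at x)) (at x)"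
      by (rule diff_chain_at[OF Ck_on_Suc_has_derivative[OF Suc.prems(2) x] f])
    moreover have "frechet_derivative f (at (h x)) \<circ> frechet_derivative h (at x) = ?D x"
      using linear_euclidean_expand[OF has_derivative_linear[OF f]] by (metis comp_apply)
    ultimately show "((\<lambda>x. f (h x)) has_derivative ?D x) (at x)"
      unfolding comp_def[of f h] by metis
  next
    fix v
    have "Ck_on k (\<lambda>x. frechet_derivative f (at (h x)) b) S" for b
      by (rule Suc.IH[OF Ck_on_Suc_derivative[OF Suc.prems(1)] Ck_on_Suc_lower[OF Suc.prems(2)]])
    moreover have "Ck_on k (\<lambda>x. frechet_derivative h (at x) v \<bullet> b) S" for b
      by (rule Ck_on_bounded_linear[OF bounded_linear_inner_left Ck_on_Suc_derivative[OF Suc.prems(2)] S])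
    ultimately show "Ck_on k (\<lambda>x. ?D x v) S"
      by (intro Ck_on_sum Ck_on_bilinear[OF bounded_bilinear_scaleR] S) auto
  qed
qed

lemma Ck_on_bounded_linear_map: "bounded_linear L \<Longrightarrow> Ck_on k L S"
proof -
  assume L: "bounded_linear L"
  have fd: "frechet_derivative L (at x) = L" for x
    using L by (metis bounded_linear_imp_has_derivative frechet_derivative_at)
  show ?thesis
  proof (cases k)
    case 0
    then show ?thesis using L by (simp add: linear_continuous_on)
  next
    case (Suc n)
    then show ?thesis using L
      by (auto simp: fd Ck_on_const intro: bounded_linear_imp_differentiable)
  qed
qed

lemma smooth_on_cong: "open S \<Longrightarrow> (\<And>y. y \<in> S \<Longrightarrow> f y = g y) \<Longrightarrow> smooth_on f S \<Longrightarrow> smooth_on g S"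
  unfolding smooth_on_def using Ck_on_cong by blast

lemma smooth_on_subset: "smooth_on f S \<Longrightarrow> R \<subseteq> S \<Longrightarrow> smooth_on f R"
  unfolding smooth_on_def using Ck_on_subset by blast

lemma smooth_on_local:
  "(\<And>x. x \<in> S \<Longrightarrow> \<exists>N. open N \<and> x \<in> N \<and> smooth_on f (N \<inter> S)) \<Longrightarrow> smooth_on f S"
  unfolding smooth_on_def by (meson Ck_on_local)

lemma smooth_on_const: "smooth_on (\<lambda>x. c) S"
  by (simp add: smooth_on_def Ck_on_const)

lemma smooth_on_bounded_linear_map: "bounded_linear L \<Longrightarrow> smooth_on L S"
  by (simp add: smooth_on_def Ck_on_bounded_linear_map)

lemma smooth_on_add:
  "smooth_on f S \<Longrightarrow> smooth_on g S \<Longrightarrow> open S \<Longrightarrow> smooth_on (\<lambda>x. f x + g x) S"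
  by (simp add: smooth_on_def Ck_on_add)

lemma smooth_on_sum:
  "finite I \<Longrightarrow> (\<And>i. i \<in> I \<Longrightarrow> smooth_on (f i) S) \<Longrightarrow> open S \<Longrightarrow> smooth_on (\<lambda>x. \<Sum>i\<in>I. f i x) S"
  unfolding smooth_on_def by (blast intro: Ck_on_sum)

lemma smooth_on_bilinear:
  fixes prod :: "'b::euclidean_space \<Rightarrow> 'c::euclidean_space \<Rightarrow> 'd::euclidean_space"
    and f :: "'a::euclidean_space \<Rightarrow> 'b"
  shows "bounded_bilinear prod \<Longrightarrow> smooth_on f S \<Longrightarrow> smooth_on g S \<Longrightarrow> open S \<Longrightarrow>
    smooth_on (\<lambda>x. prod (f x) (g x)) S"
  by (simp add: smooth_on_def Ck_on_bilinear)

lemma smooth_on_compose: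
  fixes f :: "'b::euclidean_space \<Rightarrow> 'c::euclidean_space" and h :: "'a::euclidean_space \<Rightarrow> 'b"
  shows "smooth_on f R \<Longrightarrow> smooth_on h S \<Longrightarrow> open S \<Longrightarrow> h ` S \<subseteq> R \<Longrightarrow>
    smooth_on (\<lambda>x. f (h x)) S"
  unfolding smooth_on_def using Ck_on_compose by blast

lemma smooth_on_imp_continuous_on: "smooth_on f S \<Longrightarrow> continuous_on S f"
  by (metis Ck_on.simps(1) smooth_on_def)

lemma smooth_on_imp_has_derivative:
  "smooth_on f S \<Longrightarrow> x \<in> S \<Longrightarrow> (f has_derivative frechet_derivative f (at x)) (at x)"
  unfolding smooth_on_def by (metis Ck_on.simps(2) frechet_derivative_works)

lemma smooth_on_derivative: "smooth_on f S \<Longrightarrow> smooth_on (\<lambda>x. frechet_derivative f (at x) v) S"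
  unfolding smooth_on_def by (metis Ck_on.simps(2))

lemma bounded_bilinear_matrix_vector_mult:
  "bounded_bilinear (\<lambda>(M::real^'n^'m) v. M *v v)"
  by (rule bilinear_conv_bounded_bilinear[THEN iffD1])
    (auto simp: bilinear_def intro!: linearI simp: matrix_vector_mult_add_rdistrib matrix_vector_right_distrib
      matrix_vector_mult_scaleR scaleR_matrix_vector_assoc)

lemmas smooth_on_matrix_vector_mult = smooth_on_bilinear[OF bounded_bilinear_matrix_vector_mult]

section \<open>Smooth bump functions\<close>

text \<open>For \<open>m = 0\<close> this is the function \<open>exp (- 1 / x)\<close>, flat at \<open>0\<close>. The factors \<open>1 / x\<close> are those which
appear under differentiation, so that the linear span of the family is closed under it.\<close>

definition flat_exp :: "nat \<Rightarrow> real \<Rightarrow> real" where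
  "flat_exp m x = (if x > 0 then exp (- inverse x) * inverse x ^ m else 0)"

lemma flat_exp_tendsto: "((\<lambda>x. exp (- inverse x) * inverse x ^ m) \<longlongrightarrow> 0) (at_right (0::real))"
proof -
  have "((\<lambda>y::real. y ^ m * exp (- y)) \<longlongrightarrow> 0) at_top"
    using tendsto_power_div_exp_0[of m] by (simp add: exp_minus field_simps)
  then have "((\<lambda>x::real. inverse x ^ m * exp (- inverse x)) \<longlongrightarrow> 0) (at_right 0)"
    by (rule filterlim_compose) (rule filterlim_inverse_at_top_right)
  then show ?thesis by (simp add: mult.commute)
qed

lemma flat_exp_has_derivative:
  "(flat_exp m has_real_derivative (flat_exp (m + 2) x - real m * flat_exp (m + 1) x)) (at x)"
proof -
  consider "x > 0" | "x < 0" | "x = 0" by linarith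
  then show ?thesis
  proof cases
    case 1
    have "((\<lambda>x. exp (- inverse x) * inverse x ^ m) has_real_derivative
        (flat_exp (m + 2) x - real m * flat_exp (m + 1) x)) (at x)"
    proof -
      have e: "real m * (inverse x)^(m-1) * inverse x = real m * (inverse x)^m"
        by (cases m) auto
      have "((\<lambda>x. exp (- inverse x) * inverse x ^ m) has_real_derivative
          exp (- inverse x) * (inverse x * inverse x) * inverse x ^ m +
          (real m * (- (inverse x * inverse x)) * inverse x ^ (m-1)) * exp (- inverse x)) (at x)"
        using 1 by (auto intro!: derivative_eq_intros)
      also have "exp (- inverse x) * (inverse x * inverse x) * inverse x ^ m +
          (real m * (- (inverse x * inverse x)) * inverse x ^ (m-1)) * exp (- inverse x) =
          exp (- inverse x) * (inverse x * inverse x) * inverse x ^ m -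
          (real m * inverse x ^ (m-1) * inverse x) * inverse x * exp (- inverse x)"
        by (simp add: algebra_simps)
      also have "\<dots> = flat_exp (m + 2) x - real m * flat_exp (m + 1) x"
        unfolding e using 1 by (simp add: flat_exp_def algebra_simps)
      finally show ?thesis .
    qed
    then show ?thesis
      by (rule has_field_derivative_transform_within_open[where S="{0<..}"])
        (use 1 in \<open>auto simp: flat_exp_def\<close>)
  next
    case 2
    have "((\<lambda>x. 0::real) has_real_derivative (flat_exp (m + 2) x - real m * flat_exp (m + 1) x)) (at x)"
      using 2 by (simp add: flat_exp_def)
    then show ?thesis
      by (rule has_field_derivative_transform_within_open[where S="{..<0}"])
        (use 2 in \<open>auto simp: flat_exp_def\<close>)
  next
    case 3
    have "((\<lambda>y. (flat_exp m y - flat_exp m 0) / (y - 0)) \<longlongrightarrow> 0) (at 0)"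
    proof (rule filterlim_split_at)
      show "((\<lambda>y. (flat_exp m y - flat_exp m 0) / (y - 0)) \<longlongrightarrow> 0) (at_left 0)"
        by (rule Lim_transform_eventually[OF tendsto_const])
          (auto simp: flat_exp_def eventually_at_filter)
      show "((\<lambda>y. (flat_exp m y - flat_exp m 0) / (y - 0)) \<longlongrightarrow> 0) (at_right 0)"
        by (rule Lim_transform_eventually[OF flat_exp_tendsto[of "Suc m"]])
          (auto simp: flat_exp_def eventually_at_filter field_simps)
    qed
    then show ?thesis using 3 by (simp add: has_field_derivative_iff flat_exp_def)
  qed
qed

text \<open>The derivative of a member of the family is a linear combination of two other members. Hence all
members are of class \<open>C\<^sup>k\<close>, by induction on \<open>k\<close> for all \<open>m\<close> at once.\<close>

lemma smooth_flat_exp: "smooth_on (flat_exp m) S"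
proof -
  have "Ck_on k (flat_exp m) UNIV" for k
  proof (induction k arbitrary: m)
    case 0
    then show ?case
      by (auto intro!: continuous_at_imp_continuous_on DERIV_isCont flat_exp_has_derivative)
  next
    case (Suc k)
    have d: "(flat_exp m has_derivative (\<lambda>v. v * (flat_exp (m + 2) x + (- real m) * flat_exp (m + 1) x))) (at x)"
      for x
      using flat_exp_has_derivative[of m x] unfolding has_field_derivative_def
      by (rule has_derivative_eq_rhs) (auto simp: algebra_simps)
    have "Ck_on k (\<lambda>x. v * (flat_exp (m + 2) x + (- real m) * flat_exp (m + 1) x)) UNIV" for v
      by (intro Ck_on_bounded_linear[OF bounded_linear_mult_right] Ck_on_add Suc.IH) auto
    then show ?case using d
      by (auto simp: differentiable_def frechet_derivative_at[OF d, symmetric])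
  qed
  then show ?thesis unfolding smooth_on_def using Ck_on_subset[OF _ subset_UNIV] by blast
qed

definition bump :: "complex \<Rightarrow> real \<Rightarrow> complex \<Rightarrow> real" where
  "bump a r z = flat_exp 0 (r\<^sup>2 - (norm (z - a))\<^sup>2)"

lemma bump_pos_iff: "r > 0 \<Longrightarrow> bump a r z > 0 \<longleftrightarrow> z \<in> ball a r"
  by (auto simp: bump_def flat_exp_def dist_norm norm_minus_commute
      intro: power_strict_mono dest: power_less_imp_less_base)

lemma bump_nonneg: "bump a r z \<ge> 0"
  by (auto simp: bump_def flat_exp_def)

lemma bump_eq_0: "r > 0 \<Longrightarrow> z \<notin> ball a r \<Longrightarrow> bump a r z = 0"
  using bump_pos_iff bump_nonneg by (metis less_eq_real_def)

lemma smooth_bump: "open S \<Longrightarrow> smooth_on (bump a r) S"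
proof -
  assume S: "open S"
  have t: "smooth_on (\<lambda>z. z - a) S"
    using smooth_on_add[OF smooth_on_bounded_linear_map[OF bounded_linear_ident] smooth_on_const[of "-a"] S]
    by simp
  have "smooth_on (\<lambda>z. r\<^sup>2 + (- 1) * ((z - a) \<bullet> (z - a))) S"
    by (intro smooth_on_add smooth_on_const smooth_on_bilinear[OF bounded_bilinear_mult]
        smooth_on_bilinear[OF bounded_bilinear_inner] t S)
  then have "smooth_on (\<lambda>z. flat_exp 0 (r\<^sup>2 + (- 1) * ((z - a) \<bullet> (z - a)))) S"
    by (intro smooth_on_compose[OF smooth_flat_exp[of 0 UNIV]] S) auto
  then show ?thesis
    by (simp add: bump_def[abs_def] power2_norm_eq_inner)
qed

lemma bump_le_1: "bump a r z \<le> 1"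
  by (auto simp: bump_def flat_exp_def)

lemma bump_derivative_zero:
  assumes "r > 0" "z \<notin> cball a r"
  shows "frechet_derivative (bump a r) (at z) v = 0"
proof -
  have "frechet_derivative (bump a r) (at z) = frechet_derivative (\<lambda>_. 0) (at z)"
    by (rule frechet_derivative_cong_open[of "- cball a r"]) (use assms bump_eq_0 in auto)
  then show ?thesis by simp
qed

section \<open>Charts, tangent vectors and the metric in coordinates\<close>

lemma open_topology_preimage:
  fixes u :: "'a::euclidean_space \<Rightarrow> 'm"
  assumes "continuous_map (top_of_set S) T u" "open S" "openin T V"
  shows "open {z \<in> S. u z \<in> V}"
  using openin_continuous_map_preimage[OF assms(1,3)] assms(2)
  by (simp add: openin_open_eq)

lemma continuous_map_iff_open_preimages:
  fixes u :: "'a::euclidean_space \<Rightarrow> 'm"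
  assumes "open S"
  shows "continuous_map (top_of_set S) T u \<longleftrightarrow>
    u ` S \<subseteq> topspace T \<and> (\<forall>V. openin T V \<longrightarrow> open {z \<in> S. u z \<in> V})"
  using assms by (auto simp: continuous_map_def openin_open_eq)

text \<open>The local representatives \<open>u'\<close> may differ from point to point; this is the form in which piecewise
defined variations are recognised as smooth maps.\<close>

lemma smooth_map_on_local:
  fixes u :: "'a::euclidean_space \<Rightarrow> 'm" and A :: "('m, 'n::finite) chart set"
  assumes S: "open S"
    and N: "\<And>x. x \<in> S \<Longrightarrow> \<exists>N u'. open N \<and> x \<in> N \<and> N \<subseteq> S \<and> smooth_map_on T A N u' \<and> (\<forall>y\<in>N. u y = u' y)"
    and A: "\<And>c. c \<in> A \<Longrightarrow> openin T (fst c)"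
  shows "smooth_map_on T A S u"
proof -
  have N': "\<exists>N. open N \<and> x \<in> N \<and> N \<subseteq> S \<and> u ` N \<subseteq> topspace T \<and>
      (\<forall>V. openin T V \<longrightarrow> open {z \<in> N. u z \<in> V}) \<and> (\<forall>(V, \<phi>)\<in>A. smooth_on (\<phi> \<circ> u) {z \<in> N. u z \<in> V})"
    if xS: "x \<in> S" for x
  proof -
    obtain N u' where N: "open N" "x \<in> N" "N \<subseteq> S" "smooth_map_on T A N u'" "\<forall>y\<in>N. u y = u' y"
      using N[OF xS] by metis
    have c: "continuous_map (top_of_set N) T u'" using N(4) by (simp add: smooth_map_on_def)
    have e: "{z \<in> N. u z \<in> V} = {z \<in> N. u' z \<in> V}" for V using N(5) by auto
    have "smooth_on (\<phi> \<circ> u) {z \<in> N. u z \<in> V}" if "(V, \<phi>) \<in> A" for V \<phi>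
    proof -
      have "smooth_on (\<phi> \<circ> u') {z \<in> N. u' z \<in> V}" using N(4) that by (auto simp: smooth_map_on_def)
      moreover have "open {z \<in> N. u' z \<in> V}"
        using open_topology_preimage[OF c N(1)] A[OF that] by simp
      ultimately show ?thesis unfolding e using N(5)
        by (auto intro: smooth_on_cong[where f="\<phi> \<circ> u'"])
    qed
    moreover have "u ` N \<subseteq> topspace T \<and> (\<forall>V. openin T V \<longrightarrow> open {z \<in> N. u z \<in> V})"
      using c N(5) unfolding continuous_map_iff_open_preimages[OF N(1)] e by auto
    ultimately show ?thesis using N by blast
  qed
  have 1: "u ` S \<subseteq> topspace T" using N' by blast
  have 2: "open {z \<in> S. u z \<in> V}" if V: "openin T V" for V
  proof (subst open_subopen, intro ballI)
    fix z assume z: "z \<in> {z \<in> S. u z \<in> V}"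
    then obtain N where "open N" "z \<in> N" "N \<subseteq> S" "open {z \<in> N. u z \<in> V}" using N'[of z] V by auto
    then show "\<exists>R. open R \<and> z \<in> R \<and> R \<subseteq> {z \<in> S. u z \<in> V}"
      using z by (intro exI[of _ "{z \<in> N. u z \<in> V}"]) auto
  qed
  have 3: "smooth_on (\<phi> \<circ> u) {z \<in> S. u z \<in> V}" if V: "(V, \<phi>) \<in> A" for V \<phi>
  proof (rule smooth_on_local)
    fix z assume z: "z \<in> {z \<in> S. u z \<in> V}"
    then have "z \<in> S" by simp
    from N'[OF this] V obtain N where N: "open N" "z \<in> N" "N \<subseteq> S" "smooth_on (\<phi> \<circ> u) {z \<in> N. u z \<in> V}"
      by auto
    have "{z \<in> N. u z \<in> V} = N \<inter> {z \<in> S. u z \<in> V}" using N by auto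
    then show "\<exists>N. open N \<and> z \<in> N \<and> smooth_on (\<phi> \<circ> u) (N \<inter> {z \<in> S. u z \<in> V})"
      using N by metis
  qed
  show ?thesis unfolding smooth_map_on_def continuous_map_iff_open_preimages[OF S]
    using 1 2 3 by auto
qed

lemma smooth_map_on_compose:
  assumes u: "smooth_map_on T A S u" and k: "smooth_on k R" and "open R" "k ` R \<subseteq> S" "open S"
    and A: "\<And>c. c \<in> A \<Longrightarrow> openin T (fst c)"
  shows "smooth_map_on T A R (u \<circ> k)"
proof -
  have c: "continuous_map (top_of_set S) T u" using u by (simp add: smooth_map_on_def)
  have kc: "continuous_on R k" by (rule smooth_on_imp_continuous_on[OF k])
  have "continuous_map (top_of_set R) (top_of_set S) k"
    using kc assms(4) by (simp add: continuous_map_in_subtopology image_subset_iff_funcset)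
  then have 1: "continuous_map (top_of_set R) T (u \<circ> k)" using c by (rule continuous_map_compose)
  have "smooth_on (\<phi> \<circ> (u \<circ> k)) {z \<in> R. (u \<circ> k) z \<in> V}" if V: "(V, \<phi>) \<in> A" for V \<phi>
  proof -
    have o: "open {z \<in> R. (u \<circ> k) z \<in> V}"
      using open_topology_preimage[OF 1 assms(3)] A[OF V] by simp
    have "smooth_on (\<phi> \<circ> u) {z \<in> S. u z \<in> V}" using u V by (auto simp: smooth_map_on_def)
    then have "smooth_on (\<lambda>x. (\<phi> \<circ> u) (k x)) {z \<in> R. (u \<circ> k) z \<in> V}"
      by (rule smooth_on_compose[OF _ smooth_on_subset[OF k] o]) (use assms(4) in auto)
    then show ?thesis by (simp add: comp_def)
  qed
  then show ?thesis using 1 unfolding smooth_map_on_def by auto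
qed

locale riemannian =
  fixes T :: "'m topology" and A :: "('m, 'n::finite) chart set" and g :: "('m, 'n) metric"
  assumes RM: "riemannian_manifold T A g"
begin

lemma hausdorff: "Hausdorff_space T"
  using RM by (simp add: riemannian_manifold_def smooth_manifold_def)

lemma charts_cover: "q \<in> topspace T \<Longrightarrow> \<exists>V \<phi>. (V, \<phi>) \<in> A \<and> q \<in> V"
proof -
  assume "q \<in> topspace T"
  moreover have "(\<Union>c\<in>A. fst c) = topspace T"
    using RM by (simp add: riemannian_manifold_def smooth_manifold_def)
  ultimately obtain c where "c \<in> A" "q \<in> fst c" by blast
  then show ?thesis by (intro exI[of _ "fst c"] exI[of _ "snd c"]) simp
qed

lemma is_chart: "c \<in> A \<Longrightarrow> is_chart T c"
  using RM by (simp add: riemannian_manifold_def smooth_manifold_def)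

lemma chart_open: "(V, \<phi>) \<in> A \<Longrightarrow> openin T V"
  using is_chart[of "(V, \<phi>)"] by (simp add: is_chart_def)

lemma chart_open': "c \<in> A \<Longrightarrow> openin T (fst c)"
  by (cases c) (simp add: chart_open)

lemma chart_subset: "(V, \<phi>) \<in> A \<Longrightarrow> V \<subseteq> topspace T"
  using chart_open openin_subset by blast

lemma chart_image_open: "(V, \<phi>) \<in> A \<Longrightarrow> open (\<phi> ` V)"
  using is_chart[of "(V, \<phi>)"] by (simp add: is_chart_def)

lemma chart_homeo: "(V, \<phi>) \<in> A \<Longrightarrow> homeomorphic_map (subtopology T V) (top_of_set (\<phi> ` V)) \<phi>"
  using is_chart[of "(V, \<phi>)"] by (simp add: is_chart_def)

lemma chart_inj: "(V, \<phi>) \<in> A \<Longrightarrow> inj_on \<phi> V"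
  using homeomorphic_imp_injective_map[OF chart_homeo] chart_subset
  by (metis Int_absorb1 topspace_subtopology)

lemma chart_continuous: "(V, \<phi>) \<in> A \<Longrightarrow> continuous_map (subtopology T V) euclidean \<phi>"
  using homeomorphic_imp_continuous_map[OF chart_homeo] by (simp add: continuous_map_in_subtopology)

lemma chart_preimage_open:
  assumes "(V, \<phi>) \<in> A" "open N" shows "openin T {q \<in> V. \<phi> q \<in> N}"
proof -
  have "openin (subtopology T V) {q \<in> topspace (subtopology T V). \<phi> q \<in> N}"
    by (rule openin_continuous_map_preimage[OF chart_continuous[OF assms(1)]]) (use assms in simp)
  moreover have "topspace (subtopology T V) = V" using chart_subset[OF assms(1)] by auto
  ultimately show ?thesis using openin_open_subtopology[OF chart_open[OF assms(1)]] by metis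
qed

lemma chart_image_of_open:
  assumes "(V, \<phi>) \<in> A" "openin T N" shows "open (\<phi> ` (V \<inter> N))"
proof -
  have "openin (subtopology T V) (V \<inter> N)"
    using assms chart_open openin_open_subtopology by (metis Int_lower1 openin_Int)
  then have "openin (top_of_set (\<phi> ` V)) (\<phi> ` (V \<inter> N))"
    using homeomorphic_imp_open_map[OF chart_homeo[OF assms(1)]] by (simp add: open_map_def)
  then show ?thesis using chart_image_open[OF assms(1)] openin_open_eq by blast
qed

lemma chart_inv: "(V, \<phi>) \<in> A \<Longrightarrow> q \<in> V \<Longrightarrow> inv_into V \<phi> (\<phi> q) = q"
  using chart_inj by simp

lemma chart_inv_continuous:
  assumes "(V, \<phi>) \<in> A" shows "continuous_map (top_of_set (\<phi> ` V)) T (inv_into V \<phi>)"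
  unfolding continuous_map_iff_open_preimages[OF chart_image_open[OF assms]]
proof (intro conjI allI impI)
  show "inv_into V \<phi> ` \<phi> ` V \<subseteq> topspace T"
    using chart_subset[OF assms] by (auto simp: chart_inv[OF assms])
  fix N assume N: "openin T N"
  have "{z \<in> \<phi> ` V. inv_into V \<phi> z \<in> N} = \<phi> ` (V \<inter> N)" by (auto simp: chart_inv[OF assms])
  then show "open {z \<in> \<phi> ` V. inv_into V \<phi> z \<in> N}" using chart_image_of_open[OF assms N] by simp
qed

lemma transition_at: "c \<in> A \<Longrightarrow> q \<in> fst c \<Longrightarrow> transition c d (snd c q) = snd d q"
  by (cases c; cases d) (simp add: transition_def chart_inv)

lemma transition_domain_open: "c \<in> A \<Longrightarrow> d \<in> A \<Longrightarrow> open (snd c ` (fst c \<inter> fst d))"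
  using chart_image_of_open chart_open' by (metis prod.collapse)

lemma transition_smooth: "c \<in> A \<Longrightarrow> d \<in> A \<Longrightarrow> smooth_on (transition c d) (snd c ` (fst c \<inter> fst d))"
  using RM by (simp add: riemannian_manifold_def smooth_manifold_def compatible_def)

lemma transition_has_derivative:
  "c \<in> A \<Longrightarrow> d \<in> A \<Longrightarrow> q \<in> fst c \<Longrightarrow> q \<in> fst d \<Longrightarrow>
    (transition c d has_derivative frechet_derivative (transition c d) (at (snd c q))) (at (snd c q))"
  using smooth_on_imp_has_derivative[OF transition_smooth] by blast

lemma transition_linear:
  "c \<in> A \<Longrightarrow> d \<in> A \<Longrightarrow> q \<in> fst c \<Longrightarrow> q \<in> fst d \<Longrightarrow>
    linear (frechet_derivative (transition c d) (at (snd c q)))"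
  using transition_has_derivative has_derivative_linear by blast

lemma transition_chain:
  assumes "c \<in> A" "d \<in> A" "e \<in> A" and q: "q \<in> fst c" "q \<in> fst d" "q \<in> fst e"
  shows "frechet_derivative (transition c e) (at (snd c q)) a =
    frechet_derivative (transition d e) (at (snd d q)) (frechet_derivative (transition c d) (at (snd c q)) a)"
proof -
  let ?D = "frechet_derivative (transition d e) (at (snd d q)) \<circ> frechet_derivative (transition c d) (at (snd c q))"
  have "(transition d e \<circ> transition c d has_derivative ?D) (at (snd c q))"
    by (rule diff_chain_at[OF transition_has_derivative])
      (use assms transition_has_derivative[of d e q] in \<open>auto simp: transition_at\<close>)
  moreover have o: "open (snd c ` (fst c \<inter> (fst d \<inter> fst e)))"
    using chart_image_of_open[of "fst c" "snd c"] chart_open'[OF assms(2)] chart_open'[OF assms(3)] assms(1) by auto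
  ultimately have "(transition c e has_derivative ?D) (at (snd c q))"
    by (rule has_derivative_transform_within_open) (use assms in \<open>auto simp: transition_at\<close>)
  then show ?thesis by (metis comp_apply frechet_derivative_at)
qed

lemma transition_self:
  assumes "c \<in> A" "q \<in> fst c"
  shows "frechet_derivative (transition c c) (at (snd c q)) a = a"
proof -
  have "((\<lambda>x. x) has_derivative (\<lambda>x. x)) (at (snd c q))" by simp
  then have "(transition c c has_derivative (\<lambda>x. x)) (at (snd c q))"
    by (rule has_derivative_transform_within_open[OF _ transition_domain_open[OF assms(1,1)]])
      (use assms in \<open>auto simp: transition_at\<close>)
  then show ?thesis by (metis frechet_derivative_at)
qed

lemma coord_tvec_in_tangent_space:
  "c \<in> A \<Longrightarrow> q \<in> fst c \<Longrightarrow> coord_tvec A c q a \<in> tangent_space A q"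
  unfolding tangent_space_def mem_Collect_eq
proof (intro conjI allI ballI impI)
  fix d e assume "c \<in> A" "q \<in> fst c" "d \<in> A" "e \<in> A" "q \<in> fst d \<and> q \<in> fst e"
  then show "coord_tvec A c q a e = frechet_derivative (transition d e) (at (snd d q)) (coord_tvec A c q a d)"
    using transition_chain[of c d e q a] by (simp add: coord_tvec_def)
qed (auto simp: coord_tvec_def)

lemma coord_tvec_self: "c \<in> A \<Longrightarrow> q \<in> fst c \<Longrightarrow> coord_tvec A c q a c = a"
  by (simp add: coord_tvec_def transition_self)

lemma tangent_transform:
  "v \<in> tangent_space A q \<Longrightarrow> c \<in> A \<Longrightarrow> d \<in> A \<Longrightarrow> q \<in> fst c \<Longrightarrow> q \<in> fst d \<Longrightarrow>
    v d = frechet_derivative (transition c d) (at (snd c q)) (v c)"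
  unfolding tangent_space_def by blast

lemma tangent_outside: "v \<in> tangent_space A q \<Longrightarrow> \<not> (c \<in> A \<and> q \<in> fst c) \<Longrightarrow> v c = 0"
  unfolding tangent_space_def by blast

lemma tangent_eq_coord_tvec:
  assumes "v \<in> tangent_space A q" "c \<in> A" "q \<in> fst c"
  shows "v = coord_tvec A c q (v c)"
proof
  fix d show "v d = coord_tvec A c q (v c) d"
    using tangent_transform[OF assms(1,2) _ assms(3), of d] tangent_outside[OF assms(1), of d]
    unfolding coord_tvec_def by metis
qed

lemma tangent_eqI:
  "v \<in> tangent_space A q \<Longrightarrow> w \<in> tangent_space A q \<Longrightarrow> c \<in> A \<Longrightarrow> q \<in> fst c \<Longrightarrow> v c = w c \<Longrightarrow> v = w"
  using tangent_eq_coord_tvec by metis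

lemma coord_tvec_combine:
  assumes "c \<in> A" "q \<in> fst c"
  shows "coord_tvec A c q (r *\<^sub>R a + s *\<^sub>R b) =
    (\<lambda>d. r *\<^sub>R coord_tvec A c q a d + s *\<^sub>R coord_tvec A c q b d)"
  using transition_linear[OF assms(1) _ assms(2)]
  by (intro ext) (simp add: coord_tvec_def linear_add linear_scale)

lemma metric_sym: "v \<in> tangent_space A q \<Longrightarrow> w \<in> tangent_space A q \<Longrightarrow> q \<in> topspace T \<Longrightarrow> g q v w = g q w v"
  using RM by (simp add: riemannian_manifold_def riemannian_metric_def)

lemma metric_linear: "v \<in> tangent_space A q \<Longrightarrow> w \<in> tangent_space A q \<Longrightarrow> d \<in> tangent_space A q \<Longrightarrow>
   q \<in> topspace T \<Longrightarrow> g q (\<lambda>c. r *\<^sub>R v c + s *\<^sub>R w c) d = r * g q v d + s * g q w d"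
  using RM by (simp add: riemannian_manifold_def riemannian_metric_def)

lemma metric_pos: "v \<in> tangent_space A q \<Longrightarrow> q \<in> topspace T \<Longrightarrow> v \<noteq> (\<lambda>_. 0) \<Longrightarrow> g q v v > 0"
  using RM by (simp add: riemannian_manifold_def riemannian_metric_def)

abbreviation G :: "('m, 'n) chart \<Rightarrow> real ^ 'n \<Rightarrow> real ^ 'n ^ 'n" where
  "G c y \<equiv> metric_matrix A g c y"

lemma metric_coord_linear:
  assumes "c \<in> A" "q \<in> fst c" "v \<in> tangent_space A q"
  shows "linear (\<lambda>a. g q (coord_tvec A c q a) v)"
proof -
  have q: "q \<in> topspace T" using assms chart_subset by (metis prod.collapse subsetD)
  have *: "g q (coord_tvec A c q (r *\<^sub>R a + s *\<^sub>R b)) v = r * g q (coord_tvec A c q a) v + s * g q (coord_tvec A c q b) v"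
    for r s a b
    unfolding coord_tvec_combine[OF assms(1,2)]
    by (rule metric_linear) (use assms q coord_tvec_in_tangent_space in auto)
  show ?thesis
    by (rule linearI) (use *[of 1 _ 1] *[of _ _ 0] in auto)
qed

lemma metric_coord:
  assumes "c \<in> A" "q \<in> fst c"
  shows "g q (coord_tvec A c q a) (coord_tvec A c q b) = a \<bullet> (G c (snd c q) *v b)"
proof -
  have q: "q \<in> topspace T" using assms chart_subset by (metis prod.collapse subsetD)
  note ct = coord_tvec_in_tangent_space[OF assms]
  let ?e = "\<lambda>i. coord_tvec A c q (axis i 1)"
  have exp: "g q (coord_tvec A c q a) v = (\<Sum>i\<in>UNIV. a $ i * g q (?e i) v)" if "v \<in> tangent_space A q" for a v
  proof -
    have l: "linear (\<lambda>a. g q (coord_tvec A c q a) v)" by (rule metric_coord_linear[OF assms that])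
    have "g q (coord_tvec A c q a) v = g q (coord_tvec A c q (\<Sum>i\<in>UNIV. a $ i *\<^sub>R axis i 1)) v"
      using basis_expansion[of a] by (simp add: scalar_mult_eq_scaleR)
    also have "\<dots> = (\<Sum>i\<in>UNIV. a $ i * g q (?e i) v)"
      using linear_sum[OF l, of "\<lambda>i. a $ i *\<^sub>R axis i 1" UNIV] linear_scale[OF l] by simp
    finally show ?thesis .
  qed
  have Gij: "G c (snd c q) $ i $ j = g q (?e i) (?e j)" for i j
    using assms chart_inv[of "fst c" "snd c" q] by (simp add: metric_matrix_def Let_def)
  have "g q (coord_tvec A c q a) (coord_tvec A c q b) = (\<Sum>i\<in>UNIV. a $ i * (\<Sum>j\<in>UNIV. b $ j * g q (?e j) (?e i)))"
    using exp[OF ct] exp[OF ct, of b] metric_sym[OF ct ct q] by (metis (mono_tags, lifting) sum.cong)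
  also have "\<dots> = (\<Sum>i\<in>UNIV. a $ i * (\<Sum>j\<in>UNIV. G c (snd c q) $ i $ j * b $ j))"
    unfolding Gij by (subst metric_sym[OF ct ct q]) (simp add: mult.commute)
  also have "\<dots> = a \<bullet> (G c (snd c q) *v b)"
    by (simp add: inner_vec_def matrix_vector_mult_def)
  finally show ?thesis .
qed

text \<open>A tangent vector is the linear combination of the coordinate vectors given by its components, so
bilinearity expresses \<open>g\<close> through its matrix. This reduces conformality and energy to statements
about vector-valued functions.\<close>

lemma metric_in_chart:
  assumes "c \<in> A" "q \<in> fst c" "v \<in> tangent_space A q" "w \<in> tangent_space A q"
  shows "g q v w = v c \<bullet> (G c (snd c q) *v w c)"
  using metric_coord[OF assms(1,2)] tangent_eq_coord_tvec assms by metis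

lemma chart_point: "c \<in> A \<Longrightarrow> q \<in> fst c \<Longrightarrow> q \<in> topspace T"
  using chart_subset[of "fst c" "snd c"] by auto

lemma G_sym:
  assumes "c \<in> A" "y \<in> snd c ` fst c" shows "a \<bullet> (G c y *v b) = b \<bullet> (G c y *v a)"
proof -
  obtain q where q: "q \<in> fst c" "y = snd c q" using assms by blast
  note ct = coord_tvec_in_tangent_space[OF assms(1) q(1)]
  show ?thesis
    using metric_sym[OF ct[of a] ct[of b] chart_point[OF assms(1) q(1)]]
    unfolding metric_coord[OF assms(1) q(1)] q(2) .
qed

lemma G_pos:
  assumes "c \<in> A" "y \<in> snd c ` fst c" "a \<noteq> 0" shows "a \<bullet> (G c y *v a) > 0"
proof -
  obtain q where q: "q \<in> fst c" "y = snd c q" using assms by blast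
  have "coord_tvec A c q a \<noteq> (\<lambda>_. 0)" using coord_tvec_self[OF assms(1) q(1), of a] assms(3) by metis
  then have "g q (coord_tvec A c q a) (coord_tvec A c q a) > 0"
    by (rule metric_pos[OF coord_tvec_in_tangent_space[OF assms(1) q(1)] chart_point[OF assms(1) q(1)]])
  then show ?thesis unfolding metric_coord[OF assms(1) q(1)] q(2) .
qed

lemma G_smooth: "c \<in> A \<Longrightarrow> smooth_on (G c) (snd c ` fst c)"
  using RM by (simp add: riemannian_manifold_def riemannian_metric_def)

lemma smooth_map_domain_open:
  assumes "smooth_map_on T A S u" "open S" "(V, \<phi>) \<in> A"
  shows "open {z \<in> S. u z \<in> V}"
  using open_topology_preimage[OF _ assms(2) chart_open[OF assms(3)], of u] assms(1)
  by (simp add: smooth_map_on_def)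

lemma smooth_map_coord:
  assumes "smooth_map_on T A S u" "(V, \<phi>) \<in> A"
  shows "smooth_on (\<phi> \<circ> u) {z \<in> S. u z \<in> V}"
  using assms by (auto simp: smooth_map_on_def)

lemma differential_coord:
  "(V, \<phi>) \<in> A \<Longrightarrow> u z \<in> V \<Longrightarrow> differential A u z a (V, \<phi>) = frechet_derivative (\<phi> \<circ> u) (at z) a"
  by (simp add: differential_def)

lemma differential_in_tangent_space:
  assumes u: "smooth_map_on T A S u" and S: "open S" "z \<in> S"
  shows "differential A u z a \<in> tangent_space A (u z)"
proof -
  have "differential A u z a d = frechet_derivative (transition c d) (at (snd c (u z))) (differential A u z a c)"
    if cd: "c \<in> A" "d \<in> A" "u z \<in> fst c" "u z \<in> fst d" for c d
  proof -
    let ?N = "{z \<in> S. u z \<in> fst c} \<inter> {z \<in> S. u z \<in> fst d}"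
    have o: "open ?N" using cd smooth_map_domain_open[OF u S(1), of "fst c" "snd c"]
        smooth_map_domain_open[OF u S(1), of "fst d" "snd d"] by (simp add: open_Int)
    have "(snd c \<circ> u has_derivative frechet_derivative (snd c \<circ> u) (at z)) (at z)"
      by (rule smooth_on_imp_has_derivative[OF smooth_map_coord[OF u, of "fst c"]]) (use cd S in auto)
    moreover have "(transition c d has_derivative frechet_derivative (transition c d) (at ((snd c \<circ> u) z))) (at ((snd c \<circ> u) z))"
      using transition_has_derivative[OF cd] by simp
    ultimately have "(transition c d \<circ> (snd c \<circ> u) has_derivative
        frechet_derivative (transition c d) (at ((snd c \<circ> u) z)) \<circ> frechet_derivative (snd c \<circ> u) (at z)) (at z)"
      by (rule diff_chain_at)
    then have "(snd d \<circ> u has_derivative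
        frechet_derivative (transition c d) (at ((snd c \<circ> u) z)) \<circ> frechet_derivative (snd c \<circ> u) (at z)) (at z)"
      by (rule has_derivative_transform_within_open[OF _ o]) (use cd S in \<open>auto simp: transition_at\<close>)
    from frechet_derivative_at[OF this]
    have "frechet_derivative (snd d \<circ> u) (at z) a =
        frechet_derivative (transition c d) (at (snd c (u z))) (frechet_derivative (snd c \<circ> u) (at z) a)"
      by (metis comp_apply)
    then show ?thesis
      using cd differential_coord[of "fst c" "snd c" u z a] differential_coord[of "fst d" "snd d" u z a]
      by simp
  qed
  moreover have "differential A u z a c = 0" if "\<not> (c \<in> A \<and> u z \<in> fst c)" for c
    using that by (auto simp: differential_def split: prod.splits)
  ultimately show ?thesis unfolding tangent_space_def by blast
qed

lemma metric_differential:
  assumes u: "smooth_map_on T A S u" and S: "open S" "z \<in> S" and c: "(V, \<phi>) \<in> A" "u z \<in> V"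
  shows "g (u z) (differential A u z a) (differential A u z b) =
    frechet_derivative (\<phi> \<circ> u) (at z) a \<bullet> (G (V, \<phi>) (\<phi> (u z)) *v frechet_derivative (\<phi> \<circ> u) (at z) b)"
  using metric_in_chart[of "(V, \<phi>)" "u z"] differential_in_tangent_space[OF u S] c
    differential_coord[where u=u and z=z and a=a, OF c] differential_coord[where u=u and z=z and a=b, OF c] by auto

lemma smooth_map_from_chart:
  assumes c: "(V, \<phi>) \<in> A" and k: "smooth_on k S" "open S" "k ` S \<subseteq> \<phi> ` V"
  shows "smooth_map_on T A S (inv_into V \<phi> \<circ> k)"
proof -
  have kc: "continuous_map (top_of_set S) (top_of_set (\<phi> ` V)) k"
    using smooth_on_imp_continuous_on[OF k(1)] k(3) by (simp add: continuous_map_in_subtopology image_subset_iff_funcset)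
  have cm: "continuous_map (top_of_set S) T (inv_into V \<phi> \<circ> k)"
    by (rule continuous_map_compose[OF kc chart_inv_continuous[OF c]])
  have "smooth_on (\<psi> \<circ> (inv_into V \<phi> \<circ> k)) {z \<in> S. (inv_into V \<phi> \<circ> k) z \<in> W}" if d: "(W, \<psi>) \<in> A" for W \<psi>
  proof -
    have o: "open {z \<in> S. (inv_into V \<phi> \<circ> k) z \<in> W}"
      using open_topology_preimage[OF cm k(2) chart_open[OF d]] .
    have "k ` {z \<in> S. (inv_into V \<phi> \<circ> k) z \<in> W} \<subseteq> \<phi> ` (V \<inter> W)"
    proof clarsimp
      fix z assume "z \<in> S" "inv_into V \<phi> (k z) \<in> W"
      moreover then obtain q where "q \<in> V" "k z = \<phi> q" using k(3) by blast
      ultimately show "k z \<in> \<phi> ` (V \<inter> W)" using chart_inv[OF c] by auto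
    qed
    then have "smooth_on (\<lambda>z. transition (V, \<phi>) (W, \<psi>) (k z)) {z \<in> S. (inv_into V \<phi> \<circ> k) z \<in> W}"
      using smooth_on_compose[OF transition_smooth[OF c d] smooth_on_subset[OF k(1)] o] by auto
    then show ?thesis by (simp add: transition_def comp_def)
  qed
  then show ?thesis using cm unfolding smooth_map_on_def by auto
qed

end

section \<open>Second order expansions and circle means\<close>

text \<open>The linear map \<open>l\<close> is the first derivative of \<open>k\<close> at \<open>z\<close>, and \<open>B\<close> is the second one. The first
derivative is required in a neighbourhood and the second only at \<open>z\<close>, which is exactly what Taylor's
formula with the Peano remainder asks for.\<close>

definition jet2 :: "(complex \<Rightarrow> 'b::real_normed_vector) \<Rightarrow> complex \<Rightarrow> (complex \<Rightarrow> 'b) \<Rightarrow> (complex \<Rightarrow> complex \<Rightarrow> 'b) \<Rightarrow> bool" where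
  "jet2 k z l B \<longleftrightarrow> (\<exists>D. (\<forall>\<^sub>F w in nhds z. (k has_derivative D w) (at w)) \<and> D z = l \<and>
     (\<forall>a. ((\<lambda>w. D w a) has_derivative (\<lambda>b. B b a)) (at z)))"

lemma jet2_bilinear:
  fixes prod :: "'b::real_normed_vector \<Rightarrow> 'c::real_normed_vector \<Rightarrow> 'd::real_normed_vector"
  assumes "bounded_bilinear prod" "jet2 f z l B" "jet2 h z m C"
  shows "jet2 (\<lambda>w. prod (f w) (h w)) z (\<lambda>a. prod (f z) (m a) + prod (l a) (h z))
    (\<lambda>b a. prod (f z) (C b a) + prod (l b) (m a) + (prod (l a) (m b) + prod (B b a) (h z)))"
proof -
  obtain D where D: "\<forall>\<^sub>F w in nhds z. (f has_derivative D w) (at w)" "D z = l"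
    "\<And>a. ((\<lambda>w. D w a) has_derivative (\<lambda>b. B b a)) (at z)"
    using assms(2) unfolding jet2_def by auto
  obtain E where E: "\<forall>\<^sub>F w in nhds z. (h has_derivative E w) (at w)" "E z = m"
    "\<And>a. ((\<lambda>w. E w a) has_derivative (\<lambda>b. C b a)) (at z)"
    using assms(3) unfolding jet2_def by auto
  note F = bounded_bilinear.FDERIV[OF assms(1)]
  have f: "(f has_derivative l) (at z)" and h: "(h has_derivative m) (at z)"
    using eventually_nhds_x_imp_x[OF D(1)] eventually_nhds_x_imp_x[OF E(1)] D(2) E(2) by auto
  show ?thesis
    unfolding jet2_def
  proof (intro exI conjI allI)
    show "\<forall>\<^sub>F w in nhds z. ((\<lambda>w. prod (f w) (h w)) has_derivative (\<lambda>a. prod (f w) (E w a) + prod (D w a) (h w))) (at w)"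
      using D(1) E(1) by eventually_elim (rule F)
    show "((\<lambda>w. prod (f w) (E w a) + prod (D w a) (h w)) has_derivative
         (\<lambda>b. prod (f z) (C b a) + prod (l b) (m a) + (prod (l a) (m b) + prod (B b a) (h z)))) (at z)" for a
      using has_derivative_add[OF F[OF f E(3)[of a]] F[OF D(3)[of a] h]] D(2) E(2) by simp
  qed (simp add: D(2) E(2))
qed

lemma jet2_linear:
  assumes "bounded_linear L" "jet2 f z l B"
  shows "jet2 (\<lambda>w. L (f w)) z (\<lambda>a. L (l a)) (\<lambda>b a. L (B b a))"
proof -
  obtain D where D: "\<forall>\<^sub>F w in nhds z. (f has_derivative D w) (at w)" "D z = l"
    "\<And>a. ((\<lambda>w. D w a) has_derivative (\<lambda>b. B b a)) (at z)"
    using assms(2) unfolding jet2_def by auto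
  show ?thesis unfolding jet2_def
    by (intro exI[of _ "\<lambda>w a. L (D w a)"] conjI allI)
      (use D bounded_linear.has_derivative[OF assms(1)] in \<open>auto elim!: eventually_mono\<close>)
qed

lemma jet2_add:
  assumes "jet2 f z l B" "jet2 h z m C"
  shows "jet2 (\<lambda>w. f w + h w) z (\<lambda>a. l a + m a) (\<lambda>b a. B b a + C b a)"
proof -
  obtain D where D: "\<forall>\<^sub>F w in nhds z. (f has_derivative D w) (at w)" "D z = l"
    "\<And>a. ((\<lambda>w. D w a) has_derivative (\<lambda>b. B b a)) (at z)"
    using assms(1) unfolding jet2_def by auto
  obtain E where E: "\<forall>\<^sub>F w in nhds z. (h has_derivative E w) (at w)" "E z = m"
    "\<And>a. ((\<lambda>w. E w a) has_derivative (\<lambda>b. C b a)) (at z)"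
    using assms(2) unfolding jet2_def by auto
  show ?thesis unfolding jet2_def
  proof (intro exI conjI allI)
    show "\<forall>\<^sub>F w in nhds z. ((\<lambda>w. f w + h w) has_derivative (\<lambda>a. D w a + E w a)) (at w)"
      using D(1) E(1) by eventually_elim (rule has_derivative_add)
    show "((\<lambda>w. D w a + E w a) has_derivative (\<lambda>b. B b a + C b a)) (at z)" for a
      by (rule has_derivative_add[OF D(3) E(3)])
  qed (simp add: D(2) E(2))
qed

lemma jet2_const: "jet2 (\<lambda>w. c) z (\<lambda>a. 0) (\<lambda>b a. 0)"
  unfolding jet2_def by (intro exI[of _ "\<lambda>w a. 0"]) auto

lemma jet2_ident: "jet2 (\<lambda>w. w) z (\<lambda>a. a) (\<lambda>b a. 0)"
  unfolding jet2_def by (intro exI[of _ "\<lambda>w a. a"]) auto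

lemma jet2_compose:
  fixes F :: "real \<Rightarrow> real"
  assumes "jet2 f z l B"
    and F: "\<And>t. t \<in> S \<Longrightarrow> (F has_real_derivative F' t) (at t)" "open S" "f z \<in> S"
    and F': "(F' has_real_derivative F'') (at (f z))"
  shows "jet2 (\<lambda>w. F (f w)) z (\<lambda>a. F' (f z) * l a) (\<lambda>b a. F' (f z) * B b a + F'' * l b * l a)"
proof -
  obtain D where D: "\<forall>\<^sub>F w in nhds z. (f has_derivative D w) (at w)" "D z = l"
    "\<And>a. ((\<lambda>w. D w a) has_derivative (\<lambda>b. B b a)) (at z)"
    using assms(1) unfolding jet2_def by auto
  have f: "(f has_derivative l) (at z)" using eventually_nhds_x_imp_x[OF D(1)] D(2) by auto
  have "(f \<longlongrightarrow> f z) (nhds z)"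
    using has_derivative_continuous[OF f] by (simp add: continuous_at isCont_def tendsto_nhds_iff)
  then have S: "\<forall>\<^sub>F w in nhds z. f w \<in> S" using F(2,3) by (rule topological_tendstoD)
  have ch: "((\<lambda>w. H (f w)) has_derivative (\<lambda>a. H' * m a)) (at w)"
    if "(H has_real_derivative H') (at (f w))" "(f has_derivative m) (at w)" for H H' m w
    using diff_chain_at[OF that(2), of H "\<lambda>x. H' * x"] that(1)
    by (simp add: comp_def has_field_derivative_def)
  show ?thesis unfolding jet2_def
  proof (intro exI conjI allI)
    show "\<forall>\<^sub>F w in nhds z. ((\<lambda>w. F (f w)) has_derivative (\<lambda>a. F' (f w) * D w a)) (at w)"
      using D(1) S by eventually_elim (rule ch[OF F(1)])
    show "((\<lambda>w. F' (f w) * D w a) has_derivative (\<lambda>b. F' (f z) * B b a + F'' * l b * l a)) (at z)" for a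
      using has_derivative_mult[OF ch[OF F' f] D(3)[of a]] D(2) by simp
  qed (simp add: D(2))
qed

lemma derivative_zero_of_eventually_zero:
  fixes f :: "'a::real_normed_vector \<Rightarrow> 'b::real_normed_vector"
  assumes "(f has_derivative f') (at z)" "\<forall>\<^sub>F v in nhds z. f v = 0"
  shows "f' b = 0"
proof -
  obtain S where S: "open S" "z \<in> S" "\<And>v. v \<in> S \<Longrightarrow> f v = 0"
    using assms(2) unfolding eventually_nhds by auto
  have "((\<lambda>v. 0) has_derivative f') (at z)"
    by (rule has_derivative_transform_within_open[OF assms(1) S(1,2)]) (simp add: S(3))
  then have "f' = (\<lambda>b. 0)" by (rule has_derivative_unique) simp
  then show ?thesis by simp
qed

text \<open>Along the segment from \<open>z\<close> to \<open>z + w\<close> the derivative of \<open>k\<close> minus its quadratic expansion is at most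
\<open>e\<close> times the square of the norm of \<open>w\<close>; the mean value theorem does the rest.\<close>

lemma jet2_taylor:
  fixes k :: "complex \<Rightarrow> real"
  assumes k: "jet2 k z l B" and "e > 0"
  shows "\<exists>d>0. \<forall>w. norm w < d \<longrightarrow> k (z + w) \<ge> k z + l w + B w w / 2 - e * (norm w)\<^sup>2"
proof -
  obtain D where D: "\<forall>\<^sub>F w in nhds z. (k has_derivative D w) (at w)" "D z = l"
    "\<And>a. ((\<lambda>w. D w a) has_derivative (\<lambda>b. B b a)) (at z)"
    using k unfolding jet2_def by auto
  have B: "linear (\<lambda>b. B b a)" for a using D(3) has_derivative_linear by blast
  obtain d1 where d1: "d1 > 0" "\<And>w. dist w z < d1 \<Longrightarrow> (k has_derivative D w) (at w)"
    using D(1) unfolding eventually_nhds_metric by auto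
  have exp: "\<exists>d>0. \<forall>w. norm (w - z) < d \<longrightarrow> \<bar>D w a - l a - B (w - z) a\<bar> \<le> e/2 * norm (w - z)" for a
    using D(3)[of a] \<open>e > 0\<close> unfolding has_derivative_at_alt D(2)
    by (metis half_gt_zero real_norm_def)
  obtain d2 where d2: "d2 > 0" "\<And>w. norm (w - z) < d2 \<Longrightarrow> \<bar>D w 1 - l 1 - B (w - z) 1\<bar> \<le> e/2 * norm (w - z)"
    using exp by metis
  obtain d3 where d3: "d3 > 0" "\<And>w. norm (w - z) < d3 \<Longrightarrow> \<bar>D w \<i> - l \<i> - B (w - z) \<i>\<bar> \<le> e/2 * norm (w - z)"
    using exp by metis
  define d where "d = Min {d1, d2, d3}"
  have d: "d > 0" "d \<le> d1" "d \<le> d2" "d \<le> d3" using d1 d2 d3 by (auto simp: d_def)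
  have lin: "L w = Re w * L 1 + Im w * L \<i>" if "linear L" for L :: "complex \<Rightarrow> real" and w
    using linear_euclidean_expand[OF that, of w] by (simp add: Basis_complex_def)
  have Dlin: "linear (D w)" if "dist w z < d1" for w using d1(2)[OF that] has_derivative_linear by blast
  have Dz: "\<bar>D (z + b) w - l w - B b w\<bar> \<le> e * norm b * norm w" if b: "norm b < d" for b w
  proof -
    have Bl: "B b w = Re w * B b 1 + Im w * B b \<i>"
    proof -
      have "((\<lambda>v. D v w - Re w * D v 1 - Im w * D v \<i>) has_derivative (\<lambda>b. B b w - Re w * B b 1 - Im w * B b \<i>)) (at z)"
        by (intro has_derivative_diff has_derivative_mult_right D(3))
      moreover have "\<forall>\<^sub>F v in nhds z. D v w - Re w * D v 1 - Im w * D v \<i> = 0"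
        unfolding eventually_nhds_metric
      proof (intro exI conjI allI impI)
        fix v assume "dist v z < d1"
        from lin[OF Dlin[OF this], of w] show "D v w - Re w * D v 1 - Im w * D v \<i> = 0" by linarith
      qed (rule d1(1))
      ultimately have "B b w - Re w * B b 1 - Im w * B b \<i> = 0" by (rule derivative_zero_of_eventually_zero)
      then show ?thesis by linarith
    qed
    have l: "D (z + b) w = Re w * D (z + b) 1 + Im w * D (z + b) \<i>" "l w = Re w * l 1 + Im w * l \<i>"
      using lin[OF Dlin[of "z + b"], of w] lin[OF Dlin[of z], of w] b d D(2) d1(1) by (auto simp: dist_norm)
    have "\<bar>D (z + b) w - l w - B b w\<bar> = \<bar>Re w * (D (z + b) 1 - l 1 - B b 1) + Im w * (D (z + b) \<i> - l \<i> - B b \<i>)\<bar>"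
      unfolding Bl l by (simp add: algebra_simps)
    also have "\<dots> \<le> \<bar>Re w\<bar> * \<bar>D (z + b) 1 - l 1 - B b 1\<bar> + \<bar>Im w\<bar> * \<bar>D (z + b) \<i> - l \<i> - B b \<i>\<bar>"
      by (metis abs_mult abs_triangle_ineq)
    also have "\<dots> \<le> norm w * (e/2 * norm b) + norm w * (e/2 * norm b)"
      using d2(2)[of "z + b"] d3(2)[of "z + b"] b d abs_Re_le_cmod[of w] abs_Im_le_cmod[of w]
      by (intro add_mono mult_mono) auto
    finally show ?thesis by (simp add: algebra_simps)
  qed
  have "k (z + w) \<ge> k z + l w + B w w / 2 - e * (norm w)\<^sup>2" if w: "norm w < d" for w
  proof -
    define p where "p t = k (z + of_real t * w) - t * l w - t\<^sup>2 * (B w w / 2) + e * (norm w)\<^sup>2 * t" for t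
    have der: "(p has_real_derivative (D (z + of_real t * w) w - l w - t * B w w + e * (norm w)\<^sup>2)) (at t)"
      if "0 \<le> t" "t \<le> 1" for t
    proof -
      have "norm (of_real t * w) \<le> norm w" using that by (simp add: norm_mult mult_left_le_one_le)
      then have "dist (z + of_real t * w) z < d1" using w d by (simp add: dist_norm)
      from d1(2)[OF this] have kd: "(k has_derivative D (z + of_real t * w)) (at (z + of_real t * w))" .
      have "((\<lambda>t. z + of_real t * w) has_derivative (\<lambda>s. of_real s * w)) (at t)"
        by (auto intro!: derivative_eq_intros)
      from diff_chain_at[OF this kd]
      have "((\<lambda>t. k (z + of_real t * w)) has_derivative (\<lambda>s. D (z + of_real t * w) (of_real s * w))) (at t)"
        by (simp add: comp_def)
      moreover have "D (z + of_real t * w) (of_real s * w) = D (z + of_real t * w) w * s" for s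
        using linear_scale[OF has_derivative_linear[OF kd], of s w] by (simp add: scaleR_conv_of_real)
      ultimately have "((\<lambda>t. k (z + of_real t * w)) has_real_derivative D (z + of_real t * w) w) (at t)"
        by (simp add: has_field_derivative_def fun_eq_iff[symmetric])
      then show ?thesis unfolding p_def
        by (auto intro!: derivative_eq_intros)
    qed
    have "p 0 \<le> p 1"
    proof (rule DERIV_nonneg_imp_nondecreasing[where f=p and a=0 and b=1])
      fix t :: real assume t: "0 \<le> t" "t \<le> 1"
      have nb: "norm (of_real t * w) \<le> norm w" using t by (simp add: norm_mult mult_left_le_one_le)
      have "B (of_real t * w) w = t * B w w"
        using linear_scale[OF B, of t w w] by (simp add: scaleR_conv_of_real)
      then have "\<bar>D (z + of_real t * w) w - l w - t * B w w\<bar> \<le> e * norm (of_real t * w) * norm w"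
        using Dz[of "of_real t * w" w] nb w by simp
      also have "\<dots> \<le> e * norm w * norm w" using nb \<open>e > 0\<close> by (intro mult_right_mono mult_left_mono) auto
      finally have "D (z + of_real t * w) w - l w - t * B w w + e * (norm w)\<^sup>2 \<ge> 0"
        by (simp add: power2_eq_square)
      then show "\<exists>y. (p has_real_derivative y) (at t) \<and> 0 \<le> y" using der[OF t] by blast
    qed simp
    then show ?thesis by (simp add: p_def)
  qed
  then show ?thesis using d(1) by auto
qed

text \<open>The positive part of \<open>v\<close> is at most that of \<open>u\<close>, and the negative part of \<open>v\<close> is at least that of \<open>u\<close>.
Only the integral of the latter can be infinite, and it enters with a minus sign.\<close>

lemma circle_mean_le:
  assumes le: "\<And>t. t \<in> {0..2*pi} \<Longrightarrow> v (z + of_real r * cis t) \<le> ereal (u t)"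
    and cont: "continuous_on {0..2*pi} u"
  shows "circle_mean v z r \<le> ereal (1 / (2 * pi) * integral {0..2*pi} u)"
proof -
  let ?I = "{0..2*pi}"
  let ?p = "\<integral>\<^sup>+t\<in>?I. e2ennreal (v (z + of_real r * cis t)) \<partial>lborel"
  let ?n = "\<integral>\<^sup>+t\<in>?I. e2ennreal (- v (z + of_real r * cis t)) \<partial>lborel"
  let ?P = "\<integral>\<^sup>+t. ennreal (indicator ?I t *\<^sub>R u t) \<partial>lborel"
  let ?N = "\<integral>\<^sup>+t. ennreal (- (indicator ?I t *\<^sub>R u t)) \<partial>lborel"
  have int: "set_integrable lborel ?I u" by (rule borel_integrable_atLeastAtMost') (rule cont)
  have int': "integrable lborel (\<lambda>t. indicator ?I t *\<^sub>R u t)" using int by (simp add: set_integrable_def)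
  have p: "?p \<le> ?P"
  proof (rule nn_integral_mono)
    fix t
    show "e2ennreal (v (z + of_real r * cis t)) * indicator ?I t \<le> ennreal (indicator ?I t *\<^sub>R u t)"
      using e2ennreal_mono[OF le[of t]] by (auto simp: indicator_def)
  qed
  have n: "?N \<le> ?n"
  proof (rule nn_integral_mono)
    fix t
    have "e2ennreal (- ereal (u t)) \<le> e2ennreal (- v (z + of_real r * cis t))" if "t \<in> ?I"
      using le[OF that] by (intro e2ennreal_mono) (metis ereal_minus_le_minus)
    then show "ennreal (- (indicator ?I t *\<^sub>R u t)) \<le> e2ennreal (- v (z + of_real r * cis t)) * indicator ?I t"
      by (auto simp: indicator_def)
  qed
  have fin: "?P < \<infinity>" "?N < \<infinity>"
    using int' by (auto elim!: integrableE simp: top.not_eq_extremum real_integrable_def)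
  have I: "integral ?I u = enn2real ?P - enn2real ?N"
    using set_borel_integral_eq_integral(2)[OF int] real_lebesgue_integral_def[OF int']
    by (simp add: set_lebesgue_integral_def)
  have "enn2ereal ?p - enn2ereal ?n \<le> enn2ereal ?P - enn2ereal ?N"
    using p n by (intro ereal_minus_mono) (auto simp: less_eq_ennreal.rep_eq)
  also have "\<dots> = ereal (enn2real ?P - enn2real ?N)"
    using fin by (cases ?P; cases ?N) (auto simp: enn2ereal_ennreal)
  finally have "enn2ereal ?p - enn2ereal ?n \<le> ereal (integral ?I u)" by (simp add: I)
  then have "ereal (1 / (2 * pi)) * (enn2ereal ?p - enn2ereal ?n) \<le> ereal (1 / (2 * pi)) * ereal (integral ?I u)"
    by (intro ereal_mult_left_mono) auto
  then show ?thesis unfolding circle_mean_def by simp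
qed

lemma circle_mean_le_const:
  assumes "\<And>t. v (z + of_real r * cis t) \<le> ereal c"
  shows "circle_mean v z r \<le> ereal c"
  using circle_mean_le[of v z r "\<lambda>t. c"] assms by simp

lemma circle_mean_cong:
  assumes "\<And>w. w \<in> cball z r \<Longrightarrow> v w = v' w" "r > 0"
  shows "circle_mean v z r = circle_mean v' z r"
proof -
  have "v (z + complex_of_real r * cis t) = v' (z + complex_of_real r * cis t)" for t
    using assms by (intro assms(1)) (simp add: dist_norm norm_mult)
  then show ?thesis unfolding circle_mean_def by presburger
qed

text \<open>This is how second derivatives are used although \<open>v\<close> has none. If \<open>v - v z\<close> stays below \<open>- k\<close> near
\<open>z\<close>, then the sub-mean value property forces the mean of \<open>k\<close> over small circles to be at most \<open>0\<close>. But
that mean is \<open>r\<^sup>2 / 4\<close> times the Laplacian of \<open>k\<close> up to terms of smaller order.\<close>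

lemma laplacian_nonpos_at_touching_point:
  fixes k :: "complex \<Rightarrow> real"
  assumes k: "jet2 k z l B" and k0: "k z = 0" and R: "R > 0"
    and sub: "\<And>r. 0 < r \<Longrightarrow> r < R \<Longrightarrow> v z \<le> circle_mean v z r"
    and v0: "v z = ereal v0"
    and touch: "\<And>w. norm w < R \<Longrightarrow> v (z + w) \<le> ereal (v0 - k (z + w))"
  shows "B 1 1 + B \<i> \<i> \<le> 0"
proof (rule ccontr)
  assume neg: "\<not> ?thesis"
  define e where "e = (B 1 1 + B \<i> \<i>) / 8"
  have e: "e > 0" using neg by (simp add: e_def)
  obtain d where d: "d > 0" "\<And>w. norm w < d \<Longrightarrow> k (z + w) \<ge> k z + l w + B w w / 2 - e * (norm w)\<^sup>2"
    using jet2_taylor[OF k e] by auto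
  define r where "r = min d R / 2"
  have r: "r > 0" "r < d" "r < R" using d R by (auto simp: r_def)
  obtain D where D: "\<forall>\<^sub>F w in nhds z. (k has_derivative D w) (at w)" "D z = l"
    "\<And>a. ((\<lambda>w. D w a) has_derivative (\<lambda>b. B b a)) (at z)"
    using k unfolding jet2_def by auto
  have l: "linear l" using eventually_nhds_x_imp_x[OF D(1)] D(2) has_derivative_linear by metis
  have B: "linear (\<lambda>b. B b a)" for a using D(3) has_derivative_linear by blast
  have Ba: "linear (B b)" for b
  proof -
    have "\<forall>\<^sub>F w in nhds z. linear (D w)" using D(1) by eventually_elim (rule has_derivative_linear)
    then have ev: "\<forall>\<^sub>F w in nhds z. D w (x *\<^sub>R a + y *\<^sub>R c) - x * D w a - y * D w c = 0" for x y a c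
      by eventually_elim (simp add: linear_add linear_scale)
    have "B b (x *\<^sub>R a + y *\<^sub>R c) = x * B b a + y * B b c" for x y a c
    proof -
      have "((\<lambda>w. D w (x *\<^sub>R a + y *\<^sub>R c) - x * D w a - y * D w c) has_derivative
          (\<lambda>b. B b (x *\<^sub>R a + y *\<^sub>R c) - x * B b a - y * B b c)) (at z)"
        by (intro has_derivative_diff has_derivative_mult_right D(3))
      from derivative_zero_of_eventually_zero[OF this ev, of b] show ?thesis by linarith
    qed
    from this[of 1 _ 1] this[of _ _ 0] show ?thesis by (intro linearI) auto
  qed
  have lin: "L w = Re w * L 1 + Im w * L \<i>" if "linear L" for L :: "complex \<Rightarrow> real" and w
    using linear_euclidean_expand[OF that, of w] by (simp add: Basis_complex_def)
  define u where "u t = v0 - (r * (cos t * l 1 + sin t * l \<i>) + r\<^sup>2 / 2 *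
     (B 1 1 * (cos t)\<^sup>2 + (B 1 \<i> + B \<i> 1) * (sin t * cos t) + B \<i> \<i> * (sin t)\<^sup>2) - e * r\<^sup>2)" for t
  define U where "U t = (v0 + e * r\<^sup>2) * t - (r * (sin t * l 1 - cos t * l \<i>) + r\<^sup>2 / 2 *
     (B 1 1 * ((t + sin t * cos t) / 2) + (B 1 \<i> + B \<i> 1) * ((sin t)\<^sup>2 / 2) + B \<i> \<i> * ((t - sin t * cos t) / 2)))" for t
  have "(U has_real_derivative u t) (at t)" for t
  proof -
    have sc: "(cos t)\<^sup>2 = 1 - (sin t)\<^sup>2" by (simp add: cos_squared_eq)
    have "(U has_real_derivative (v0 + e * r\<^sup>2) - (r * (cos t * l 1 + sin t * l \<i>) + r\<^sup>2 / 2 *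
     (B 1 1 * ((1 + (cos t * cos t - sin t * sin t)) / 2) + (B 1 \<i> + B \<i> 1) * (2 * sin t * cos t / 2) +
       B \<i> \<i> * ((1 - (cos t * cos t - sin t * sin t)) / 2)))) (at t)"
      unfolding U_def by (auto intro!: derivative_eq_intros simp: field_simps)
    moreover have "(1 + (cos t * cos t - sin t * sin t)) / 2 = (cos t)\<^sup>2"
      "(1 - (cos t * cos t - sin t * sin t)) / 2 = (sin t)\<^sup>2" "2 * sin t * cos t / 2 = sin t * cos t"
      using sc by (simp_all add: power2_eq_square)
    moreover have "v0 + e * r\<^sup>2 - X = v0 - (X - e * r\<^sup>2)" for X by simp
    ultimately show ?thesis unfolding u_def by (simp only:)
  qed
  then have "(u has_integral U (2*pi) - U 0) {0..2*pi}"
    by (intro fundamental_theorem_of_calculus)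
      (auto simp: has_real_derivative_iff_has_vector_derivative[symmetric] has_field_derivative_at_within)
  then have I: "integral {0..2*pi} u = 2 * pi * (v0 + e * r\<^sup>2) - r\<^sup>2 / 2 * (pi * (B 1 1 + B \<i> \<i>))"
    by (simp add: integral_unique U_def algebra_simps)
  have "v (z + of_real r * cis t) \<le> ereal (u t)" for t
  proof -
    let ?w = "of_real r * cis t"
    have n: "norm ?w = r" using r by (simp add: norm_mult)
    have lw: "l ?w = r * (cos t * l 1 + sin t * l \<i>)"
      using lin[OF l, of ?w] by (simp add: algebra_simps)
    have "B ?w ?w = r * cos t * B ?w 1 + r * sin t * B ?w \<i>"
      using lin[OF Ba, of ?w ?w] by simp
    also have "B ?w 1 = r * cos t * B 1 1 + r * sin t * B \<i> 1" using lin[OF B, of ?w 1] by simp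
    also have "B ?w \<i> = r * cos t * B 1 \<i> + r * sin t * B \<i> \<i>" using lin[OF B, of ?w \<i>] by simp
    finally have Bw: "B ?w ?w = r\<^sup>2 * (B 1 1 * (cos t)\<^sup>2 + (B 1 \<i> + B \<i> 1) * (sin t * cos t) + B \<i> \<i> * (sin t)\<^sup>2)"
      by (simp add: algebra_simps power2_eq_square)
    have "v (z + ?w) \<le> ereal (v0 - k (z + ?w))" using touch[of ?w] n r by simp
    also have "v0 - k (z + ?w) \<le> u t" using d(2)[of ?w] n r k0 unfolding u_def lw Bw by simp
    finally show ?thesis by simp
  qed
  then have "circle_mean v z r \<le> ereal (1 / (2 * pi) * integral {0..2*pi} u)"
    by (intro circle_mean_le) (auto simp: u_def intro!: continuous_intros)
  then have "v0 \<le> 1 / (2 * pi) * integral {0..2*pi} u"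
    using sub[of r] r v0 by (metis ereal_less_eq(3) order_trans)
  also have "\<dots> = v0 + e * r\<^sup>2 - r\<^sup>2 / 4 * (B 1 1 + B \<i> \<i>)"
    unfolding I by (simp add: field_simps)
  also have "\<dots> = v0 - e * r\<^sup>2" by (simp add: e_def algebra_simps)
  finally have "e * r\<^sup>2 \<le> 0" by simp
  moreover have "e * r\<^sup>2 > 0" using e r by simp
  ultimately show False by simp
qed

section \<open>Rescaling discs\<close>

lemma lborel_integral_affine:
  fixes f :: "'a::euclidean_space \<Rightarrow> real"
  assumes c: "c \<noteq> 0"
  shows "integral\<^sup>L lborel f = \<bar>c\<bar> ^ DIM('a) * integral\<^sup>L lborel (\<lambda>x. f (t + c *\<^sub>R x))"
proof (cases "f \<in> borel_measurable borel")
  case True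
  have m: "(\<lambda>x. t + c *\<^sub>R x) \<in> borel_measurable lborel" by simp
  have "integral\<^sup>L lborel f = integral\<^sup>L (density (distr lborel borel (\<lambda>x. t + c *\<^sub>R x)) (\<lambda>_. ennreal (\<bar>c\<bar> ^ DIM('a)))) f"
    using lborel_affine[OF c, of t] by simp
  also have "\<dots> = integral\<^sup>L (distr lborel borel (\<lambda>x. t + c *\<^sub>R x)) (\<lambda>x. \<bar>c\<bar> ^ DIM('a) *\<^sub>R f x)"
    using True by (intro integral_density) auto
  also have "\<dots> = \<bar>c\<bar> ^ DIM('a) * integral\<^sup>L lborel (\<lambda>x. f (t + c *\<^sub>R x))"
    using True by (subst integral_distr) auto
  finally show ?thesis .
next
  case False
  \<comment> \<open>Without measurability both integrals have the default value \<open>0\<close>.\<close>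
  have "(\<lambda>x. f (t + c *\<^sub>R x)) \<notin> borel_measurable borel"
  proof
    assume "(\<lambda>x. f (t + c *\<^sub>R x)) \<in> borel_measurable borel"
    then have "(\<lambda>x. f (t + c *\<^sub>R ((1 / c) *\<^sub>R (x - t)))) \<in> borel_measurable borel"
      by (rule measurable_compose[rotated]) simp
    then show False using False c by simp
  qed
  then have "\<not> integrable lborel (\<lambda>x. f (t + c *\<^sub>R x))" "\<not> integrable lborel f"
    using False borel_measurable_integrable by fastforce+
  then show ?thesis by (simp add: not_integrable_integral_eq)
qed

lemma set_lborel_integral_rescale_complex:
  fixes f :: "complex \<Rightarrow> real"
  assumes b: "b > 0"
  shows "set_lebesgue_integral lborel ((\<lambda>z. z0 + b *\<^sub>R z) ` K) f =
    b\<^sup>2 * set_lebesgue_integral lborel K (\<lambda>z. f (z0 + b *\<^sub>R z))"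
proof -
  have "indicator ((\<lambda>z. z0 + b *\<^sub>R z) ` K) (z0 + b *\<^sub>R z) = (indicator K z :: real)" for z
    using b by (auto simp: indicator_def)
  then show ?thesis
    unfolding set_lebesgue_integral_def
    using lborel_integral_affine[of b "\<lambda>z. indicator ((\<lambda>z. z0 + b *\<^sub>R z) ` K) z *\<^sub>R f z" z0] b by simp
qed

context riemannian begin

lemma differential_cong:
  assumes "open N" "z \<in> N" "\<And>w. w \<in> N \<Longrightarrow> u w = u' w"
  shows "differential A u z = differential A u' z"
proof (intro ext)
  fix a and c :: "('m, 'n) chart"
  have "frechet_derivative (snd c \<circ> u) (at z) = frechet_derivative (snd c \<circ> u') (at z)"
    by (rule frechet_derivative_cong_open[OF assms(1,2)]) (simp add: assms(3))
  then show "differential A u z a c = differential A u' z a c"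
    using assms(3)[OF assms(2)] by (cases c) (simp add: differential_def)
qed

lemma differential_rescale:
  fixes u :: "'a::euclidean_space \<Rightarrow> 'm"
  assumes u: "smooth_map_on T A S u" and S: "open S" "z0 + b *\<^sub>R z \<in> S"
  shows "differential A (\<lambda>z. u (z0 + b *\<^sub>R z)) z a = (\<lambda>c. b *\<^sub>R differential A u (z0 + b *\<^sub>R z) a c)"
proof
  fix c :: "('m, 'n) chart"
  obtain V \<phi> where c: "c = (V, \<phi>)" by fastforce
  show "differential A (\<lambda>z. u (z0 + b *\<^sub>R z)) z a c = b *\<^sub>R differential A u (z0 + b *\<^sub>R z) a c"
  proof (cases "(V, \<phi>) \<in> A \<and> u (z0 + b *\<^sub>R z) \<in> V")
    case True
    have d: "(\<phi> \<circ> u has_derivative frechet_derivative (\<phi> \<circ> u) (at (z0 + b *\<^sub>R z))) (at (z0 + b *\<^sub>R z))"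
      by (rule smooth_on_imp_has_derivative[OF smooth_map_coord[OF u, of V]]) (use True S in auto)
    have "((\<lambda>z. z0 + b *\<^sub>R z) has_derivative (\<lambda>a. b *\<^sub>R a)) (at z)" by (auto intro!: derivative_eq_intros)
    from diff_chain_at[OF this d]
    have "(\<phi> \<circ> (\<lambda>z. u (z0 + b *\<^sub>R z)) has_derivative (\<lambda>a. frechet_derivative (\<phi> \<circ> u) (at (z0 + b *\<^sub>R z)) (b *\<^sub>R a))) (at z)"
      by (simp add: comp_def)
    from frechet_derivative_at[OF this]
    have "frechet_derivative (\<phi> \<circ> (\<lambda>z. u (z0 + b *\<^sub>R z))) (at z) a = frechet_derivative (\<phi> \<circ> u) (at (z0 + b *\<^sub>R z)) (b *\<^sub>R a)"
      by metis
    then show ?thesis using True linear_scale[OF has_derivative_linear[OF d], of b a] by (simp add: c differential_def)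
  next
    case False
    then show ?thesis by (auto simp: c differential_def)
  qed
qed

lemma metric_scale:
  assumes "v \<in> tangent_space A q" "w \<in> tangent_space A q" "q \<in> topspace T"
    and bw: "(\<lambda>c. b *\<^sub>R w c) \<in> tangent_space A q"
  shows "g q (\<lambda>c. b *\<^sub>R v c) (\<lambda>c. b *\<^sub>R w c) = b\<^sup>2 * g q v w"
proof -
  have "g q (\<lambda>c. b *\<^sub>R v c) (\<lambda>c. b *\<^sub>R w c) = b * g q v (\<lambda>c. b *\<^sub>R w c)"
    using metric_linear[OF assms(1,1) bw assms(3), of b 0] by simp
  also have "g q v (\<lambda>c. b *\<^sub>R w c) = g q (\<lambda>c. b *\<^sub>R w c) v" by (rule metric_sym[OF assms(1) bw assms(3)])
  also have "\<dots> = b * g q w v" using metric_linear[OF assms(2,2,1,3), of b 0] by simp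
  also have "g q w v = g q v w" by (rule metric_sym[OF assms(2,1,3)])
  finally show ?thesis by (simp add: power2_eq_square)
qed

lemma smooth_rescale:
  fixes u :: "'a::euclidean_space \<Rightarrow> 'm"
  assumes u: "smooth_map_on T A S u" and "open S" "open R" "\<And>z. z \<in> R \<Longrightarrow> z0 + b *\<^sub>R z \<in> S"
  shows "smooth_map_on T A R (\<lambda>z. u (z0 + b *\<^sub>R z))"
proof -
  have "smooth_on (\<lambda>z. z0 + b *\<^sub>R z) R"
    by (intro smooth_on_add smooth_on_const smooth_on_bounded_linear_map bounded_linear_scaleR_right assms)
  from smooth_map_on_compose[OF u this assms(3) _ assms(2) chart_open'] show ?thesis
    using assms(4) by (simp add: comp_def image_subset_iff)
qed

lemma metric_differential_rescale:
  fixes u :: "complex \<Rightarrow> 'm"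
  assumes u: "smooth_map_on T A S u" and S: "open S" "z0 + b *\<^sub>R z \<in> S"
  shows "g (u (z0 + b *\<^sub>R z)) (differential A (\<lambda>z. u (z0 + b *\<^sub>R z)) z a) (differential A (\<lambda>z. u (z0 + b *\<^sub>R z)) z c) =
    b\<^sup>2 * g (u (z0 + b *\<^sub>R z)) (differential A u (z0 + b *\<^sub>R z) a) (differential A u (z0 + b *\<^sub>R z) c)"
proof -
  let ?R = "{z. z0 + b *\<^sub>R z \<in> S}"
  have "continuous_on UNIV (\<lambda>z. z0 + b *\<^sub>R z)" by (intro continuous_intros)
  from open_vimage[OF S(1) this] have o: "open ?R" by (simp add: vimage_def)
  have "smooth_map_on T A ?R (\<lambda>z. u (z0 + b *\<^sub>R z))" by (rule smooth_rescale[OF u S(1) o]) simp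
  from differential_in_tangent_space[OF this o] S(2)
  have "differential A (\<lambda>z. u (z0 + b *\<^sub>R z)) z c \<in> tangent_space A (u (z0 + b *\<^sub>R z))" by simp
  moreover have "u (z0 + b *\<^sub>R z) \<in> topspace T"
    using u S(2) by (auto simp: smooth_map_on_def continuous_map_def)
  ultimately show ?thesis
    unfolding differential_rescale[OF u S]
    by (intro metric_scale differential_in_tangent_space[OF u S]) auto
qed

lemma energy_density_rescale:
  fixes u :: "complex \<Rightarrow> 'm"
  assumes "smooth_map_on T A S u" "open S" "z0 + b *\<^sub>R z \<in> S"
  shows "energy_density A g (\<lambda>z. u (z0 + b *\<^sub>R z)) z = b\<^sup>2 * energy_density A g u (z0 + b *\<^sub>R z)"
  unfolding energy_density_def metric_differential_rescale[OF assms] by (simp add: algebra_simps)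

text \<open>A variation of the subdisc extends by the original disc to a variation of the latter. Its energy is
the same: the factor \<open>b\<^sup>2\<close> of the energy density cancels the one of the area.\<close>

lemma harmonic_disc_rescale:
  assumes u: "harmonic_disc T A g u" and b: "b > 0" and sub: "ball z0 b \<subseteq> unit_disc"
  shows "harmonic_disc T A g (\<lambda>z. u (z0 + b *\<^sub>R z))"
proof -
  define k where "k z = z0 + b *\<^sub>R z" for z :: complex
  have us: "smooth_map_on T A unit_disc u" using u by (simp add: harmonic_disc_def)
  have k_in: "k z \<in> ball z0 b \<longleftrightarrow> z \<in> unit_disc" for z
    using b by (simp add: k_def dist_norm)
  define ki where "ki z = (1/b) *\<^sub>R (z - z0)" for z :: complex
  have kki: "k (ki z) = z" "ki (k z) = z" for z using b by (auto simp: k_def ki_def)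
  have ki_in: "ki z \<in> unit_disc \<longleftrightarrow> z \<in> ball z0 b" for z using k_in[of "ki z"] kki by simp
  have main: "((\<lambda>t. energy A g K (\<lambda>z. h (t, z))) has_real_derivative 0) (at 0)"
    if \<delta>: "\<delta> > 0" and K: "compact K" "K \<subseteq> unit_disc"
      and h: "smooth_map_on T A ({-\<delta><..<\<delta>} \<times> unit_disc) h"
      and h0: "\<And>z. z \<in> unit_disc \<Longrightarrow> h (0, z) = u (k z)"
      and hK: "\<And>t z. t \<in> {-\<delta><..<\<delta>} \<Longrightarrow> z \<in> unit_disc - K \<Longrightarrow> h (t, z) = u (k z)" for \<delta> K h
  proof -
    define h' where "h' p = (if snd p \<in> ball z0 b then h (fst p, ki (snd p)) else u (snd p))" for p
    let ?I = "{-\<delta><..<\<delta>} :: real set"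
    have K': "compact (k ` K)" unfolding k_def
      by (intro compact_continuous_image K continuous_intros)
    have kK: "k ` K \<subseteq> ball z0 b" using K(2) k_in by auto
    have out: "h' (t, z) = u z" if "t \<in> ?I" "z \<in> unit_disc - k ` K" for t z
    proof (cases "z \<in> ball z0 b")
      case True
      then have "ki z \<in> unit_disc - K" using that ki_in kki by (metis DiffD2 DiffI image_eqI)
      then show ?thesis using hK[OF that(1), of "ki z"] True kki by (simp add: h'_def)
    qed (simp add: h'_def)
    have sm: "smooth_map_on T A (?I \<times> unit_disc) h'"
    proof (rule smooth_map_on_local[OF _ _ chart_open'])
      show "open (?I \<times> unit_disc)" by (intro open_Times) auto
      fix x assume x: "x \<in> ?I \<times> unit_disc"
      show "\<exists>N u'. open N \<and> x \<in> N \<and> N \<subseteq> ?I \<times> unit_disc \<and> smooth_map_on T A N u' \<and> (\<forall>y\<in>N. h' y = u' y)"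
      proof (cases "snd x \<in> ball z0 b")
        case True
        have o: "open (?I \<times> ball z0 b)" by (intro open_Times) auto
        have "smooth_on (\<lambda>p::real \<times> complex. (fst p, (1/b) *\<^sub>R snd p) + (0, - (1/b) *\<^sub>R z0)) (?I \<times> ball z0 b)"
          by (intro smooth_on_add[OF smooth_on_bounded_linear_map smooth_on_const o] bounded_linear_Pair
              bounded_linear_fst bounded_linear_scaleR_right bounded_linear_compose[OF bounded_linear_scaleR_right bounded_linear_snd])
        then have "smooth_on (\<lambda>p::real \<times> complex. (fst p, ki (snd p))) (?I \<times> ball z0 b)"
          by (simp add: ki_def scaleR_diff_right)
        from smooth_map_on_compose[OF h this o _ _ chart_open']
        have "smooth_map_on T A (?I \<times> ball z0 b) (h \<circ> (\<lambda>p. (fst p, ki (snd p))))"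
          using ki_in by (fastforce intro: open_Times)
        moreover have "x \<in> ?I \<times> ball z0 b" using True x by (metis mem_Times_iff)
        moreover have "?I \<times> ball z0 b \<subseteq> ?I \<times> unit_disc" using sub by auto
        moreover have "\<forall>y\<in>?I \<times> ball z0 b. h' y = (h \<circ> (\<lambda>p. (fst p, ki (snd p)))) y"
          unfolding h'_def by auto
        ultimately show ?thesis using o by blast
      next
        case False
        have o: "open (?I \<times> (unit_disc - k ` K))"
          by (intro open_Times open_Diff compact_imp_closed K') auto
        have "smooth_map_on T A (?I \<times> (unit_disc - k ` K)) (u \<circ> snd)"
          by (rule smooth_map_on_compose[OF us smooth_on_bounded_linear_map[OF bounded_linear_snd] o _ _ chart_open']) auto
        moreover have "x \<in> ?I \<times> (unit_disc - k ` K)"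
          using False x kK by (auto simp: mem_Times_iff)
        moreover have "\<forall>y\<in>?I \<times> (unit_disc - k ` K). h' y = (u \<circ> snd) y" using out by auto
        ultimately show ?thesis using o by (intro exI[of _ "?I \<times> (unit_disc - k ` K)"] exI[of _ "u \<circ> snd"]) auto
      qed
    qed
    have d: "((\<lambda>t. energy A g (k ` K) (\<lambda>z. h' (t, z))) has_real_derivative 0) (at 0)"
    proof -
      have "compact (k ` K) \<and> k ` K \<subseteq> unit_disc" using K' kK sub by auto
      moreover have "\<forall>z\<in>unit_disc. h' (0, z) = u z" using h0 kki ki_in by (simp add: h'_def)
      moreover have "\<forall>t\<in>?I. \<forall>z\<in>unit_disc - k ` K. h' (t, z) = u z" using out by auto
      ultimately show ?thesis using u \<delta> sm unfolding harmonic_disc_def by blast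
    qed
    have e: "energy A g (k ` K) (\<lambda>z. h' (t, z)) = energy A g K (\<lambda>z. h (t, z))" if t: "t \<in> ?I" for t
    proof -
      have "smooth_on (\<lambda>z::complex. (0, z) + (t, 0)) unit_disc"
        by (intro smooth_on_add[OF smooth_on_bounded_linear_map smooth_on_const] bounded_linear_Pair
            bounded_linear_zero bounded_linear_ident) auto
      from smooth_map_on_compose[OF sm this _ _ _ chart_open']
      have hs: "smooth_map_on T A unit_disc (\<lambda>z. h' (t, z))"
        using t by (simp add: comp_def image_subset_iff open_Times)
      have "b\<^sup>2 * energy_density A g (\<lambda>z. h' (t, z)) (k z) = energy_density A g (\<lambda>z. h (t, z)) z" if z: "z \<in> K" for z
      proof -
        have kz: "k z \<in> unit_disc" using z kK sub by (meson image_eqI subsetD)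
        have e: "h' (t, k w) = h (t, w)" if "w \<in> unit_disc" for w
          using that k_in kki by (simp add: h'_def)
        have "energy_density A g (\<lambda>z. h' (t, k z)) z = b\<^sup>2 * energy_density A g (\<lambda>z. h' (t, z)) (k z)"
          using energy_density_rescale[OF hs, of z0 b z] kz by (simp add: k_def)
        moreover have "energy_density A g (\<lambda>z. h' (t, k z)) z = energy_density A g (\<lambda>z. h (t, z)) z"
          unfolding energy_density_def using differential_cong[of unit_disc z "\<lambda>z. h' (t, k z)" "\<lambda>z. h (t, z)"] e z K(2)
          by (simp add: subset_iff)
        ultimately show ?thesis by simp
      qed
      then have eq: "indicator K z *\<^sub>R (b\<^sup>2 * energy_density A g (\<lambda>z. h' (t, z)) (k z)) =
        indicator K z *\<^sub>R energy_density A g (\<lambda>z. h (t, z)) z" for z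
        by (auto simp: indicator_def)
      have "energy A g (k ` K) (\<lambda>z. h' (t, z)) =
          b\<^sup>2 * set_lebesgue_integral lborel K (\<lambda>z. energy_density A g (\<lambda>z. h' (t, z)) (k z))"
        unfolding energy_def k_def[abs_def] by (rule set_lborel_integral_rescale_complex[OF b])
      also have "\<dots> = set_lebesgue_integral lborel K (\<lambda>z. b\<^sup>2 * energy_density A g (\<lambda>z. h' (t, z)) (k z))"
        by simp
      also have "\<dots> = energy A g K (\<lambda>z. h (t, z))"
        unfolding energy_def set_lebesgue_integral_def eq ..
      finally show ?thesis .
    qed
    show ?thesis
    proof (rule has_field_derivative_transform_within_open[OF d])
      show "open ?I" "0 \<in> ?I" using \<delta> by auto
      show "energy A g (k ` K) (\<lambda>z. h' (t, z)) = energy A g K (\<lambda>z. h (t, z))" if "t \<in> ?I" for t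
        by (rule e[OF that])
    qed
  qed
  have "smooth_map_on T A unit_disc (\<lambda>z. u (k z))"
    unfolding k_def
  proof (rule smooth_rescale[OF us])
    fix z assume "z \<in> unit_disc"
    then show "z0 + b *\<^sub>R z \<in> unit_disc" using k_in sub unfolding k_def by blast
  qed auto
  then show ?thesis unfolding harmonic_disc_def k_def[symmetric] using main by blast
qed

text \<open>With \<open>b\<close> small, this permits testing a function that is minimal plurisubharmonic only on an open
set \<open>V'\<close> along a disc which meets \<open>V'\<close> without being contained in it.\<close>

lemma CHI_disc_rescale:
  assumes u: "CHI_disc T A g V u" and b: "b > 0" and sub: "ball z0 b \<subseteq> unit_disc" and V': "u ` ball z0 b \<subseteq> V'"
  shows "CHI_disc T A g V' (\<lambda>z. u (z0 + b *\<^sub>R z))"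
proof -
  have k_in: "z0 + b *\<^sub>R z \<in> ball z0 b" if "z \<in> unit_disc" for z
    using b that by (simp add: dist_norm)
  then have kd: "z0 + b *\<^sub>R z \<in> unit_disc" if "z \<in> unit_disc" for z using sub that by blast
  have us: "smooth_map_on T A unit_disc u" using u by (simp add: CHI_disc_def harmonic_disc_def)
  have 1: "harmonic_disc T A g (\<lambda>z. u (z0 + b *\<^sub>R z))"
    using harmonic_disc_rescale u b sub by (simp add: CHI_disc_def)
  have "conformal_disc A g u" using u by (simp add: CHI_disc_def)
  then obtain f where ff: "smooth_on f unit_disc \<and>
        (\<forall>z\<in>unit_disc. \<forall>a c. g (u z) (differential A u z a) (differential A u z c) = exp (f z) * (a \<bullet> c))"
    unfolding conformal_disc_def ..
  have f: "smooth_on f unit_disc"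
    "\<And>z a c. z \<in> unit_disc \<Longrightarrow> g (u z) (differential A u z a) (differential A u z c) = exp (f z) * (a \<bullet> c)"
    using conjunct1[OF ff] conjunct2[OF ff] by blast+
  have "smooth_on (\<lambda>z. f (z0 + b *\<^sub>R z) + 2 * ln b) unit_disc"
    by (intro smooth_on_add smooth_on_const smooth_on_compose[OF f(1)] smooth_on_bounded_linear_map
        bounded_linear_scaleR_right) (use kd in auto)
  moreover have "exp (2 * ln b) = b\<^sup>2" using b by (simp add: exp_double)
  ultimately have 2: "conformal_disc A g (\<lambda>z. u (z0 + b *\<^sub>R z))"
    unfolding conformal_disc_def
    using metric_differential_rescale[OF us] kd f(2)
    by (intro exI[of _ "\<lambda>z. f (z0 + b *\<^sub>R z) + 2 * ln b"]) (simp add: exp_add)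
  have 3: "inj (differential A (\<lambda>z. u (z0 + b *\<^sub>R z)) z)" if z: "z \<in> unit_disc" for z
  proof (rule injI)
    fix a c assume "differential A (\<lambda>z. u (z0 + b *\<^sub>R z)) z a = differential A (\<lambda>z. u (z0 + b *\<^sub>R z)) z c"
    then have "differential A u (z0 + b *\<^sub>R z) a = differential A u (z0 + b *\<^sub>R z) c"
      unfolding differential_rescale[OF us open_ball kd[OF z]] using b by (auto simp: fun_eq_iff)
    then show "a = c" using u kd[OF z] unfolding CHI_disc_def by (meson injD)
  qed
  show ?thesis unfolding CHI_disc_def using 1 2 3 V' k_in by auto
qed

end

section \<open>The Euler-Lagrange equation of the energy\<close>

text \<open>The integral of a compactly supported function does not change under translations; its derivative
with respect to the translation is the integral of the directional derivative.\<close>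

lemma integral_directional_derivative_eq_0:
  fixes Q :: "complex \<Rightarrow> real"
  assumes D: "\<And>z. (Q has_derivative D z) (at z)" and cont: "continuous_on UNIV (\<lambda>z. D z a)"
    and supp: "\<And>z. z \<notin> cball z1 r \<Longrightarrow> Q z = 0" and box: "cball z1 R \<subseteq> cbox c d" and r: "r < R"
  shows "integral (cbox c d) (\<lambda>z. D z a) = 0"
proof -
  have Qc: "continuous_on S Q" for S
    by (intro continuous_at_imp_continuous_on ballI has_derivative_continuous[OF D])
  have bm: "Q \<in> borel_measurable borel" using Qc by (rule borel_measurable_continuous_onI)
  define \<delta> where "\<delta> = (R - r) / (norm a + 1)"
  have \<delta>: "\<delta> > 0" using r by (simp add: \<delta>_def add_nonneg_pos)
  let ?U = "{-\<delta><..<\<delta>}"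
  have "((\<lambda>t. integral (cbox c d) (\<lambda>z. Q (z + t *\<^sub>R a))) has_real_derivative
      integral (cbox c d) (\<lambda>z. D (z + 0 *\<^sub>R a) a)) (at 0 within ?U)"
  proof (rule leibniz_rule_field_derivative[where fx="\<lambda>t z. D (z + t *\<^sub>R a) a" and f="\<lambda>t z. Q (z + t *\<^sub>R a)"])
    fix t z
    have "((\<lambda>t. z + t *\<^sub>R a) has_derivative (\<lambda>s. s *\<^sub>R a)) (at t)"
      by (auto intro!: derivative_eq_intros)
    from diff_chain_at[OF this D]
    have "((\<lambda>t. Q (z + t *\<^sub>R a)) has_derivative (\<lambda>s. D (z + t *\<^sub>R a) (s *\<^sub>R a))) (at t)" by (simp add: comp_def)
    moreover have "D (z + t *\<^sub>R a) (s *\<^sub>R a) = D (z + t *\<^sub>R a) a * s" for s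
      using linear_scale[OF has_derivative_linear[OF D[of "z + t *\<^sub>R a"]], of s a] by simp
    ultimately have "((\<lambda>t. Q (z + t *\<^sub>R a)) has_real_derivative D (z + t *\<^sub>R a) a) (at t)"
      unfolding has_field_derivative_def by simp
    then show "((\<lambda>t. Q (z + t *\<^sub>R a)) has_real_derivative D (z + t *\<^sub>R a) a) (at t within ?U)"
      by (rule has_field_derivative_at_within)
  next
    show "(\<lambda>z. Q (z + t *\<^sub>R a)) integrable_on cbox c d" for t
      by (intro integrable_continuous continuous_on_compose2[OF Qc[of UNIV]] continuous_intros) auto
    have "continuous_on (?U \<times> cbox c d) (\<lambda>p. D (snd p + fst p *\<^sub>R a) a)"
      by (rule continuous_on_compose2[OF cont]) (auto intro!: continuous_intros)
    then show "continuous_on (?U \<times> cbox c d) (\<lambda>(t, z). D (z + t *\<^sub>R a) a)" by (simp add: case_prod_unfold)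
  qed (use \<delta> in auto)
  then have 1: "((\<lambda>t. integral (cbox c d) (\<lambda>z. Q (z + t *\<^sub>R a))) has_real_derivative
      integral (cbox c d) (\<lambda>z. D z a)) (at 0)"
    using \<delta> at_within_open[of 0 ?U] by simp
  have const: "integral (cbox c d) (\<lambda>z. Q (z + t *\<^sub>R a)) = integral\<^sup>L lborel Q" if t: "t \<in> ?U" for t
  proof -
    have ta: "norm (t *\<^sub>R a) \<le> R - r"
    proof -
      have "norm (t *\<^sub>R a) \<le> \<delta> * (norm a + 1)" using t by (auto intro!: mult_mono)
      also have "\<dots> = R - r" by (simp add: \<delta>_def add_nonneg_eq_0_iff)
      finally show ?thesis .
    qed
    have z: "Q (z + t *\<^sub>R a) = 0" if "z \<notin> cbox c d" for z
    proof (rule supp)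
      have "z \<notin> cball z1 R" using that box by auto
      moreover have "dist z1 z \<le> dist z1 (z + t *\<^sub>R a) + norm (t *\<^sub>R a)"
        by (metis add_diff_cancel_left' dist_commute dist_norm dist_triangle)
      ultimately show "z + t *\<^sub>R a \<notin> cball z1 r" using ta by simp
    qed
    have "continuous_on (cbox c d) (\<lambda>z. Q (z + t *\<^sub>R a))"
      by (intro continuous_on_compose2[OF Qc[of UNIV]] continuous_intros) auto
    then have "set_integrable lborel (cbox c d) (\<lambda>z. Q (z + t *\<^sub>R a))"
      unfolding set_integrable_def by (rule borel_integrable_compact[OF compact_cbox])
    then have "integral (cbox c d) (\<lambda>z. Q (z + t *\<^sub>R a)) = (LINT z|lborel. indicator (cbox c d) z *\<^sub>R Q (z + t *\<^sub>R a))"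
      by (simp add: set_borel_integral_eq_integral(2)[symmetric] set_lebesgue_integral_def)
    also have "\<dots> = (LINT z|lborel. Q (t *\<^sub>R a + z))"
      by (intro Bochner_Integration.integral_cong) (auto simp: indicator_def z add.commute)
    also have "\<dots> = integral\<^sup>L (distr lborel borel ((+) (t *\<^sub>R a))) Q"
      using bm by (subst integral_distr) auto
    also have "\<dots> = integral\<^sup>L lborel Q" by (simp add: lborel_distr_plus)
    finally show ?thesis .
  qed
  have "((\<lambda>t. integral (cbox c d) (\<lambda>z. Q (z + t *\<^sub>R a))) has_real_derivative 0) (at 0)"
    by (rule has_field_derivative_transform_within_open[where S="?U" and f="\<lambda>t. integral\<^sup>L lborel Q"])
      (use \<delta> const in auto)
  then show ?thesis using DERIV_unique[OF 1] by blast
qed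

context riemannian begin

text \<open>The variation is \<open>y + t \<beta> e\<close> in the chart, with a bump function \<open>\<beta>\<close> whose support lies in a box that the
disc maps into the chart. The energy over the box is differentiated under the integral sign.\<close>

lemma harmonic_disc_weak_equation:
  assumes u: "harmonic_disc T A g u" and c: "(V, \<phi>) \<in> A"
    and r: "r > 0" and K: "cbox lo hi \<subseteq> {z \<in> unit_disc. u z \<in> V}" and rK: "cball z1 r \<subseteq> cbox lo hi"
  defines "y \<equiv> \<phi> \<circ> u" and "\<beta> \<equiv> bump z1 r"
  defines "Y \<equiv> \<lambda>a z. frechet_derivative y (at z) a"
    and "E \<equiv> \<lambda>z a. frechet_derivative \<beta> (at z) a"
    and "DG \<equiv> \<lambda>x v. frechet_derivative (G (V, \<phi>)) (at x) v"
  shows "integral (cbox lo hi) (\<lambda>z. \<Sum>a\<in>{1, \<i>}. 2 * E z a * (e \<bullet> (G (V, \<phi>) (y z) *v Y a z)) +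
     \<beta> z * (Y a z \<bullet> (DG (y z) e *v Y a z))) = 0"
proof -
  let ?K = "cbox lo hi" and ?G = "G (V, \<phi>)"
  define O' where "O' = {z \<in> unit_disc. u z \<in> V}"
  have us: "smooth_map_on T A unit_disc u" using u by (simp add: harmonic_disc_def)
  have oO: "open O'" unfolding O'_def by (rule smooth_map_domain_open[OF us open_ball c])
  have ysm: "smooth_on y O'" unfolding y_def O'_def by (rule smooth_map_coord[OF us c])
  have yV: "y z \<in> \<phi> ` V" if "z \<in> O'" for z using that by (auto simp: y_def O'_def)
  have Gsm: "smooth_on ?G (\<phi> ` V)" using G_smooth[OF c] by simp
  have oV: "open (\<phi> ` V)" by (rule chart_image_open[OF c])
  have bsm: "smooth_on \<beta> S" if "open S" for S unfolding \<beta>_def by (rule smooth_bump[OF that])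
  have KO: "?K \<subseteq> O'" using K by (simp add: O'_def)
  have Kd: "?K \<subseteq> unit_disc" using K by auto
  have ycont: "continuous_on ?K y" using smooth_on_imp_continuous_on[OF ysm] KO continuous_on_subset by blast
  have "compact (y ` ?K)" by (intro compact_continuous_image ycont compact_cbox)
  moreover have "y ` ?K \<subseteq> \<phi> ` V" using yV KO by auto
  ultimately obtain \<delta>0 where \<delta>0: "\<delta>0 > 0" "(\<Union>x\<in>y ` ?K. ball x \<delta>0) \<subseteq> \<phi> ` V"
    using compact_subset_open_imp_ball_epsilon_subset[OF _ oV] by metis
  define \<delta> where "\<delta> = \<delta>0 / (norm e + 1)"
  have \<delta>: "\<delta> > 0" using \<delta>0 by (simp add: \<delta>_def add_nonneg_pos)
  let ?I = "{-\<delta><..<\<delta>} :: real set"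
  have \<beta>0: "\<beta> z = 0" if "z \<notin> ?K" for z
    using that rK bump_eq_0[OF r] unfolding \<beta>_def by (metis ball_subset_cball subsetD)
  define yt where "yt t z = y z + (t * \<beta> z) *\<^sub>R e" for t z
  have ytV: "yt t z \<in> \<phi> ` V" if "t \<in> ?I" "z \<in> O'" for t z
  proof (cases "z \<in> ?K")
    case True
    have "norm ((t * \<beta> z) *\<^sub>R e) \<le> \<bar>t\<bar> * norm e"
      using bump_le_1[of z1 r z] bump_nonneg[of z1 r z]
      by (auto simp: \<beta>_def abs_mult intro!: mult_right_mono mult_left_le)
    also have "\<dots> \<le> \<bar>t\<bar> * (norm e + 1)" by (intro mult_left_mono) auto
    also have "\<dots> < \<delta> * (norm e + 1)" using that by (intro mult_strict_right_mono) (auto simp: add_nonneg_pos)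
    also have "\<dots> = \<delta>0" by (simp add: \<delta>_def add_nonneg_eq_0_iff)
    finally have "yt t z \<in> ball (y z) \<delta>0" by (simp add: yt_def dist_norm)
    then show ?thesis using \<delta>0(2) True by blast
  next
    case False
    then show ?thesis using \<beta>0 yV that by (simp add: yt_def)
  qed
  define h where "h p = (if snd p \<in> O' then inv_into V \<phi> (yt (fst p) (snd p)) else u (snd p))" for p :: "real \<times> complex"
  have uinv: "inv_into V \<phi> (y z) = u z" if "z \<in> O'" for z
    using that chart_inv[OF c] by (simp add: y_def O'_def)
  have hout: "h (t, z) = u z" if "z \<notin> ?K" for t z
    using that \<beta>0 uinv by (simp add: h_def yt_def)
  have h0: "h (0, z) = u z" for z using uinv by (simp add: h_def yt_def)
  have hsm: "smooth_map_on T A (?I \<times> unit_disc) h"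
  proof (rule smooth_map_on_local[OF _ _ chart_open'])
    show "open (?I \<times> unit_disc)" by (intro open_Times) auto
    fix x assume x: "x \<in> ?I \<times> unit_disc"
    show "\<exists>N u'. open N \<and> x \<in> N \<and> N \<subseteq> ?I \<times> unit_disc \<and> smooth_map_on T A N u' \<and> (\<forall>y\<in>N. h y = u' y)"
    proof (cases "snd x \<in> O'")
      case True
      have o: "open (?I \<times> O')" by (intro open_Times oO) auto
      have "smooth_on (\<lambda>p. y (snd p) + (fst p * \<beta> (snd p)) *\<^sub>R e) (?I \<times> O')"
        by (intro smooth_on_add[OF _ _ o] smooth_on_bilinear[OF bounded_bilinear_scaleR _ _ o] smooth_on_const
            smooth_on_bilinear[OF bounded_bilinear_mult _ _ o] smooth_on_bounded_linear_map[OF bounded_linear_fst]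
            smooth_on_compose[OF ysm smooth_on_bounded_linear_map[OF bounded_linear_snd] o]
            smooth_on_compose[OF bsm[OF oO] smooth_on_bounded_linear_map[OF bounded_linear_snd] o]) auto
      then have "smooth_map_on T A (?I \<times> O') (inv_into V \<phi> \<circ> (\<lambda>p. y (snd p) + (fst p * \<beta> (snd p)) *\<^sub>R e))"
        by (rule smooth_map_from_chart[OF c _ o]) (use ytV in \<open>auto simp: yt_def\<close>)
      moreover have "\<forall>p\<in>?I \<times> O'. h p = (inv_into V \<phi> \<circ> (\<lambda>p. y (snd p) + (fst p * \<beta> (snd p)) *\<^sub>R e)) p"
        by (auto simp: h_def yt_def)
      moreover have "x \<in> ?I \<times> O'" "?I \<times> O' \<subseteq> ?I \<times> unit_disc" using x True by (auto simp: O'_def mem_Times_iff)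
      ultimately show ?thesis using o by blast
    next
      case False
      have o: "open (?I \<times> (unit_disc - ?K))" by (intro open_Times open_Diff) auto
      have "smooth_map_on T A (?I \<times> (unit_disc - ?K)) (u \<circ> snd)"
        by (rule smooth_map_on_compose[OF us smooth_on_bounded_linear_map[OF bounded_linear_snd] o _ _ chart_open']) auto
      moreover have "x \<in> ?I \<times> (unit_disc - ?K)" using x False KO by (metis DiffI mem_Times_iff subsetD)
      moreover have "\<forall>p\<in>?I \<times> (unit_disc - ?K). h p = (u \<circ> snd) p" using hout by auto
      moreover have "?I \<times> (unit_disc - ?K) \<subseteq> ?I \<times> unit_disc" by auto
      ultimately show ?thesis using o by blast
    qed
  qed
  have crit: "((\<lambda>t. energy A g ?K (\<lambda>z. h (t, z))) has_real_derivative 0) (at 0)"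
  proof -
    have "compact ?K \<and> ?K \<subseteq> unit_disc" using Kd by simp
    moreover have "\<forall>z\<in>unit_disc. h (0, z) = u z" using h0 by simp
    moreover have "\<forall>t\<in>?I. \<forall>z\<in>unit_disc - ?K. h (t, z) = u z" using hout by simp
    ultimately show ?thesis using u \<delta> hsm unfolding harmonic_disc_def by blast
  qed
  define N where "N t z a = Y a z + (t * E z a) *\<^sub>R e" for t z a
  define P where "P t z = (\<Sum>a\<in>{1, \<i>}. N t z a \<bullet> (?G (yt t z) *v N t z a))" for t z
  have yd: "(y has_derivative (\<lambda>a. Y a z)) (at z)" if "z \<in> O'" for z
    unfolding Y_def using smooth_on_imp_has_derivative[OF ysm that] by simp
  have bd: "(\<beta> has_derivative E z) (at z)" for z
    unfolding E_def using smooth_on_imp_has_derivative[OF bsm[of UNIV], of z] by simp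
  have dens: "energy_density A g (\<lambda>z. h (t, z)) z = P t z" if t: "t \<in> ?I" and z: "z \<in> O'" for t z
  proof -
    have "smooth_on (\<lambda>z::complex. (0, z) + (t, 0)) unit_disc"
      by (intro smooth_on_add[OF smooth_on_bounded_linear_map smooth_on_const] bounded_linear_Pair
          bounded_linear_zero bounded_linear_ident) auto
    from smooth_map_on_compose[OF hsm this _ _ _ chart_open']
    have hs: "smooth_map_on T A unit_disc (\<lambda>z. h (t, z))"
      using t by (simp add: comp_def image_subset_iff open_Times)
    have \<phi>h: "(\<phi> \<circ> (\<lambda>z. h (t, z))) w = yt t w" if "w \<in> O'" for w
      using ytV[OF t that] that by (simp add: h_def f_inv_into_f)
    have zd: "z \<in> unit_disc" using z by (simp add: O'_def)
    have hV: "h (t, z) \<in> V" using ytV[OF t z] z by (simp add: h_def inv_into_into)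
    have "(yt t has_derivative N t z) (at z)"
      unfolding yt_def N_def
      using yd[OF z] bd[of z] by (auto intro!: derivative_eq_intros simp: algebra_simps)
    then have "frechet_derivative (\<phi> \<circ> (\<lambda>z. h (t, z))) (at z) = N t z"
      using frechet_derivative_cong_open[OF oO z, of "\<phi> \<circ> (\<lambda>z. h (t, z))" "yt t"] \<phi>h frechet_derivative_at by metis
    then show ?thesis
      unfolding energy_density_def P_def metric_differential[OF hs open_ball zd c hV]
      using \<phi>h[OF z] by simp
  qed
  define DP where "DP t z = (\<Sum>a\<in>{1, \<i>}. N t z a \<bullet> (?G (yt t z) *v (E z a *\<^sub>R e)) +
      N t z a \<bullet> ((\<beta> z *\<^sub>R DG (yt t z) e) *v N t z a) + (E z a *\<^sub>R e) \<bullet> (?G (yt t z) *v N t z a))" for t z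
  have Pder: "((\<lambda>t. P t z) has_real_derivative DP t z) (at t)" if t: "t \<in> ?I" and z: "z \<in> O'" for t z
  proof -
    have Gd: "(?G has_derivative DG (yt t z)) (at (yt t z))"
      unfolding DG_def by (rule smooth_on_imp_has_derivative[OF Gsm ytV[OF t z]])
    have ytd: "((\<lambda>t. yt t z) has_derivative (\<lambda>s. s *\<^sub>R (\<beta> z *\<^sub>R e))) (at t)"
      unfolding yt_def by (auto intro!: derivative_eq_intros simp: algebra_simps)
    have Nd: "((\<lambda>t. N t z a) has_derivative (\<lambda>s. s *\<^sub>R (E z a *\<^sub>R e))) (at t)" for a
      unfolding N_def by (auto intro!: derivative_eq_intros simp: algebra_simps)
    have GYd: "((\<lambda>t. ?G (yt t z)) has_derivative (\<lambda>s. s *\<^sub>R (\<beta> z *\<^sub>R DG (yt t z) e))) (at t)"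
    proof -
      have "DG (yt t z) (s *\<^sub>R (\<beta> z *\<^sub>R e)) = s *\<^sub>R (\<beta> z *\<^sub>R DG (yt t z) e)" for s
        using linear_scale[OF has_derivative_linear[OF Gd], of s] linear_scale[OF has_derivative_linear[OF Gd], of "\<beta> z" e] by metis
      then show ?thesis using diff_chain_at[OF ytd Gd] by (simp add: comp_def)
    qed
    note MV = bounded_bilinear.FDERIV[OF bounded_bilinear_matrix_vector_mult GYd Nd]
    have "((\<lambda>t. P t z) has_derivative (\<lambda>s. \<Sum>a\<in>{1, \<i>}. N t z a \<bullet> (?G (yt t z) *v (s *\<^sub>R (E z a *\<^sub>R e)) +
       (s *\<^sub>R (\<beta> z *\<^sub>R DG (yt t z) e)) *v N t z a) + (s *\<^sub>R (E z a *\<^sub>R e)) \<bullet> (?G (yt t z) *v N t z a))) (at t)"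
      unfolding P_def by (intro has_derivative_sum bounded_bilinear.FDERIV[OF bounded_bilinear_inner] MV Nd)
    moreover have "(\<Sum>a\<in>{1, \<i>}. N t z a \<bullet> (?G (yt t z) *v (s *\<^sub>R (E z a *\<^sub>R e)) +
       (s *\<^sub>R (\<beta> z *\<^sub>R DG (yt t z) e)) *v N t z a) + (s *\<^sub>R (E z a *\<^sub>R e)) \<bullet> (?G (yt t z) *v N t z a)) = DP t z * s" for s
    proof -
      have "N t z a \<bullet> (?G (yt t z) *v (s *\<^sub>R (E z a *\<^sub>R e)) +
       (s *\<^sub>R (\<beta> z *\<^sub>R DG (yt t z) e)) *v N t z a) + (s *\<^sub>R (E z a *\<^sub>R e)) \<bullet> (?G (yt t z) *v N t z a) =
       s * (N t z a \<bullet> (?G (yt t z) *v (E z a *\<^sub>R e)) +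
      N t z a \<bullet> ((\<beta> z *\<^sub>R DG (yt t z) e) *v N t z a) + (E z a *\<^sub>R e) \<bullet> (?G (yt t z) *v N t z a))" for a
        by (simp only: matrix_vector_mult_scaleR scaleR_matrix_vector_assoc[symmetric] inner_add_right
            inner_scaleR_left inner_scaleR_right distrib_left)
      then show ?thesis unfolding DP_def sum_distrib_right by (simp add: mult.commute)
    qed
    ultimately show ?thesis unfolding has_field_derivative_def by simp
  qed
  have Ycont: "continuous_on O' (\<lambda>z. Y a z)" for a
    unfolding Y_def by (intro smooth_on_imp_continuous_on smooth_on_derivative ysm)
  have Econt: "continuous_on UNIV (\<lambda>z. E z a)" for a
    unfolding E_def by (intro smooth_on_imp_continuous_on smooth_on_derivative bsm) simp
  have bcont: "continuous_on UNIV \<beta>" by (intro smooth_on_imp_continuous_on bsm) simp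
  have DGcont: "continuous_on (\<phi> ` V) (\<lambda>x. DG x e)"
    unfolding DG_def by (intro smooth_on_imp_continuous_on smooth_on_derivative Gsm)
  have Gcont: "continuous_on (\<phi> ` V) ?G" by (rule smooth_on_imp_continuous_on[OF Gsm])
  note mvc = bounded_bilinear.continuous_on[OF bounded_bilinear_matrix_vector_mult]
  have ytc: "continuous_on (?I \<times> O') (\<lambda>p. yt (fst p) (snd p))"
    unfolding yt_def
    by (intro continuous_intros continuous_on_compose2[OF bcont] continuous_on_compose2[OF smooth_on_imp_continuous_on[OF ysm]]) auto
  have Nc: "continuous_on (?I \<times> O') (\<lambda>p. N (fst p) (snd p) a)" for a
    unfolding N_def by (intro continuous_intros continuous_on_compose2[OF Econt] continuous_on_compose2[OF Ycont]) auto
  have Gc: "continuous_on (?I \<times> O') (\<lambda>p. ?G (yt (fst p) (snd p)))"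
    by (rule continuous_on_compose2[OF Gcont ytc]) (use ytV in auto)
  have DGc: "continuous_on (?I \<times> O') (\<lambda>p. DG (yt (fst p) (snd p)) e)"
    by (rule continuous_on_compose2[OF DGcont ytc]) (use ytV in auto)
  have Ec: "continuous_on (?I \<times> O') (\<lambda>p. E (snd p) a *\<^sub>R e)" for a
    by (intro continuous_intros continuous_on_compose2[OF Econt]) auto
  have bc: "continuous_on (?I \<times> O') (\<lambda>p. \<beta> (snd p))"
    by (intro continuous_intros continuous_on_compose2[OF bcont]) auto
  have DPc: "continuous_on (?I \<times> O') (\<lambda>p. DP (fst p) (snd p))"
    unfolding DP_def by (intro continuous_on_sum continuous_on_add continuous_on_inner mvc Nc Gc Ec
        continuous_on_scaleR bc DGc)
  have Pc: "continuous_on ?K (P t)" if "t \<in> ?I" for t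
  proof -
    have "continuous_on (?I \<times> O') (\<lambda>p. P (fst p) (snd p))"
      unfolding P_def by (intro continuous_on_sum continuous_on_inner mvc Nc Gc)
    moreover have "continuous_on ?K (\<lambda>z. (t, z))"
      by (intro continuous_on_Pair continuous_on_const continuous_on_id)
    moreover have "(\<lambda>z. (t, z)) ` ?K \<subseteq> ?I \<times> O'" using that KO by auto
    ultimately have "continuous_on ?K (\<lambda>z. P (fst (t, z)) (snd (t, z)))"
      by (rule continuous_on_compose2)
    then show ?thesis by simp
  qed
  have "((\<lambda>t. integral ?K (P t)) has_real_derivative integral ?K (DP 0)) (at 0 within ?I)"
  proof (rule leibniz_rule_field_derivative)
    show "((\<lambda>t. P t z) has_real_derivative DP t z) (at t within ?I)" if "t \<in> ?I" "z \<in> ?K" for t z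
      using Pder that KO has_field_derivative_at_within by blast
    show "P t integrable_on ?K" if "t \<in> ?I" for t by (rule integrable_continuous[OF Pc[OF that]])
    show "continuous_on (?I \<times> ?K) (\<lambda>(t, z). DP t z)"
      using continuous_on_subset[OF DPc, of "?I \<times> ?K"] KO by (auto simp: case_prod_unfold)
  qed (use \<delta> in auto)
  then have 1: "((\<lambda>t. integral ?K (P t)) has_real_derivative integral ?K (DP 0)) (at 0)"
    using \<delta> at_within_open[of 0 ?I] by simp
  have "energy A g ?K (\<lambda>z. h (t, z)) = integral ?K (P t)" if t: "t \<in> ?I" for t
  proof -
    have "energy A g ?K (\<lambda>z. h (t, z)) = set_lebesgue_integral lborel ?K (P t)"
      unfolding energy_def using dens[OF t] KO by (intro set_lebesgue_integral_cong) auto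
    also have "\<dots> = integral ?K (P t)"
      by (rule set_borel_integral_eq_integral(2))
        (unfold set_integrable_def, rule borel_integrable_compact[OF compact_cbox Pc[OF t]])
    finally show ?thesis .
  qed
  then have "((\<lambda>t. integral ?K (P t)) has_real_derivative 0) (at 0)"
    using has_field_derivative_transform_within_open[OF crit, of ?I "\<lambda>t. integral ?K (P t)"] \<delta> by simp
  then have "integral ?K (DP 0) = 0" using DERIV_unique[OF 1] by blast
  moreover have "integral ?K (DP 0) = integral ?K (\<lambda>z. \<Sum>a\<in>{1, \<i>}. 2 * E z a * (e \<bullet> (?G (y z) *v Y a z)) +
     \<beta> z * (Y a z \<bullet> (DG (y z) e *v Y a z)))"
  proof (rule integral_cong)
    fix z assume "z \<in> ?K"
    then have "y z \<in> snd (V, \<phi>) ` fst (V, \<phi>)" using yV KO by auto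
    from G_sym[OF c this] have s: "Y a z \<bullet> (?G (y z) *v e) = e \<bullet> (?G (y z) *v Y a z)" for a .
    have t: "yt 0 z = y z" "N 0 z a = Y a z" for a by (simp_all add: yt_def N_def)
    show "DP 0 z = (\<Sum>a\<in>{1, \<i>}. 2 * E z a * (e \<bullet> (?G (y z) *v Y a z)) + \<beta> z * (Y a z \<bullet> (DG (y z) e *v Y a z)))"
      unfolding DP_def t
      by (intro sum.cong refl) (simp only: matrix_vector_mult_scaleR scaleR_matrix_vector_assoc[symmetric]
            inner_scaleR_left inner_scaleR_right s)
  qed
  ultimately show ?thesis by simp
qed

text \<open>Integrating the weak equation by parts removes the derivatives of the bump function. If the two sides
differed at \<open>z1\<close>, their difference would have a sign near \<open>z1\<close>, and its integral against a bump function
supported there could not vanish. Replacing \<open>e\<close> by \<open>- e\<close> reduces this to a positive difference.\<close>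

lemma harmonic_map_equation:
  assumes u: "harmonic_disc T A g u" and c: "(V, \<phi>) \<in> A" and z1: "z1 \<in> unit_disc" "u z1 \<in> V"
  defines "y \<equiv> \<phi> \<circ> u"
  defines "Y \<equiv> \<lambda>a z. frechet_derivative y (at z) a"
    and "DG \<equiv> \<lambda>x v. frechet_derivative (G (V, \<phi>)) (at x) v"
  defines "YY \<equiv> \<lambda>a. frechet_derivative (Y a) (at z1) a"
  shows "2 * (e \<bullet> (G (V, \<phi>) (y z1) *v (\<Sum>a\<in>{1, \<i>}. YY a))) =
    (\<Sum>a\<in>{1, \<i>}. Y a z1 \<bullet> (DG (y z1) e *v Y a z1) - 2 * (e \<bullet> (DG (y z1) (Y a z1) *v Y a z1)))"
proof -
  let ?G = "G (V, \<phi>)"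
  define O' where "O' = {z \<in> unit_disc. u z \<in> V}"
  have us: "smooth_map_on T A unit_disc u" using u by (simp add: harmonic_disc_def)
  have oO: "open O'" unfolding O'_def by (rule smooth_map_domain_open[OF us open_ball c])
  have z1O: "z1 \<in> O'" using z1 by (simp add: O'_def)
  have ysm: "smooth_on y O'" unfolding y_def O'_def by (rule smooth_map_coord[OF us c])
  have yV: "y z \<in> \<phi> ` V" if "z \<in> O'" for z using that by (auto simp: y_def O'_def)
  have Gsm: "smooth_on ?G (\<phi> ` V)" using G_smooth[OF c] by simp
  have Ysm: "smooth_on (Y a) O'" for a unfolding Y_def by (rule smooth_on_derivative[OF ysm])
  have Gy: "smooth_on (\<lambda>z. ?G (y z)) O'"
    by (rule smooth_on_compose[OF Gsm ysm oO]) (use yV in auto)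
  define F where "F a z = ?G (y z) *v Y a z" for a z
  have Fsm: "smooth_on (F a) O'" for a
    unfolding F_def by (rule smooth_on_matrix_vector_mult[OF Gy Ysm oO])
  define DF where "DF a z = frechet_derivative (F a) (at z) a" for a z
  define EL where "EL e z = (\<Sum>a\<in>{1, \<i>}. Y a z \<bullet> (DG (y z) e *v Y a z) - 2 * (e \<bullet> DF a z))" for e z
  have ELc: "continuous_on O' (EL e)" for e
  proof -
    have 1: "continuous_on O' (Y a)" for a by (rule smooth_on_imp_continuous_on[OF Ysm])
    have 2: "continuous_on O' (DF a)" for a
      unfolding DF_def by (rule smooth_on_imp_continuous_on[OF smooth_on_derivative[OF Fsm]])
    have 3: "continuous_on O' (\<lambda>z. DG (y z) e)"
      unfolding DG_def
      by (rule continuous_on_compose2[OF smooth_on_imp_continuous_on[OF smooth_on_derivative[OF Gsm]]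
            smooth_on_imp_continuous_on[OF ysm]]) (use yV in auto)
    show ?thesis unfolding EL_def
      by (intro continuous_on_sum continuous_on_diff continuous_on_mult continuous_on_inner continuous_on_const
          bounded_bilinear.continuous_on[OF bounded_bilinear_matrix_vector_mult] 1 2 3)
  qed
  have not_pos: "\<not> EL e z1 > 0" for e
  proof
    assume pos: "EL e z1 > 0"
    have "open (O' \<inter> EL e -` {0<..})" by (rule continuous_open_preimage[OF ELc oO open_greaterThan])
    moreover have "z1 \<in> O' \<inter> EL e -` {0<..}" using pos z1O by simp
    ultimately obtain R where R: "R > 0" "cball z1 R \<subseteq> O' \<inter> EL e -` {0<..}"
      unfolding open_contains_cball by blast
    define q where "q = R / 2"
    define lo hi where "lo = z1 - Complex q q" and "hi = z1 + Complex q q"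
    have q: "q > 0" using R by (simp add: q_def)
    have cb: "cbox lo hi \<subseteq> cball z1 R"
    proof
      fix z assume "z \<in> cbox lo hi"
      then have "\<bar>Re (z - z1)\<bar> \<le> q" "\<bar>Im (z - z1)\<bar> \<le> q"
        by (auto simp: lo_def hi_def in_cbox_complex_iff)
      then have "norm (z - z1) \<le> R" using cmod_le[of "z - z1"] by (simp add: q_def)
      then show "z \<in> cball z1 R" by (simp add: dist_norm norm_minus_commute)
    qed
    have bc: "cball z1 q \<subseteq> cbox lo hi"
    proof
      fix z assume "z \<in> cball z1 q"
      then have "norm (z - z1) \<le> q" by (simp add: dist_norm norm_minus_commute)
      then have "\<bar>Re (z - z1)\<bar> \<le> q" "\<bar>Im (z - z1)\<bar> \<le> q"
        using abs_Re_le_cmod abs_Im_le_cmod order_trans by blast+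
      then show "z \<in> cbox lo hi" by (auto simp: lo_def hi_def in_cbox_complex_iff)
    qed
    define r where "r = q / 2"
    have r: "r > 0" "r < q" using q by (auto simp: r_def)
    have rbox: "cball z1 r \<subseteq> cbox lo hi" using bc r by (meson cball_subset_cball_iff dist_self le_less order_trans subset_cball subset_trans)
    have KO: "cbox lo hi \<subseteq> O'" using cb R by blast
    let ?K = "cbox lo hi"
    define \<beta> where "\<beta> = bump z1 r"
    define E where "E z a = frechet_derivative \<beta> (at z) a" for z a
    have bd: "(\<beta> has_derivative E z) (at z)" for z
      unfolding E_def \<beta>_def using smooth_on_imp_has_derivative[OF smooth_bump[of UNIV], of z] by simp
    have weak: "integral ?K (\<lambda>z. \<Sum>a\<in>{1, \<i>}. 2 * E z a * (e \<bullet> F a z) + \<beta> z * (Y a z \<bullet> (DG (y z) e *v Y a z))) = 0"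
      using harmonic_disc_weak_equation[OF u c r(1) KO[unfolded O'_def] rbox, of e]
      unfolding E_def F_def \<beta>_def Y_def DG_def y_def by simp
    have \<beta>0: "\<beta> z = 0" "E z a = 0" if "z \<notin> cball z1 r" for z a
      using that bump_eq_0[OF r(1), of z z1] bump_derivative_zero[OF r(1) that] ball_subset_cball
      unfolding \<beta>_def E_def by blast+
    \<comment> \<open>The field whose divergence relates the weak equation to \<open>EL\<close>; its support lies inside the box.\<close>
    define Q where "Q a z = (if z \<in> O' then \<beta> z * (e \<bullet> F a z) else 0)" for a z
    define DQ where "DQ a z v = (if z \<in> O' then \<beta> z * (e \<bullet> frechet_derivative (F a) (at z) v) + E z v * (e \<bullet> F a z) else 0)" for a z v
    have Qd: "(Q a has_derivative DQ a z) (at z)" for a z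
    proof (cases "z \<in> O'")
      case True
      have "((\<lambda>z. \<beta> z * (e \<bullet> F a z)) has_derivative (\<lambda>v. \<beta> z * (e \<bullet> frechet_derivative (F a) (at z) v) + E z v * (e \<bullet> F a z))) (at z)"
        by (rule has_derivative_mult[OF bd has_derivative_inner_right[OF smooth_on_imp_has_derivative[OF Fsm True]]])
      then have "(Q a has_derivative (\<lambda>v. \<beta> z * (e \<bullet> frechet_derivative (F a) (at z) v) + E z v * (e \<bullet> F a z))) (at z)"
        by (rule has_derivative_transform_within_open[OF _ oO True]) (simp add: Q_def)
      then show ?thesis using True by (simp add: DQ_def[abs_def])
    next
      case False
      have "((\<lambda>z. 0) has_derivative (\<lambda>v. 0)) (at z)" by simp
      then have "(Q a has_derivative (\<lambda>v. 0)) (at z)"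
        by (rule has_derivative_transform_within_open[of _ _ _ _ "- cball z1 r"])
          (use False rbox KO \<beta>0 in \<open>auto simp: Q_def\<close>)
      then show ?thesis using False by (simp add: DQ_def[abs_def])
    qed
    have DQc: "continuous_on UNIV (\<lambda>z. DQ a z a)" for a
    proof -
      have 1: "continuous_on O' (\<lambda>z. DQ a z a)"
      proof -
        have "continuous_on O' \<beta>" "continuous_on O' (\<lambda>z. E z a)"
          unfolding \<beta>_def E_def
          by (intro smooth_on_imp_continuous_on smooth_on_derivative smooth_bump oO)+
        moreover have "continuous_on O' (F a)" "continuous_on O' (\<lambda>z. frechet_derivative (F a) (at z) a)"
          by (intro smooth_on_imp_continuous_on smooth_on_derivative Fsm)+
        ultimately have "continuous_on O' (\<lambda>z. \<beta> z * (e \<bullet> frechet_derivative (F a) (at z) a) + E z a * (e \<bullet> F a z))"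
          by (intro continuous_intros)
        then show ?thesis by (rule continuous_on_eq) (simp add: DQ_def)
      qed
      have 2: "continuous_on (- cball z1 r) (\<lambda>z. DQ a z a)"
        by (rule continuous_on_eq[OF continuous_on_const[of _ 0]]) (use \<beta>0 in \<open>auto simp: DQ_def\<close>)
      have "O' \<union> - cball z1 r = UNIV" using rbox KO by auto
      then show ?thesis using continuous_on_open_Un[OF oO open_Compl[OF closed_cball] 1 2] by simp
    qed
    have div: "integral ?K (\<lambda>z. DQ a z a) = 0" for a
      by (rule integral_directional_derivative_eq_0[OF Qd DQc _ bc r(2)]) (use \<beta>0 in \<open>auto simp: Q_def\<close>)
    have DQK: "DQ a z a = \<beta> z * (e \<bullet> DF a z) + E z a * (e \<bullet> F a z)" if "z \<in> ?K" for a z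
      using that KO by (auto simp: DQ_def DF_def)
    have DQi: "(\<lambda>z. DQ a z a) integrable_on ?K" for a
      by (rule integrable_continuous[OF continuous_on_subset[OF DQc subset_UNIV]])
    have bELc: "continuous_on ?K (\<lambda>z. \<beta> z * EL e z)"
    proof -
      have "continuous_on ?K \<beta>" unfolding \<beta>_def
        by (rule continuous_on_subset[OF smooth_on_imp_continuous_on[OF smooth_bump[OF open_UNIV]] subset_UNIV])
      then show ?thesis by (intro continuous_on_mult continuous_on_subset[OF ELc KO])
    qed
    have "integral ?K (\<lambda>z. \<beta> z * EL e z + (\<Sum>a\<in>{1, \<i>}. 2 * DQ a z a)) = 0"
    proof -
      have eq: "\<beta> z * EL e z + (\<Sum>a\<in>{1, \<i>}. 2 * DQ a z a) =
         (\<Sum>a\<in>{1, \<i>}. 2 * E z a * (e \<bullet> F a z) + \<beta> z * (Y a z \<bullet> (DG (y z) e *v Y a z)))" if "z \<in> ?K" for z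
        unfolding EL_def sum_distrib_left sum.distrib[symmetric]
        by (intro sum.cong refl) (simp add: DQK[OF that] algebra_simps)
      show ?thesis by (subst Henstock_Kurzweil_Integration.integral_cong[OF eq]) (use weak in auto)
    qed
    moreover have "integral ?K (\<lambda>z. \<beta> z * EL e z + (\<Sum>a\<in>{1, \<i>}. 2 * DQ a z a)) =
      integral ?K (\<lambda>z. \<beta> z * EL e z) + (\<Sum>a\<in>{1, \<i>}. 2 * integral ?K (\<lambda>z. DQ a z a))"
      using integrable_continuous[OF bELc] DQi
      by (simp add: Henstock_Kurzweil_Integration.integral_add integrable_add integrable_on_mult_right)
    ultimately have I0: "integral ?K (\<lambda>z. \<beta> z * EL e z) = 0" using div by simp
    have "((\<lambda>z. \<beta> z * EL e z) has_integral 0) ?K"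
      using integrable_integral[OF integrable_continuous[OF bELc]] I0 by simp
    moreover have "0 \<le> \<beta> z * EL e z" if "z \<in> box lo hi" for z
    proof -
      have "z \<in> cball z1 R" using that cb box_subset_cbox by blast
      then have "EL e z > 0" using R by auto
      then show ?thesis by (simp add: \<beta>_def bump_nonneg)
    qed
    moreover have "box lo hi \<noteq> {}"
      using q by (auto simp: box_ne_empty Basis_complex_def lo_def hi_def)
    moreover have "z1 \<in> ?K" using bc q by auto
    ultimately have "\<beta> z1 * EL e z1 = 0" using has_integral_0_cbox_imp_0[OF bELc] by blast
    moreover have "\<beta> z1 > 0" using bump_pos_iff[OF r(1), of z1 z1] r by (simp add: \<beta>_def)
    ultimately show False using pos by simp
  qed
  have DGlin: "linear (DG (y z1))"
    unfolding DG_def using has_derivative_linear[OF smooth_on_imp_has_derivative[OF Gsm yV[OF z1O]]] .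
  have neg: "EL (- e) z1 = - EL e z1" for e
    unfolding EL_def sum_negf[symmetric]
  proof (intro sum.cong refl)
    fix a
    have "DG (y z1) (- e) *v Y a z1 = - (DG (y z1) e *v Y a z1)"
      using linear_neg[OF DGlin, of e] bounded_bilinear.minus_left[OF bounded_bilinear_matrix_vector_mult] by metis
    then show "Y a z1 \<bullet> (DG (y z1) (- e) *v Y a z1) - 2 * (- e \<bullet> DF a z1) =
       - (Y a z1 \<bullet> (DG (y z1) e *v Y a z1) - 2 * (e \<bullet> DF a z1))" by simp
  qed
  have EL0: "EL e z1 = 0" using not_pos[of e] not_pos[of "- e"] neg[of e] by linarith
  have DFe: "DF a z1 = ?G (y z1) *v YY a + DG (y z1) (Y a z1) *v Y a z1" for a
  proof -
    have yd: "(y has_derivative frechet_derivative y (at z1)) (at z1)"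
      by (rule smooth_on_imp_has_derivative[OF ysm z1O])
    have Gd: "(?G has_derivative DG (y z1)) (at (y z1))"
      unfolding DG_def by (rule smooth_on_imp_has_derivative[OF Gsm yV[OF z1O]])
    have "(F a has_derivative (\<lambda>v. ?G (y z1) *v frechet_derivative (Y a) (at z1) v + DG (y z1) (frechet_derivative y (at z1) v) *v Y a z1)) (at z1)"
      unfolding F_def
      using bounded_bilinear.FDERIV[OF bounded_bilinear_matrix_vector_mult diff_chain_at[OF yd Gd] smooth_on_imp_has_derivative[OF Ysm z1O]]
      by (simp add: comp_def)
    from fun_cong[OF frechet_derivative_at[OF this], of a] show ?thesis
      unfolding DF_def YY_def by (simp add: Y_def)
  qed
  have "2 * (e \<bullet> (?G (y z1) *v (\<Sum>a\<in>{1, \<i>}. YY a))) = (\<Sum>a\<in>{1, \<i>}. 2 * (e \<bullet> (?G (y z1) *v YY a)))"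
    by (simp add: matrix_vector_right_distrib inner_add_right)
  then show ?thesis using EL0 unfolding EL_def DFe
    by (simp add: inner_add_right algebra_simps)
qed

end

section \<open>Bounds on compact sets\<close>

lemma smooth_on_derivative_bound:
  fixes f :: "'a::euclidean_space \<Rightarrow> 'b::euclidean_space"
  assumes f: "smooth_on f S" and K: "compact K" "K \<subseteq> S"
  shows "\<exists>L>0. \<forall>y\<in>K. \<forall>v. norm (frechet_derivative f (at y) v) \<le> L * norm v"
proof -
  have "\<exists>B. \<forall>y\<in>K. norm (frechet_derivative f (at y) b) \<le> B" for b
  proof -
    have "continuous_on K (\<lambda>y. frechet_derivative f (at y) b)"
      by (rule continuous_on_subset[OF smooth_on_imp_continuous_on[OF smooth_on_derivative[OF f]] K(2)])
    then have "bounded ((\<lambda>y. frechet_derivative f (at y) b) ` K)"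
      by (intro compact_imp_bounded compact_continuous_image K(1))
    then show ?thesis by (auto simp: bounded_iff)
  qed
  then obtain B where B: "\<And>b y. y \<in> K \<Longrightarrow> norm (frechet_derivative f (at y) b) \<le> B b" by metis
  define L where "L = (\<Sum>b\<in>(Basis::'a set). \<bar>B b\<bar>) + 1"
  have "norm (frechet_derivative f (at y) v) \<le> L * norm v" if y: "y \<in> K" for y v
  proof -
    have l: "linear (frechet_derivative f (at y))"
      using has_derivative_linear[OF smooth_on_imp_has_derivative[OF f]] y K(2) by blast
    have "norm (frechet_derivative f (at y) v) = norm (\<Sum>b\<in>Basis. (v \<bullet> b) *\<^sub>R frechet_derivative f (at y) b)"
      using linear_euclidean_expand[OF l, of v] by simp
    also have "\<dots> \<le> (\<Sum>b\<in>Basis. norm ((v \<bullet> b) *\<^sub>R frechet_derivative f (at y) b))" by (rule norm_sum)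
    also have "\<dots> \<le> (\<Sum>b\<in>Basis. norm v * \<bar>B b\<bar>)"
    proof (rule sum_mono)
      fix b :: 'a assume b: "b \<in> Basis"
      have "norm (frechet_derivative f (at y) b) \<le> \<bar>B b\<bar>" using B[OF y, of b] by linarith
      then show "norm ((v \<bullet> b) *\<^sub>R frechet_derivative f (at y) b) \<le> norm v * \<bar>B b\<bar>"
        using Basis_le_norm[OF b, of v] by (simp add: mult_mono)
    qed
    also have "\<dots> \<le> L * norm v" by (simp add: L_def sum_distrib_left[symmetric] algebra_simps)
    finally show ?thesis .
  qed
  moreover have "L > 0" unfolding L_def by (intro add_nonneg_pos sum_nonneg) auto
  ultimately show ?thesis by blast
qed

lemma smooth_on_lipschitz:
  fixes f :: "'a::euclidean_space \<Rightarrow> 'b::euclidean_space"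
  assumes f: "smooth_on f S" and K: "compact K" "K \<subseteq> S" "convex K"
  shows "\<exists>L>0. \<forall>y\<in>K. \<forall>z\<in>K. norm (f y - f z) \<le> L * norm (y - z)"
proof -
  obtain L where L: "L > 0" "\<And>y v. y \<in> K \<Longrightarrow> norm (frechet_derivative f (at y) v) \<le> L * norm v"
    using smooth_on_derivative_bound[OF f K(1,2)] by metis
  have "norm (f y - f z) \<le> L * norm (y - z)" if "y \<in> K" "z \<in> K" for y z
  proof (rule differentiable_bound[where f'="\<lambda>x. frechet_derivative f (at x)", OF K(3) _ _ that])
    show "(f has_derivative frechet_derivative f (at x)) (at x within K)" if "x \<in> K" for x
      by (rule has_derivative_at_withinI[OF smooth_on_imp_has_derivative[OF f subsetD[OF K(2) that]]])
    show "onorm (frechet_derivative f (at x)) \<le> L" if "x \<in> K" for x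
      by (rule onorm_le) (rule L(2)[OF that])
  qed
  then show ?thesis using L(1) by blast
qed

text \<open>The constant is the minimum of the quadratic forms over the unit sphere and over \<open>K\<close>.\<close>

lemma pos_def_uniform_on_compact:
  fixes M :: "'a::euclidean_space \<Rightarrow> real ^ 'n ^ 'n"
  assumes M: "continuous_on K M" and K: "compact K"
    and pos: "\<And>y a. y \<in> K \<Longrightarrow> a \<noteq> 0 \<Longrightarrow> a \<bullet> (M y *v a) > 0"
  shows "\<exists>m>0. \<forall>y\<in>K. \<forall>a. a \<bullet> (M y *v a) \<ge> m * (norm a)\<^sup>2"
proof (cases "K = {}")
  case False
  let ?f = "\<lambda>p. snd p \<bullet> (M (fst p) *v snd p)"
  let ?S = "K \<times> sphere (0::real^'n) 1"
  have c: "continuous_on ?S ?f"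
    by (intro continuous_on_inner bounded_bilinear.continuous_on[OF bounded_bilinear_matrix_vector_mult]
        continuous_on_snd continuous_on_id continuous_on_compose2[OF M continuous_on_fst[OF continuous_on_id]]) auto
  have "compact ?S" using K by (intro compact_Times) auto
  moreover have "?S \<noteq> {}" using False by simp
  ultimately have "\<exists>p\<in>?S. \<forall>x\<in>?S. ?f p \<le> ?f x" using c by (rule continuous_attains_inf)
  then obtain p where p: "p \<in> ?S" "\<And>x. x \<in> ?S \<Longrightarrow> ?f p \<le> ?f x" by blast
  have "snd p \<noteq> 0" using p(1) by (auto simp: mem_Times_iff)
  then have m: "?f p > 0" using pos p(1) by (auto simp: mem_Times_iff)
  have "a \<bullet> (M y *v a) \<ge> ?f p * (norm a)\<^sup>2" if y: "y \<in> K" for y a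
  proof (cases "a = 0")
    case False
    have "(y, a /\<^sub>R norm a) \<in> ?S" using y False by simp
    from p(2)[OF this] have "?f p \<le> (a \<bullet> (M y *v a)) / (norm a)\<^sup>2"
      using False by (simp add: matrix_vector_mult_scaleR power2_eq_square divide_inverse mult_ac)
    then show ?thesis using False by (simp add: field_simps)
  qed simp
  then show ?thesis using m by blast
qed (auto intro: exI[of _ 1])

lemma matrix_vector_mult_bound:
  "\<exists>C>0. \<forall>(M::real^'n^'m) v. norm (M *v v) \<le> C * norm M * norm v"
proof -
  have "\<exists>C>0. \<forall>(M::real^'n^'m) v. norm (M *v v) \<le> norm M * norm v * C"
    by (rule bounded_bilinear.pos_bounded[OF bounded_bilinear_matrix_vector_mult])
  then show ?thesis by (simp add: mult_ac)
qed

section \<open>Uniqueness of geodesics\<close>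

text \<open>To the right of \<open>t0\<close> the function \<open>e t * exp (- C * t)\<close> is nonincreasing, and to the left
\<open>e t * exp (C * t)\<close> is nondecreasing.\<close>

lemma gronwall_zero:
  fixes e e' :: "real \<Rightarrow> real"
  assumes d: "\<And>t. t \<in> ball t0 r \<Longrightarrow> (e has_real_derivative e' t) (at t)"
    and C: "\<And>t. t \<in> ball t0 r \<Longrightarrow> \<bar>e' t\<bar> \<le> C * e t" and nn: "\<And>t. e t \<ge> 0" and e0: "e t0 = 0"
    and t: "t \<in> ball t0 r"
  shows "e t = 0"
proof -
  have in_ball: "s \<in> ball t0 r" if "\<bar>s - t0\<bar> \<le> \<bar>t - t0\<bar>" for s
    using that t by (auto simp: dist_real_def)
  show ?thesis
  proof (cases "t0 \<le> t")
    case True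
    have "e t * exp (- C * t) \<le> e t0 * exp (- C * t0)"
    proof (rule DERIV_nonpos_imp_nonincreasing[OF True, of "\<lambda>s. e s * exp (- C * s)"])
      fix s assume s: "t0 \<le> s" "s \<le> t"
      then have b: "s \<in> ball t0 r" by (intro in_ball) auto
      have "((\<lambda>s. e s * exp (- C * s)) has_real_derivative (e' s - C * e s) * exp (- C * s)) (at s)"
        by (auto intro!: derivative_eq_intros d[OF b] simp: algebra_simps)
      moreover have "e' s - C * e s \<le> 0" using C[OF b] by linarith
      ultimately show "\<exists>y. ((\<lambda>s. e s * exp (- C * s)) has_real_derivative y) (at s) \<and> y \<le> 0"
        by (meson exp_ge_zero mult_nonpos_nonneg)
    qed
    then have "e t \<le> 0" using e0 by (simp add: mult_le_0_iff not_le)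
    then show ?thesis using nn[of t] by linarith
  next
    case False
    then have le: "t \<le> t0" by simp
    have "e t * exp (C * t) \<le> e t0 * exp (C * t0)"
    proof (rule DERIV_nonneg_imp_nondecreasing[OF le, of "\<lambda>s. e s * exp (C * s)"])
      fix s assume s: "t \<le> s" "s \<le> t0"
      then have b: "s \<in> ball t0 r" by (intro in_ball) auto
      have "((\<lambda>s. e s * exp (C * s)) has_real_derivative (e' s + C * e s) * exp (C * s)) (at s)"
        by (auto intro!: derivative_eq_intros d[OF b] simp: algebra_simps)
      moreover have "e' s + C * e s \<ge> 0" using C[OF b] by linarith
      ultimately show "\<exists>y. ((\<lambda>s. e s * exp (C * s)) has_real_derivative y) (at s) \<and> y \<ge> 0"
        by (meson exp_ge_zero mult_nonneg_nonneg)
    qed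
    then have "e t \<le> 0" using e0 by (simp add: mult_le_0_iff not_le)
    then show ?thesis using nn[of t] by linarith
  qed
qed

text \<open>The two solutions are indexed by \<open>bool\<close>. The equation is kept in the form \<open>M \<sigma> \<sigma>'' = q\<close>, so that
the inverse of \<open>M\<close> never has to be differentiated: positivity of \<open>M\<close> alone bounds the difference of the
accelerations by the differences of the positions and velocities, and Gronwall's inequality applies.\<close>

lemma second_order_ode_local_unique:
  fixes M :: "real^'n \<Rightarrow> real^'n^'n" and q :: "(real^'n) \<times> (real^'n) \<Rightarrow> real^'n"
    and \<sigma> v a :: "bool \<Rightarrow> real \<Rightarrow> real^'n"
  assumes X: "open X" and M: "smooth_on M X" and q: "smooth_on q (X \<times> UNIV)"
    and pos: "\<And>y b. y \<in> X \<Longrightarrow> b \<noteq> 0 \<Longrightarrow> b \<bullet> (M y *v b) > 0"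
    and J: "open J" "t0 \<in> J"
    and d\<sigma>: "\<And>i t. t \<in> J \<Longrightarrow> (\<sigma> i has_vector_derivative v i t) (at t)"
    and dv: "\<And>i t. t \<in> J \<Longrightarrow> (v i has_vector_derivative a i t) (at t)"
    and \<sigma>X: "\<And>i t. t \<in> J \<Longrightarrow> \<sigma> i t \<in> X"
    and eq: "\<And>i t. t \<in> J \<Longrightarrow> M (\<sigma> i t) *v a i t = q (\<sigma> i t, v i t)"
    and ac: "continuous_on J (a True)"
    and init: "\<sigma> True t0 = \<sigma> False t0" "v True t0 = v False t0"
  shows "\<exists>r>0. \<forall>t\<in>ball t0 r. \<sigma> True t = \<sigma> False t"
proof -
  define y0 v0 where "y0 = \<sigma> True t0" and "v0 = v True t0"
  have y0X: "y0 \<in> X" using \<sigma>X J by (simp add: y0_def)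
  obtain \<rho> where \<rho>: "\<rho> > 0" "cball y0 \<rho> \<subseteq> X" using X y0X open_contains_cball by blast
  obtain LM where LM: "LM > 0" "\<And>y z. y \<in> cball y0 \<rho> \<Longrightarrow> z \<in> cball y0 \<rho> \<Longrightarrow> norm (M y - M z) \<le> LM * norm (y - z)"
    using smooth_on_lipschitz[OF M compact_cball \<rho>(2) convex_cball] by metis
  have qK: "cball y0 \<rho> \<times> cball v0 1 \<subseteq> X \<times> UNIV" using \<rho> by auto
  obtain Lq where Lq: "Lq > 0" "\<And>y z. y \<in> cball y0 \<rho> \<times> cball v0 1 \<Longrightarrow> z \<in> cball y0 \<rho> \<times> cball v0 1 \<Longrightarrow> norm (q y - q z) \<le> Lq * norm (y - z)"
    using smooth_on_lipschitz[OF q _ qK] by (metis compact_Times compact_cball convex_Times convex_cball)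
  obtain m where m: "m > 0" "\<And>y b. y \<in> cball y0 \<rho> \<Longrightarrow> b \<bullet> (M y *v b) \<ge> m * (norm b)\<^sup>2"
    using pos_def_uniform_on_compact[OF continuous_on_subset[OF smooth_on_imp_continuous_on[OF M] \<rho>(2)] compact_cball] pos \<rho>(2)
    by (metis subsetD)
  obtain K where K: "K > 0" "\<And>(N::real^'n^'n) b. norm (N *v b) \<le> K * norm N * norm b"
    using matrix_vector_mult_bound by metis
  obtain r0 where r0: "r0 > 0" "cball t0 r0 \<subseteq> J" using J open_contains_cball by blast
  have "bounded (a True ` cball t0 r0)"
    by (intro compact_imp_bounded compact_continuous_image continuous_on_subset[OF ac r0(2)] compact_cball)
  then obtain B where B: "B > 0" "\<And>t. t \<in> cball t0 r0 \<Longrightarrow> norm (a True t) \<le> B"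
    unfolding bounded_pos by auto
  have \<sigma>c: "continuous (at t0) (\<sigma> i)" for i using d\<sigma>[OF J(2)] by (rule has_vector_derivative_continuous)
  have vc: "continuous (at t0) (v i)" for i using dv[OF J(2)] by (rule has_vector_derivative_continuous)
  have ev: "\<exists>d>0. \<forall>t. dist t t0 < d \<longrightarrow> dist (\<sigma> i t) y0 < \<rho> \<and> dist (v i t) v0 < 1" for i
  proof -
    have i: "\<sigma> i t0 = y0" "v i t0 = v0" using init by (cases i; simp add: y0_def v0_def)+
    obtain d1 where "d1 > 0" "\<And>t. dist t t0 < d1 \<Longrightarrow> dist (\<sigma> i t) y0 < \<rho>"
      using \<sigma>c[of i] \<rho>(1) unfolding continuous_at_eps_delta i by metis
    moreover obtain d2 where "d2 > 0" "\<And>t. dist t t0 < d2 \<Longrightarrow> dist (v i t) v0 < 1"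
      using vc[of i] zero_less_one unfolding continuous_at_eps_delta i by metis
    ultimately show ?thesis by (intro exI[of _ "min d1 d2"]) auto
  qed
  obtain dT where dT: "dT > 0" "\<And>t. dist t t0 < dT \<Longrightarrow> dist (\<sigma> True t) y0 < \<rho> \<and> dist (v True t) v0 < 1"
    using ev[of True] by auto
  obtain dF where dF: "dF > 0" "\<And>t. dist t t0 < dF \<Longrightarrow> dist (\<sigma> False t) y0 < \<rho> \<and> dist (v False t) v0 < 1"
    using ev[of False] by auto
  define r where "r = Min {r0, dT, dF}"
  have r: "r > 0" "r \<le> r0" "r \<le> dT" "r \<le> dF" using r0 dT dF by (auto simp: r_def)
  have near: "\<sigma> i t \<in> cball y0 \<rho>" "v i t \<in> cball v0 1" if "t \<in> ball t0 r" for i t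
    using dT(2)[of t] dF(2)[of t] that r by (cases i; simp add: dist_commute; linarith)+
  define D W where "D t = \<sigma> True t - \<sigma> False t" and "W t = v True t - v False t" for t
  define Z where "Z t = a True t - a False t" for t
  define C where "C = (Lq + K * LM * B) / m"
  have C: "C > 0" using Lq K LM B m by (simp add: C_def add_pos_pos)
  have Zb: "norm (Z t) \<le> C * (norm (D t) + norm (W t))" if t: "t \<in> ball t0 r" for t
  proof -
    have tJ: "t \<in> J" "t \<in> cball t0 r0" using t r r0 by auto
    have "M (\<sigma> False t) *v Z t = q (\<sigma> True t, v True t) - q (\<sigma> False t, v False t) - (M (\<sigma> True t) - M (\<sigma> False t)) *v a True t"
      unfolding Z_def eq[OF tJ(1), symmetric] matrix_vector_mult_diff_distrib matrix_vector_mult_diff_rdistrib by simp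
    then have "norm (M (\<sigma> False t) *v Z t) \<le> norm (q (\<sigma> True t, v True t) - q (\<sigma> False t, v False t)) + norm ((M (\<sigma> True t) - M (\<sigma> False t)) *v a True t)"
      by (metis norm_triangle_ineq4)
    also have "\<dots> \<le> Lq * (norm (D t) + norm (W t)) + K * (LM * norm (D t)) * B"
    proof (rule add_mono)
      have "norm (q (\<sigma> True t, v True t) - q (\<sigma> False t, v False t)) \<le> Lq * norm ((\<sigma> True t, v True t) - (\<sigma> False t, v False t))"
        using near[OF t] by (intro Lq(2)) auto
      also have "norm ((\<sigma> True t, v True t) - (\<sigma> False t, v False t)) \<le> norm (D t) + norm (W t)"
        using norm_Pair_le[of "D t" "W t"] by (simp add: D_def W_def)
      finally show "norm (q (\<sigma> True t, v True t) - q (\<sigma> False t, v False t)) \<le> Lq * (norm (D t) + norm (W t))"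
        using Lq(1) by simp
      have "norm ((M (\<sigma> True t) - M (\<sigma> False t)) *v a True t) \<le> K * norm (M (\<sigma> True t) - M (\<sigma> False t)) * norm (a True t)" by (rule K(2))
      also have "\<dots> \<le> K * (LM * norm (D t)) * B"
        using LM(2)[OF near(1)[OF t, of True] near(1)[OF t, of False]] B(2)[OF tJ(2)] K(1) LM(1)
        by (intro mult_mono) (auto simp: D_def)
      finally show "norm ((M (\<sigma> True t) - M (\<sigma> False t)) *v a True t) \<le> K * (LM * norm (D t)) * B" .
    qed
    also have "\<dots> \<le> (Lq + K * LM * B) * (norm (D t) + norm (W t))"
      using K LM B by (simp add: algebra_simps)
    finally have 1: "norm (M (\<sigma> False t) *v Z t) \<le> (Lq + K * LM * B) * (norm (D t) + norm (W t))" .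
    have "m * (norm (Z t))\<^sup>2 \<le> Z t \<bullet> (M (\<sigma> False t) *v Z t)" using m(2) near(1)[OF t] by blast
    also have "\<dots> \<le> norm (Z t) * norm (M (\<sigma> False t) *v Z t)" by (rule norm_cauchy_schwarz)
    finally have "m * norm (Z t) \<le> norm (M (\<sigma> False t) *v Z t)"
      by (cases "Z t = 0") (auto simp: power2_eq_square)
    then show ?thesis using 1 m(1) by (simp add: C_def field_simps)
  qed
  define e where "e t = D t \<bullet> D t + W t \<bullet> W t" for t
  define e' where "e' t = 2 * (D t \<bullet> W t) + 2 * (W t \<bullet> Z t)" for t
  have "e t = 0" if "t \<in> ball t0 r" for t
  proof (rule gronwall_zero[of t0 r e e' "1 + 3 * C", OF _ _ _ _ that])
    fix t assume t: "t \<in> ball t0 r"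
    have tJ: "t \<in> J" using t r r0 by auto
    have Dd: "(D has_derivative (\<lambda>h. h *\<^sub>R W t)) (at t)"
      using has_vector_derivative_diff[OF d\<sigma>[OF tJ, of True] d\<sigma>[OF tJ, of False]]
      unfolding D_def W_def has_vector_derivative_def .
    have Wd: "(W has_derivative (\<lambda>h. h *\<^sub>R Z t)) (at t)"
      using has_vector_derivative_diff[OF dv[OF tJ, of True] dv[OF tJ, of False]]
      unfolding W_def Z_def has_vector_derivative_def .
    have "(e has_derivative (\<lambda>h. (D t \<bullet> (h *\<^sub>R W t) + (h *\<^sub>R W t) \<bullet> D t) + (W t \<bullet> (h *\<^sub>R Z t) + (h *\<^sub>R Z t) \<bullet> W t))) (at t)"
      unfolding e_def by (intro has_derivative_add has_derivative_inner Dd Wd)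
    then show "(e has_real_derivative e' t) (at t)"
      unfolding has_field_derivative_def e'_def
      by (rule has_derivative_eq_rhs) (auto simp: inner_commute algebra_simps)
    define x y where "x = norm (D t)" and "y = norm (W t)"
    have "\<bar>e' t\<bar> \<le> 2 * \<bar>D t \<bullet> W t\<bar> + 2 * \<bar>W t \<bullet> Z t\<bar>" unfolding e'_def by linarith
    also have "\<dots> \<le> 2 * (x * y) + 2 * (y * (C * (x + y)))"
    proof -
      have "\<bar>D t \<bullet> W t\<bar> \<le> x * y" unfolding x_def y_def by (rule Cauchy_Schwarz_ineq2)
      moreover have "\<bar>W t \<bullet> Z t\<bar> \<le> y * norm (Z t)" unfolding y_def by (rule Cauchy_Schwarz_ineq2)
      moreover have "y * norm (Z t) \<le> y * (C * (x + y))"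
        using Zb[OF t] unfolding x_def y_def by (intro mult_left_mono) auto
      ultimately show ?thesis by linarith
    qed
    also have "\<dots> = (1 + C) * (2 * (x * y)) + 2 * C * y\<^sup>2" by (simp add: algebra_simps power2_eq_square)
    also have "\<dots> \<le> (1 + C) * (x\<^sup>2 + y\<^sup>2) + 2 * C * (x\<^sup>2 + y\<^sup>2)"
      using C sum_squares_bound[of x y] by (intro add_mono mult_left_mono) auto
    also have "\<dots> = (1 + 3 * C) * e t"
      by (simp add: e_def x_def y_def power2_norm_eq_inner algebra_simps)
    finally show "\<bar>e' t\<bar> \<le> (1 + 3 * C) * e t" .
  next
    show "e t0 = 0" by (simp add: e_def D_def W_def init)
  qed (simp add: e_def)
  then have "\<forall>t\<in>ball t0 r. \<sigma> True t = \<sigma> False t"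
    by (auto simp: e_def D_def add_nonneg_eq_0_iff)
  then show ?thesis using r(1) by blast
qed

lemma pos_def_matrix_inv:
  fixes M :: "real^'n^'n"
  assumes "\<And>b. b \<noteq> 0 \<Longrightarrow> b \<bullet> (M *v b) > 0"
  shows "M *v (matrix_inv M *v x) = x"
proof -
  have "\<forall>x. M *v x = 0 \<longrightarrow> x = 0" using assms by (metis inner_zero_right less_irrefl)
  then have "invertible M" by (simp add: invertible_left_inverse matrix_left_invertible_ker)
  then have "M ** matrix_inv M = mat 1"
    unfolding matrix_inv_def invertible_def by (rule someI2_ex) simp
  then show ?thesis by (simp add: matrix_vector_mul_assoc)
qed

lemma smooth_curve_has_vector_derivative:
  fixes \<sigma> :: "real \<Rightarrow> 'b::euclidean_space"
  assumes "smooth_on \<sigma> J" "t \<in> J"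
  shows "(\<sigma> has_vector_derivative frechet_derivative \<sigma> (at t) 1) (at t)"
proof -
  note d = smooth_on_imp_has_derivative[OF assms]
  have "frechet_derivative \<sigma> (at t) h = h *\<^sub>R frechet_derivative \<sigma> (at t) 1" for h
    using linear_scale[OF has_derivative_linear[OF d], of h 1] by simp
  then show ?thesis using d unfolding has_vector_derivative_def by (metis (no_types, lifting) ext)
qed

lemma smooth_curve_vector_derivative:
  fixes \<sigma> :: "real \<Rightarrow> 'b::euclidean_space"
  assumes "smooth_on \<sigma> J" "t \<in> J"
  shows "vector_derivative \<sigma> (at t) = frechet_derivative \<sigma> (at t) 1"
  by (rule vector_derivative_at[OF smooth_curve_has_vector_derivative[OF assms]])

lemma sum_axis: "(\<Sum>l\<in>UNIV. f l *\<^sub>R axis l 1) $ k = (f k :: real)"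
  by (simp add: axis_def if_distrib cong: if_cong)

context riemannian begin

text \<open>The quadratic term of the geodesic equation after multiplication by the matrix of the metric, that
is, up to a sign, the Christoffel symbols of the first kind applied to the velocity twice.\<close>

definition geodesic_rhs :: "('m, 'n) chart \<Rightarrow> (real^'n) \<times> (real^'n) \<Rightarrow> real^'n" where
  "geodesic_rhs c = (\<lambda>(y, w). \<Sum>l\<in>UNIV. ((-1/2) * (\<Sum>i\<in>UNIV. \<Sum>j\<in>UNIV.
     (frechet_derivative (G c) (at y) (axis i 1) $ j $ l + frechet_derivative (G c) (at y) (axis j 1) $ i $ l +
      (-1) * frechet_derivative (G c) (at y) (axis l 1) $ i $ j) * (w $ i * w $ j))) *\<^sub>R axis l 1)"

lemma geodesic_rhs_smooth:
  assumes c: "c \<in> A"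
  shows "smooth_on (geodesic_rhs c) ((snd c ` fst c) \<times> UNIV)"
proof -
  let ?S = "(snd c ` fst c) \<times> (UNIV :: (real^'n) set)"
  have o: "open ?S" using chart_image_open[of "fst c" "snd c"] c by (intro open_Times) auto
  have DG: "smooth_on (\<lambda>p. frechet_derivative (G c) (at (fst p)) v $ i $ j) ?S" for v i j
  proof -
    have "smooth_on (\<lambda>p. frechet_derivative (G c) (at (fst p)) v) ?S"
      by (rule smooth_on_compose[OF smooth_on_derivative[OF G_smooth[OF c]]
            smooth_on_bounded_linear_map[OF bounded_linear_fst] o]) auto
    from smooth_on_compose[OF smooth_on_bounded_linear_map[OF bounded_linear_vec_nth, of i UNIV] this o]
    have "smooth_on (\<lambda>p. frechet_derivative (G c) (at (fst p)) v $ i) ?S" by simp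
    from smooth_on_compose[OF smooth_on_bounded_linear_map[OF bounded_linear_vec_nth, of j UNIV] this o]
    show ?thesis by simp
  qed
  have w: "smooth_on (\<lambda>p. snd p $ i) ?S" for i
    by (rule smooth_on_bounded_linear_map[OF bounded_linear_compose[OF bounded_linear_vec_nth bounded_linear_snd]])
  show ?thesis
    unfolding geodesic_rhs_def case_prod_unfold
    by (intro smooth_on_sum smooth_on_bilinear[OF bounded_bilinear_scaleR] smooth_on_bilinear[OF bounded_bilinear_mult]
        smooth_on_add DG w smooth_on_const o finite)
qed

lemma geodesic_equation:
  assumes c: "(V, \<phi>) \<in> A" and geo: "geodesic_on T A g J \<gamma>" and t: "t \<in> J" "\<gamma> t \<in> V" and J: "open J"
  defines "\<sigma> \<equiv> \<phi> \<circ> \<gamma>" and "v \<equiv> \<lambda>s. frechet_derivative (\<phi> \<circ> \<gamma>) (at s) 1"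
  shows "G (V, \<phi>) (\<sigma> t) *v frechet_derivative v (at t) 1 = geodesic_rhs (V, \<phi>) (\<sigma> t, v t)"
proof -
  let ?G = "G (V, \<phi>)"
  have sm: "smooth_map_on T A J \<gamma>" using geo by (simp add: geodesic_on_def)
  define J' where "J' = {s \<in> J. \<gamma> s \<in> V}"
  have oJ: "open J'" unfolding J'_def by (rule smooth_map_domain_open[OF sm J c])
  have \<sigma>s: "smooth_on \<sigma> J'" unfolding \<sigma>_def J'_def by (rule smooth_map_coord[OF sm c])
  have vs: "smooth_on v J'" unfolding v_def \<sigma>_def[symmetric] by (rule smooth_on_derivative[OF \<sigma>s])
  have tJ: "t \<in> J'" using t by (simp add: J'_def)
  have v: "vector_derivative \<sigma> (at s) = v s" if "s \<in> J'" for s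
    using smooth_curve_vector_derivative[OF \<sigma>s that] by (simp add: v_def \<sigma>_def)
  have "((\<lambda>s. vector_derivative \<sigma> (at s)) has_vector_derivative frechet_derivative v (at t) 1) (at t)"
    by (rule has_vector_derivative_transform_within_open[OF smooth_curve_has_vector_derivative[OF vs tJ] oJ tJ])
      (simp add: v)
  then have acc: "vector_derivative (\<lambda>s. vector_derivative \<sigma> (at s)) (at t) = frechet_derivative v (at t) 1"
    by (rule vector_derivative_at)
  have all: "\<forall>(V, \<phi>)\<in>A. \<forall>t\<in>J. \<gamma> t \<in> V \<longrightarrow>
        (let \<sigma> = \<phi> \<circ> \<gamma>; d\<sigma> = (\<lambda>s. vector_derivative \<sigma> (at s)) in
         \<forall>k. vector_derivative d\<sigma> (at t) $ k + (\<Sum>i\<in>UNIV. \<Sum>j\<in>UNIV.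
              christoffel A g (V, \<phi>) (\<sigma> t) k i j * d\<sigma> t $ i * d\<sigma> t $ j) = 0)"
    using geo unfolding geodesic_on_def by (rule conjunct2)
  have eq: "frechet_derivative v (at t) 1 $ k + (\<Sum>i\<in>UNIV. \<Sum>j\<in>UNIV. christoffel A g (V, \<phi>) (\<sigma> t) k i j * v t $ i * v t $ j) = 0" for k
  proof -
    have "\<sigma> t = \<phi> (\<gamma> t)" by (simp add: \<sigma>_def)
    then show ?thesis
      using bspec[OF all c, simplified, rule_format, OF t] acc v[OF tJ]
      unfolding Let_def \<sigma>_def[symmetric] by simp
  qed
  define X where "X i j l = frechet_derivative ?G (at (\<sigma> t)) (axis i 1) $ j $ l + frechet_derivative ?G (at (\<sigma> t)) (axis j 1) $ i $ l -
      frechet_derivative ?G (at (\<sigma> t)) (axis l 1) $ i $ j" for i j l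
  have chr: "christoffel A g (V, \<phi>) (\<sigma> t) k i j = (1/2) * (\<Sum>l\<in>UNIV. matrix_inv (?G (\<sigma> t)) $ k $ l * X i j l)" for k i j
    by (simp add: christoffel_def Let_def X_def)
  have rhs: "geodesic_rhs (V, \<phi>) (\<sigma> t, v t) $ l = (-1/2) * (\<Sum>i\<in>UNIV. \<Sum>j\<in>UNIV. X i j l * (v t $ i * v t $ j))" for l
    by (simp only: geodesic_rhs_def prod.case sum_axis) (simp add: X_def)
  have swap: "(\<Sum>i\<in>UNIV. \<Sum>j\<in>UNIV. (1/2) * (\<Sum>l\<in>UNIV. m l * X i j l) * v t $ i * v t $ j) =
     - (\<Sum>l\<in>UNIV. m l * ((-1/2) * (\<Sum>i\<in>UNIV. \<Sum>j\<in>UNIV. X i j l * (v t $ i * v t $ j))))" for m :: "'n \<Rightarrow> real"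
  proof -
    have "(\<Sum>i\<in>UNIV. \<Sum>j\<in>UNIV. (1/2) * (\<Sum>l\<in>UNIV. m l * X i j l) * v t $ i * v t $ j) =
      (\<Sum>i\<in>UNIV. \<Sum>j\<in>UNIV. \<Sum>l\<in>UNIV. m l * ((1/2) * (X i j l * (v t $ i * v t $ j))))"
      by (simp add: sum_distrib_left sum_distrib_right mult_ac)
    also have "\<dots> = (\<Sum>i\<in>UNIV. \<Sum>l\<in>UNIV. \<Sum>j\<in>UNIV. m l * ((1/2) * (X i j l * (v t $ i * v t $ j))))"
      by (intro sum.cong refl sum.swap)
    also have "\<dots> = (\<Sum>l\<in>UNIV. \<Sum>i\<in>UNIV. \<Sum>j\<in>UNIV. m l * ((1/2) * (X i j l * (v t $ i * v t $ j))))"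
      by (rule sum.swap)
    also have "\<dots> = - (\<Sum>l\<in>UNIV. m l * ((-1/2) * (\<Sum>i\<in>UNIV. \<Sum>j\<in>UNIV. X i j l * (v t $ i * v t $ j))))"
      by (simp add: sum_distrib_left sum_negf)
    finally show ?thesis .
  qed
  have "frechet_derivative v (at t) 1 = matrix_inv (?G (\<sigma> t)) *v geodesic_rhs (V, \<phi>) (\<sigma> t, v t)"
  proof (subst vec_eq_iff, intro allI)
    fix k
    have "frechet_derivative v (at t) 1 $ k = - (\<Sum>i\<in>UNIV. \<Sum>j\<in>UNIV. christoffel A g (V, \<phi>) (\<sigma> t) k i j * v t $ i * v t $ j)"
      using eq[of k] by linarith
    also have "\<dots> = (\<Sum>l\<in>UNIV. matrix_inv (?G (\<sigma> t)) $ k $ l * geodesic_rhs (V, \<phi>) (\<sigma> t, v t) $ l)"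
      unfolding chr rhs swap by simp
    also have "\<dots> = (matrix_inv (?G (\<sigma> t)) *v geodesic_rhs (V, \<phi>) (\<sigma> t, v t)) $ k"
      by (simp add: matrix_vector_mult_def)
    finally show "frechet_derivative v (at t) 1 $ k = (matrix_inv (?G (\<sigma> t)) *v geodesic_rhs (V, \<phi>) (\<sigma> t, v t)) $ k" .
  qed
  moreover have "b \<noteq> 0 \<Longrightarrow> b \<bullet> (?G (\<sigma> t) *v b) > 0" for b
    using G_pos[OF c, of "\<sigma> t" b] t by (simp add: \<sigma>_def)
  ultimately show ?thesis using pos_def_matrix_inv by metis
qed

lemma geodesic_local_unique:
  assumes J: "open J" "t0 \<in> J" and geo: "geodesic_on T A g J \<gamma>1" "geodesic_on T A g J \<gamma>2"
    and init: "\<gamma>1 t0 = \<gamma>2 t0" "differential A \<gamma>1 t0 1 = differential A \<gamma>2 t0 1"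
  shows "\<exists>r>0. \<forall>t\<in>ball t0 r. \<gamma>1 t = \<gamma>2 t"
proof -
  define \<gamma> where "\<gamma> i = (if i then \<gamma>1 else \<gamma>2)" for i
  have geo': "geodesic_on T A g J (\<gamma> i)" for i using geo by (simp add: \<gamma>_def)
  then have sm: "smooth_map_on T A J (\<gamma> i)" for i by (simp add: geodesic_on_def)
  have "\<gamma>1 t0 \<in> topspace T" using sm[of True] J by (auto simp: \<gamma>_def smooth_map_on_def continuous_map_def)
  then obtain V \<phi> where c: "(V, \<phi>) \<in> A" "\<gamma>1 t0 \<in> V" using charts_cover by blast
  define J' where "J' = {t \<in> J. \<gamma> True t \<in> V} \<inter> {t \<in> J. \<gamma> False t \<in> V}"
  have oJ': "open J'" unfolding J'_def by (intro open_Int smooth_map_domain_open[OF sm J(1) c(1)])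
  have J'i: "t \<in> J" "\<gamma> i t \<in> V" if "t \<in> J'" for t i using that by (cases i; simp add: J'_def)+
  have t0J': "t0 \<in> J'" using J c init by (simp add: J'_def \<gamma>_def)
  define \<sigma> v a where "\<sigma> i = \<phi> \<circ> \<gamma> i" and "v i s = frechet_derivative (\<phi> \<circ> \<gamma> i) (at s) 1"
    and "a i t = frechet_derivative (v i) (at t) 1" for i s t
  have \<sigma>s: "smooth_on (\<sigma> i) J'" for i
    unfolding \<sigma>_def by (rule smooth_on_subset[OF smooth_map_coord[OF sm c(1)]]) (use J'i in auto)
  have vs: "smooth_on (v i) J'" for i unfolding v_def \<sigma>_def[symmetric] by (rule smooth_on_derivative[OF \<sigma>s])
  have "\<exists>r>0. \<forall>t\<in>ball t0 r. \<sigma> True t = \<sigma> False t"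
  proof (rule second_order_ode_local_unique[of "\<phi> ` V" "G (V, \<phi>)" "geodesic_rhs (V, \<phi>)" J' t0 \<sigma> v a])
    show "smooth_on (G (V, \<phi>)) (\<phi> ` V)" using G_smooth[OF c(1)] by simp
    show "smooth_on (geodesic_rhs (V, \<phi>)) (\<phi> ` V \<times> UNIV)" using geodesic_rhs_smooth[OF c(1)] by simp
    show "0 < b \<bullet> (G (V, \<phi>) y *v b)" if "y \<in> \<phi> ` V" "b \<noteq> 0" for y b using G_pos[OF c(1)] that by simp
    show "(\<sigma> i has_vector_derivative v i t) (at t)" if "t \<in> J'" for i t
      using smooth_curve_has_vector_derivative[OF \<sigma>s that] by (simp add: \<sigma>_def v_def)
    show "(v i has_vector_derivative a i t) (at t)" if "t \<in> J'" for i t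
      using smooth_curve_has_vector_derivative[OF vs that] by (simp add: a_def)
    show "\<sigma> i t \<in> \<phi> ` V" if "t \<in> J'" for i t using J'i(2)[OF that] by (simp add: \<sigma>_def)
    show "G (V, \<phi>) (\<sigma> i t) *v a i t = geodesic_rhs (V, \<phi>) (\<sigma> i t, v i t)" if "t \<in> J'" for i t
      using geodesic_equation[OF c(1) geo' J'i(1)[OF that] J'i(2)[OF that] J(1)]
      unfolding \<sigma>_def a_def v_def[abs_def] by simp
    show "continuous_on J' (a True)"
      unfolding a_def by (rule smooth_on_imp_continuous_on[OF smooth_on_derivative[OF vs]])
    show "\<sigma> True t0 = \<sigma> False t0" using init by (simp add: \<sigma>_def \<gamma>_def)
    have "v i t0 = differential A (\<gamma> i) t0 1 (V, \<phi>)" for i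
      using c(1) J'i(2)[OF t0J'] by (simp add: v_def differential_def)
    then show "v True t0 = v False t0" using init by (simp add: \<gamma>_def)
  qed (use chart_image_open[OF c(1)] oJ' t0J' in auto)
  then obtain r where r: "r > 0" "\<And>t. t \<in> ball t0 r \<Longrightarrow> \<sigma> True t = \<sigma> False t" by blast
  obtain r' where r': "r' > 0" "ball t0 r' \<subseteq> J'" using oJ' t0J' open_contains_ball by blast
  have "\<gamma>1 t = \<gamma>2 t" if "t \<in> ball t0 (min r r')" for t
  proof -
    have "\<sigma> True t = \<sigma> False t" "t \<in> J'" using that r r' by auto
    then show ?thesis using J'i(2)[of t] inj_onD[OF chart_inj[OF c(1)], of "\<gamma>1 t" "\<gamma>2 t"]
      unfolding \<sigma>_def \<gamma>_def by (metis comp_apply)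
  qed
  then show ?thesis using r(1) r'(1) by (intro exI[of _ "min r r'"]) auto
qed

text \<open>The parameters at which both positions and velocities agree form an open set by local uniqueness.
The complement is open too: distinct positions are separated by neighbourhoods, and distinct
velocities at one position remain distinct in a chart. So connectedness of \<open>J\<close> concludes.\<close>

lemma geodesic_unique:
  assumes J: "open J" "is_interval J" "t0 \<in> J" and geo: "geodesic_on T A g J \<gamma>1" "geodesic_on T A g J \<gamma>2"
    and init: "\<gamma>1 t0 = \<gamma>2 t0" "differential A \<gamma>1 t0 1 = differential A \<gamma>2 t0 1" and t: "t \<in> J"
  shows "\<gamma>1 t = \<gamma>2 t"
proof -
  have sm: "smooth_map_on T A J \<gamma>1" "smooth_map_on T A J \<gamma>2" using geo by (simp_all add: geodesic_on_def)
  have cm: "continuous_map (top_of_set J) T \<gamma>1" "continuous_map (top_of_set J) T \<gamma>2"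
    using sm by (simp_all add: smooth_map_on_def)
  define S where "S = {t \<in> J. \<gamma>1 t = \<gamma>2 t \<and> differential A \<gamma>1 t 1 = differential A \<gamma>2 t 1}"
  have oS: "open S"
  proof (subst open_subopen, intro ballI)
    fix s assume s: "s \<in> S"
    then obtain r where r: "r > 0" "\<And>t. t \<in> ball s r \<Longrightarrow> \<gamma>1 t = \<gamma>2 t"
      using geodesic_local_unique[OF J(1) _ geo, of s] unfolding S_def by blast
    have "ball s r \<inter> J \<subseteq> S"
      using r(2) differential_cong[OF open_ball, of _ s r \<gamma>1 \<gamma>2] unfolding S_def by auto
    moreover have "open (ball s r \<inter> J)" "s \<in> ball s r \<inter> J" using J r s by (auto simp: S_def)
    ultimately show "\<exists>R. open R \<and> s \<in> R \<and> R \<subseteq> S" by blast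
  qed
  have oC: "open (J - S)"
  proof (subst open_subopen, intro ballI)
    fix s assume s: "s \<in> J - S"
    have top: "\<gamma>1 s \<in> topspace T" "\<gamma>2 s \<in> topspace T"
      using cm s by (auto simp: continuous_map_def)
    show "\<exists>R. open R \<and> s \<in> R \<and> R \<subseteq> J - S"
    proof (cases "\<gamma>1 s = \<gamma>2 s")
      case False
      then obtain N1 N2 where N: "openin T N1" "openin T N2" "\<gamma>1 s \<in> N1" "\<gamma>2 s \<in> N2" "disjnt N1 N2"
        using hausdorff top unfolding Hausdorff_space_def by metis
      have "open ({t \<in> J. \<gamma>1 t \<in> N1} \<inter> {t \<in> J. \<gamma>2 t \<in> N2})"
        by (intro open_Int open_topology_preimage[OF cm(1) J(1) N(1)] open_topology_preimage[OF cm(2) J(1) N(2)])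
      moreover have "{t \<in> J. \<gamma>1 t \<in> N1} \<inter> {t \<in> J. \<gamma>2 t \<in> N2} \<subseteq> J - S"
        using N(5) by (auto simp: S_def disjnt_iff)
      ultimately show ?thesis using s N by blast
    next
      case True
      obtain V \<phi> where c: "(V, \<phi>) \<in> A" "\<gamma>1 s \<in> V" using charts_cover top by blast
      define J' where "J' = {t \<in> J. \<gamma>1 t \<in> V} \<inter> {t \<in> J. \<gamma>2 t \<in> V}"
      have oJ': "open J'" unfolding J'_def
        by (intro open_Int smooth_map_domain_open[OF sm(1) J(1) c(1)] smooth_map_domain_open[OF sm(2) J(1) c(1)])
      have s': "s \<in> J'" using s c True by (auto simp: J'_def)
      define v1 v2 where "v1 t = frechet_derivative (\<phi> \<circ> \<gamma>1) (at t) 1" and "v2 t = frechet_derivative (\<phi> \<circ> \<gamma>2) (at t) 1" for t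
      have vc: "continuous_on J' v1" "continuous_on J' v2"
        unfolding v1_def v2_def J'_def
        by (intro smooth_on_imp_continuous_on smooth_on_derivative smooth_on_subset[OF smooth_map_coord[OF sm(1) c(1)]]
            smooth_on_subset[OF smooth_map_coord[OF sm(2) c(1)]]; blast)+
      have dv: "differential A \<gamma>1 t 1 (V, \<phi>) = v1 t" "differential A \<gamma>2 t 1 (V, \<phi>) = v2 t" if "t \<in> J'" for t
        using c(1) that by (simp_all add: differential_def v1_def v2_def J'_def)
      have "v1 s \<noteq> v2 s"
      proof
        assume "v1 s = v2 s"
        then have "differential A \<gamma>1 s 1 (V, \<phi>) = differential A \<gamma>2 s 1 (V, \<phi>)" using dv[OF s'] by simp
        moreover have "differential A \<gamma>1 s 1 \<in> tangent_space A (\<gamma>1 s)" "differential A \<gamma>2 s 1 \<in> tangent_space A (\<gamma>1 s)"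
          using differential_in_tangent_space[OF sm(1) J(1), of s 1] differential_in_tangent_space[OF sm(2) J(1), of s 1] s True by auto
        ultimately have "differential A \<gamma>1 s 1 = differential A \<gamma>2 s 1"
          using tangent_eqI[of _ "\<gamma>1 s" _ "(V, \<phi>)"] c by simp
        then show False using s True by (simp add: S_def)
      qed
      moreover have "open (J' \<inter> (\<lambda>t. v1 t - v2 t) -` (- {0}))"
        by (rule continuous_open_preimage[OF continuous_on_diff[OF vc] oJ']) (simp add: open_Compl)
      moreover have "J' \<inter> (\<lambda>t. v1 t - v2 t) -` (- {0}) \<subseteq> J - S"
      proof
        fix t assume t: "t \<in> J' \<inter> (\<lambda>t. v1 t - v2 t) -` (- {0})"
        then have "differential A \<gamma>1 t 1 (V, \<phi>) \<noteq> differential A \<gamma>2 t 1 (V, \<phi>)" using dv[of t] by simp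
        then show "t \<in> J - S" using t by (auto simp: S_def J'_def)
      qed
      ultimately show ?thesis using s' by (intro exI[of _ "J' \<inter> (\<lambda>t. v1 t - v2 t) -` (- {0})"]) auto
    qed
  qed
  have "connected J" using J(2) by (rule is_interval_connected)
  moreover have "J \<subseteq> S \<union> (J - S)" "S \<inter> (J - S) \<inter> J = {}" by auto
  moreover have "S \<inter> J \<noteq> {}" using J(3) init by (auto simp: S_def)
  ultimately have "(J - S) \<inter> J = {}" using connectedD[OF _ oS oC] by blast
  then show ?thesis using t by (auto simp: S_def)
qed

lemma geodesic_on_subset:
  assumes "geodesic_on T A g I \<gamma>" "J \<subseteq> I"
  shows "geodesic_on T A g J \<gamma>"
proof -
  have sm: "continuous_map (top_of_set I) T \<gamma>" "\<And>V \<phi>. (V, \<phi>) \<in> A \<Longrightarrow> smooth_on (\<phi> \<circ> \<gamma>) {z \<in> I. \<gamma> z \<in> V}"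
    using assms(1) unfolding geodesic_on_def smooth_map_on_def by blast+
  have 1: "smooth_on (\<phi> \<circ> \<gamma>) {z \<in> J. \<gamma> z \<in> V}" if "(V, \<phi>) \<in> A" for V \<phi>
    by (rule smooth_on_subset[OF sm(2)[OF that]]) (use assms(2) in auto)
  have 2: "continuous_map (top_of_set J) T \<gamma>"
    by (rule continuous_map_from_subtopology_mono[OF sm(1) assms(2)])
  have "smooth_map_on T A J \<gamma>"
    unfolding smooth_map_on_def using 1 2 by auto
  then show ?thesis using assms(1) subsetD[OF assms(2)] unfolding geodesic_on_def by fast
qed

text \<open>Two geodesics that witness \<open>riem_exp\<close> may live on different intervals; they agree on the intersection,
which still contains \<open>0\<close> and \<open>1\<close>.\<close>

lemma riem_exp_unique:
  assumes "riem_exp T A g p v q1" "riem_exp T A g p v q2"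
  shows "q1 = q2"
proof -
  obtain I1 \<gamma>1 where 1: "open I1" "is_interval I1" "0 \<in> I1" "1 \<in> I1" "geodesic_on T A g I1 \<gamma>1"
    "\<gamma>1 0 = p" "differential A \<gamma>1 0 1 = v" "\<gamma>1 1 = q1"
    using assms(1) unfolding riem_exp_def by blast
  obtain I2 \<gamma>2 where 2: "open I2" "is_interval I2" "0 \<in> I2" "1 \<in> I2" "geodesic_on T A g I2 \<gamma>2"
    "\<gamma>2 0 = p" "differential A \<gamma>2 0 1 = v" "\<gamma>2 1 = q2"
    using assms(2) unfolding riem_exp_def by blast
  have "\<gamma>1 1 = \<gamma>2 1"
    by (rule geodesic_unique[of "I1 \<inter> I2" 0])
      (use 1 2 in \<open>auto intro: geodesic_on_subset is_interval_Int\<close>)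
  then show ?thesis using 1 2 by simp
qed

section \<open>Comparing normal coordinates at one point\<close>

lemma frame_combination_tangent:
  assumes "\<And>i. e i \<in> tangent_space A p"
  shows "(\<lambda>c. s *\<^sub>R (\<Sum>i\<in>UNIV. (y $ i) *\<^sub>R e i c)) \<in> tangent_space A p"
proof -
  have "s *\<^sub>R (\<Sum>i\<in>UNIV. (y $ i) *\<^sub>R e i d) =
      frechet_derivative (transition c d) (at (snd c p)) (s *\<^sub>R (\<Sum>i\<in>UNIV. (y $ i) *\<^sub>R e i c))"
    if "c \<in> A" "d \<in> A" "p \<in> fst c \<and> p \<in> fst d" for c d
  proof -
    have l: "linear (frechet_derivative (transition c d) (at (snd c p)))"
      by (rule transition_linear) (use that in auto)
    have "e i d = frechet_derivative (transition c d) (at (snd c p)) (e i c)" for i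
      by (rule tangent_transform[OF assms]) (use that in auto)
    then show ?thesis by (simp add: linear_scale[OF l] linear_sum[OF l])
  qed
  moreover have "s *\<^sub>R (\<Sum>i\<in>UNIV. (y $ i) *\<^sub>R e i c) = 0" if "\<not> (c \<in> A \<and> p \<in> fst c)" for c
    using tangent_outside[OF assms that] by simp
  ultimately show ?thesis unfolding tangent_space_def by blast
qed

lemma frame_norm:
  assumes c: "c \<in> A" "p \<in> fst c" and e: "\<And>i. e i \<in> tangent_space A p"
    and on: "\<And>i j. g p (e i) (e j) = (if i = j then 1 else 0)"
  shows "(\<Sum>i\<in>UNIV. (y $ i) *\<^sub>R e i c) \<bullet> (G c (snd c p) *v (\<Sum>i\<in>UNIV. (y $ i) *\<^sub>R e i c)) = (norm y)\<^sup>2"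
proof -
  have Gij: "e i c \<bullet> (G c (snd c p) *v e j c) = (if i = j then 1 else 0)" for i j
    using metric_in_chart[OF c e e, of i j] on by simp
  have mv: "M *v (\<Sum>i\<in>UNIV. (y $ i) *\<^sub>R e i c) = (\<Sum>i\<in>UNIV. (y $ i) *\<^sub>R (M *v e i c))" for M :: "real^'n^'n"
    by (simp add: linear_sum[OF matrix_vector_mul_linear] matrix_vector_mult_scaleR)
  have "(\<Sum>i\<in>UNIV. (y $ i) *\<^sub>R e i c) \<bullet> (G c (snd c p) *v (\<Sum>i\<in>UNIV. (y $ i) *\<^sub>R e i c)) =
    (\<Sum>i\<in>UNIV. \<Sum>j\<in>UNIV. y $ i * (y $ j * (e j c \<bullet> (G c (snd c p) *v e i c))))"
    unfolding mv by (simp add: inner_sum_left inner_sum_right sum_distrib_left)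
  also have "\<dots> = (\<Sum>i\<in>UNIV. y $ i * y $ i)"
    unfolding Gij by (simp add: if_distrib cong: if_cong)
  also have "\<dots> = (norm y)\<^sup>2" by (simp add: power2_norm_eq_inner inner_vec_def)
  finally show ?thesis .
qed

text \<open>The two orthonormal frames at \<open>p\<close> differ by an orthogonal map \<open>R\<close>, so the coordinate vectors \<open>y\<close> and
\<open>(s / s0) R y\<close> stand for the same initial velocity. Uniqueness of the exponential map identifies the
points with these coordinates, provided that \<open>(s / s0) R y\<close> lies in the range of \<open>x0\<close>. If it did not,
some multiple of \<open>y\<close> would be the coordinate vector of a point at which \<open>x0\<close> has norm \<open>2\<close>, although \<open>U\<close>
contains only points where this norm is less than \<open>r \<le> 1\<close>.\<close>

lemma normal_coordinates_similar:
  assumes N0: "normal_coordinates T A g p s0 U0 x0" and N: "normal_coordinates T A g p s U x"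
    and U: "U \<subseteq> {q \<in> U0. norm (x0 q) < r}" and r: "r \<le> 1"
  obtains R where "linear R" "\<And>y. norm (R y) = norm y" "\<And>q. q \<in> U \<Longrightarrow> x0 q = (s / s0) *\<^sub>R R (x q)"
    "U = {q \<in> U0. norm (x0 q) < 3 * (s / s0)}" "3 * (s / s0) \<le> r"
proof -
  have c0: "(U0, x0) \<in> A" "x0 ` U0 = ball 0 3" "p \<in> U0" "x0 p = 0" "s0 > 0"
    using N0 by (auto simp: normal_coordinates_def)
  have c: "(U, x) \<in> A" "x ` U = ball 0 3" "p \<in> U" "x p = 0" "s > 0"
    using N by (auto simp: normal_coordinates_def)
  obtain e0 where e0: "\<And>i. e0 i \<in> tangent_space A p" "\<And>i j. g p (e0 i) (e0 j) = (if i = j then 1 else 0)"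
    "\<And>y. y \<in> ball 0 3 \<Longrightarrow> riem_exp T A g p (\<lambda>c. s0 *\<^sub>R (\<Sum>i\<in>UNIV. (y $ i) *\<^sub>R e0 i c)) (inv_into U0 x0 y)"
    using N0 unfolding normal_coordinates_def by blast
  obtain e where e: "\<And>i. e i \<in> tangent_space A p" "\<And>i j. g p (e i) (e j) = (if i = j then 1 else 0)"
    "\<And>y. y \<in> ball 0 3 \<Longrightarrow> riem_exp T A g p (\<lambda>c. s *\<^sub>R (\<Sum>i\<in>UNIV. (y $ i) *\<^sub>R e i c)) (inv_into U x y)"
    using N unfolding normal_coordinates_def by blast
  let ?c = "(U0, x0)"
  define M where "M = G ?c (x0 p)"
  define L0 L where "L0 y = (\<Sum>i\<in>UNIV. (y $ i) *\<^sub>R e0 i ?c)" and "L y = (\<Sum>i\<in>UNIV. (y $ i) *\<^sub>R e i ?c)" for y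
  have lin: "linear L0" "linear L"
    unfolding L0_def L_def
    by (intro linearI; simp add: scaleR_add_left sum.distrib scaleR_sum_right)+
  have n0: "L0 y \<bullet> (M *v L0 y) = (norm y)\<^sup>2" for y
    using frame_norm[of ?c p e0 y] c0 e0(1,2) by (simp add: L0_def M_def)
  have n: "L y \<bullet> (M *v L y) = (norm y)\<^sup>2" for y
    using frame_norm[of ?c p e y] c0 e(1,2) by (simp add: L_def M_def)
  have "inj L0"
  proof (subst linear_injective_0[OF lin(1)], intro allI impI)
    fix y assume "L0 y = 0"
    then show "y = 0" using n0[of y] by simp
  qed
  then obtain L0' where L0': "linear L0'" "\<And>y. L0 (L0' y) = y"
    using linear_injective_isomorphism[OF lin(1)] by blast
  define R where "R y = L0' (L y)" for y
  have Rlin: "linear R" unfolding R_def using linear_compose[OF lin(2) L0'(1)] by (simp add: comp_def)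
  have LR: "L0 (R y) = L y" for y by (simp add: R_def L0')
  have "(norm (R y))\<^sup>2 = (norm y)\<^sup>2" for y using n0[of "R y"] n[of y] by (simp add: LR)
  then have Rn: "norm (R y) = norm y" for y by (metis norm_ge_zero power2_eq_imp_eq)
  define k where "k = s / s0"
  have k: "k > 0" using c c0 by (simp add: k_def)
  have vec: "(\<lambda>c. s *\<^sub>R (\<Sum>i\<in>UNIV. (y $ i) *\<^sub>R e i c)) = (\<lambda>c. s0 *\<^sub>R (\<Sum>i\<in>UNIV. ((k *\<^sub>R R y) $ i) *\<^sub>R e0 i c))" for y
  proof (rule tangent_eqI[OF frame_combination_tangent[OF e(1)] frame_combination_tangent[OF e0(1)] c0(1)])
    have "s *\<^sub>R L y = s0 *\<^sub>R L0 (k *\<^sub>R R y)"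
      using c0(5) by (simp add: linear_scale[OF lin(1)] LR k_def)
    then show "s *\<^sub>R (\<Sum>i\<in>UNIV. (y $ i) *\<^sub>R e i ?c) = s0 *\<^sub>R (\<Sum>i\<in>UNIV. ((k *\<^sub>R R y) $ i) *\<^sub>R e0 i ?c)"
      by (simp add: L_def L0_def)
  qed (use c0 in simp)
  have same: "inv_into U x y = inv_into U0 x0 (k *\<^sub>R R y)" if "norm y < 3" "norm (k *\<^sub>R R y) < 3" for y
    by (rule riem_exp_unique[OF e(3)[of y, unfolded vec] e0(3)]) (use that in auto)
  have inU: "inv_into U x y \<in> U" "x (inv_into U x y) = y" if "norm y < 3" for y
    using that c(2) by (auto intro: inv_into_into f_inv_into_f)
  have small: "norm (k *\<^sub>R R y) < r" "x0 (inv_into U x y) = k *\<^sub>R R y" if y: "norm y < 3" for y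
  proof -
    have *: "norm (k *\<^sub>R R z) < r \<and> x0 (inv_into U x z) = k *\<^sub>R R z" if "norm z < 3" "norm (k *\<^sub>R R z) < 3" for z
    proof -
      have "x0 (inv_into U0 x0 (k *\<^sub>R R z)) = k *\<^sub>R R z" using that c0(2) by (intro f_inv_into_f) simp
      then have x: "x0 (inv_into U x z) = k *\<^sub>R R z" using same[OF that] by simp
      moreover have "norm (x0 (inv_into U x z)) < r" using inU(1)[OF that(1)] U by auto
      ultimately show ?thesis by simp
    qed
    have "norm (k *\<^sub>R R y) < 3"
    proof (rule ccontr)
      assume "\<not> ?thesis"
      then have b: "norm (k *\<^sub>R R y) \<ge> 3" by simp
      define \<tau> where "\<tau> = 2 / norm (k *\<^sub>R R y)"
      have \<tau>: "\<tau> > 0" "\<tau> \<le> 1" and \<tau>2: "\<tau> * norm (k *\<^sub>R R y) = 2"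
      proof -
        have "2 / N > 0 \<and> 2 / N \<le> 1 \<and> 2 / N * N = 2" if "N \<ge> 3" for N :: real
          using that by auto
        from this[OF b] show "\<tau> > 0" "\<tau> \<le> 1" "\<tau> * norm (k *\<^sub>R R y) = 2" by (simp_all only: \<tau>_def)
      qed
      have sc: "k *\<^sub>R R (\<tau> *\<^sub>R y) = \<tau> *\<^sub>R (k *\<^sub>R R y)" by (simp add: linear_scale[OF Rlin])
      have "norm (\<tau> *\<^sub>R (k *\<^sub>R R y)) = \<tau> * norm (k *\<^sub>R R y)" using \<tau> k by (simp add: abs_mult)
      also note \<tau>2
      finally have n2: "norm (k *\<^sub>R R (\<tau> *\<^sub>R y)) = 2" by (simp only: sc)
      have "norm (\<tau> *\<^sub>R y) \<le> norm y" using \<tau> by (simp add: mult_left_le_one_le)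
      then have "norm (k *\<^sub>R R (\<tau> *\<^sub>R y)) < r" using *[of "\<tau> *\<^sub>R y"] n2 y by simp
      then show False using n2 r by simp
    qed
    then show "norm (k *\<^sub>R R y) < r" "x0 (inv_into U x y) = k *\<^sub>R R y" using *[OF y] by auto
  qed
  have xq: "x0 q = k *\<^sub>R R (x q)" "norm (x q) < 3" if "q \<in> U" for q
  proof -
    show 3: "norm (x q) < 3" using that c(2) by force
    show "x0 q = k *\<^sub>R R (x q)" using small(2)[OF 3] chart_inv[OF c(1) that] by simp
  qed
  have 3: "3 * k \<le> r"
  proof (rule ccontr)
    assume "\<not> ?thesis"
    then have "r / k < 3" using k by (simp add: divide_less_eq)
    moreover have "r > 0"
      using small(1)[of 0] by (simp add: linear_0[OF Rlin])
    moreover obtain y :: "real^'n" where "norm y = r / k" using vector_choose_size[of "r / k"] calculation k by auto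
    ultimately have "norm (k *\<^sub>R R y) < r" using small(1)[of y] by simp
    then show False using \<open>norm y = r / k\<close> k by (simp add: Rn)
  qed
  have Ueq: "U = {q \<in> U0. norm (x0 q) < 3 * k}"
  proof (intro equalityI subsetI)
    fix q assume "q \<in> U"
    then show "q \<in> {q \<in> U0. norm (x0 q) < 3 * k}" using xq[of q] U k by (auto simp: Rn)
  next
    fix q assume q: "q \<in> {q \<in> U0. norm (x0 q) < 3 * k}"
    have "inj R"
    proof (subst linear_injective_0[OF Rlin], intro allI impI)
      fix y assume "R y = 0" then show "y = 0" using Rn[of y] by simp
    qed
    then have "surj R" by (intro linear_injective_imp_surjective[OF Rlin]) (simp_all)
    then obtain y where y: "(1 / k) *\<^sub>R x0 q = R y" by (metis surjD)
    then have Ry: "k *\<^sub>R R y = x0 q" using k by (metis divide_self_if eq_divide_eq_1 less_irrefl mult.commute nonzero_mult_div_cancel_left scaleR_one scaleR_scaleR times_divide_eq_right)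
    have "k * norm y < 3 * k" using q Ry k by (metis (no_types, lifting) Rn abs_of_pos mem_Collect_eq norm_scaleR)
    then have "norm y < 3" using k by simp
    then have "x0 (inv_into U x y) = x0 q" "inv_into U x y \<in> U" using small(2) Ry inU by auto
    then have "inv_into U x y = q" using inj_onD[OF chart_inj[OF c0(1)]] q U by blast
    then show "q \<in> U" using \<open>inv_into U x y \<in> U\<close> by simp
  qed
  show ?thesis using that[OF Rlin Rn] xq(1) Ueq 3 unfolding k_def by blast
qed

lemma tangent_norm_similar:
  assumes c0: "(U0, x0) \<in> A" and c: "(U, x) \<in> A" and U: "U \<subseteq> U0" and R: "linear R" "\<And>y. norm (R y) = norm y"
    and k: "k > 0" and x0: "\<And>q. q \<in> U \<Longrightarrow> x0 q = k *\<^sub>R R (x q)" and w: "w \<in> U" and \<xi>: "\<xi> \<in> tangent_space A w"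
  shows "norm (\<xi> (U0, x0)) = k * norm (\<xi> (U, x))"
proof -
  have "((\<lambda>y. k *\<^sub>R R y) has_derivative (\<lambda>y. k *\<^sub>R R y)) (at (x w))"
    using R(1) by (intro has_derivative_scaleR_right linear_imp_has_derivative)
  then have "(transition (U, x) (U0, x0) has_derivative (\<lambda>y. k *\<^sub>R R y)) (at (x w))"
    by (rule has_derivative_transform_within_open[OF _ chart_image_open[OF c]])
      (use w x0 chart_inv[OF c] in \<open>auto simp: transition_def\<close>)
  from frechet_derivative_at[OF this] have "\<xi> (U0, x0) = k *\<^sub>R R (\<xi> (U, x))"
    using tangent_transform[OF \<xi> c c0] w U by (metis fst_conv snd_conv subsetD)
  then show ?thesis using k R(2) by simp
qed

end

section \<open>A Schwarz lemma by the maximum principle\<close>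

text \<open>Otherwise the open sets \<open>{w. E w < E (f z)}\<close> with \<open>f z\<close> of larger value than \<open>z\<close> cover \<open>X\<close>, and a finite
subcover misses the point \<open>f z\<close> at which \<open>E (f z)\<close> is largest.\<close>

lemma usc_attains_max:
  fixes E :: "'a::topological_space \<Rightarrow> real"
  assumes X: "compact X" "X \<noteq> {}"
    and usc: "\<And>z a. z \<in> X \<Longrightarrow> E z < a \<Longrightarrow> \<exists>N. open N \<and> z \<in> N \<and> (\<forall>w\<in>N \<inter> X. E w < a)"
  shows "\<exists>z\<in>X. \<forall>w\<in>X. E w \<le> E z"
proof (rule ccontr)
  assume "\<not> ?thesis"
  then have "\<forall>z\<in>X. \<exists>w\<in>X. E z < E w" by (meson not_le)
  then obtain f where f: "\<And>z. z \<in> X \<Longrightarrow> f z \<in> X \<and> E z < E (f z)" by metis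
  have "\<forall>z\<in>X. \<exists>N. open N \<and> z \<in> N \<and> (\<forall>w\<in>N \<inter> X. E w < E (f z))"
    using usc f by blast
  then obtain N where N: "\<And>z. z \<in> X \<Longrightarrow> open (N z) \<and> z \<in> N z \<and> (\<forall>w\<in>N z \<inter> X. E w < E (f z))" by metis
  obtain Z where Z: "Z \<subseteq> X" "finite Z" "X \<subseteq> (\<Union>z\<in>Z. N z)"
    by (rule compactE_image[OF X(1), of X N]) (use N in blast)+
  have "Z \<noteq> {}" using Z X(2) by auto
  define m where "m = Max ((\<lambda>z. E (f z)) ` Z)"
  have "m \<in> (\<lambda>z. E (f z)) ` Z" unfolding m_def using \<open>Z \<noteq> {}\<close> Z(2) by (intro Max_in) auto
  then obtain z where "z \<in> Z" "m = E (f z)" by blast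
  moreover have "E (f w) \<le> m" if "w \<in> Z" for w unfolding m_def using that Z(2) by (intro Max_ge) auto
  ultimately have z: "z \<in> Z" "\<And>w. w \<in> Z \<Longrightarrow> E (f w) \<le> E (f z)" by auto
  have "f z \<in> X" using f z Z by blast
  then obtain w where "w \<in> Z" "f z \<in> N w" using Z by blast
  then have "E (f z) < E (f w)" using N Z \<open>f z \<in> X\<close> by blast
  then show False using z(2)[OF \<open>w \<in> Z\<close>] by simp
qed

text \<open>This is \<open>ln \<tau> + \<kappa> sqrt \<tau>\<close> minus its first order Taylor polynomial at \<open>1\<close>, which is why it vanishes there
to second order and has a \<open>C\<^sup>1\<close> extension by \<open>0\<close>. The root is there to compensate the variation of
the metric near the pole.\<close>

definition cutoff_log :: "real \<Rightarrow> real \<Rightarrow> real" where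
  "cutoff_log \<kappa> \<tau> = ln \<tau> - (\<tau> - 1) - \<kappa> / 2 * (sqrt \<tau> - 1)\<^sup>2"

text \<open>The exponential of \<open>cutoff_log\<close>, extended continuously by \<open>0\<close> at \<open>\<tau> = 0\<close> and by \<open>1\<close> for \<open>\<tau> \<ge> 1\<close>.\<close>

definition cutoff_exp :: "real \<Rightarrow> real \<Rightarrow> real" where
  "cutoff_exp \<kappa> \<tau> = min \<tau> 1 * exp (- (min \<tau> 1 - 1) - \<kappa> / 2 * (sqrt (min \<tau> 1) - 1)\<^sup>2)"

lemma cutoff_exp_eq: "0 < \<tau> \<Longrightarrow> \<tau> \<le> 1 \<Longrightarrow> cutoff_exp \<kappa> \<tau> = exp (cutoff_log \<kappa> \<tau>)"
proof -
  assume t: "0 < \<tau>" "\<tau> \<le> 1"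
  have "exp (cutoff_log \<kappa> \<tau>) = exp (ln \<tau> + (- (\<tau> - 1) - \<kappa> / 2 * (sqrt \<tau> - 1)\<^sup>2))"
    by (simp add: cutoff_log_def)
  also have "\<dots> = cutoff_exp \<kappa> \<tau>" unfolding exp_add using t by (simp add: cutoff_exp_def)
  finally show ?thesis by simp
qed

lemma cutoff_exp_eq_1: "\<tau> \<ge> 1 \<Longrightarrow> cutoff_exp \<kappa> \<tau> = 1"
  by (simp add: cutoff_exp_def min_def)

lemma cutoff_log_nonpos: "0 < \<tau> \<Longrightarrow> \<kappa> \<ge> 0 \<Longrightarrow> cutoff_log \<kappa> \<tau> \<le> 0"
  using ln_le_minus_one[of \<tau>] unfolding cutoff_log_def
  by (smt (verit, best) divide_nonneg_nonneg mult_nonneg_nonneg zero_le_power2)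

lemma cutoff_exp_le_1: "0 \<le> \<tau> \<Longrightarrow> \<kappa> \<ge> 0 \<Longrightarrow> cutoff_exp \<kappa> \<tau> \<le> 1"
  using cutoff_exp_eq[of \<tau> \<kappa>] cutoff_log_nonpos[of \<tau> \<kappa>] cutoff_exp_eq_1[of \<tau> \<kappa>]
  by (cases "\<tau> = 0"; cases "\<tau> \<le> 1") (auto simp: cutoff_exp_def)

lemma cutoff_exp_upper: "0 \<le> \<tau> \<Longrightarrow> \<kappa> \<ge> 0 \<Longrightarrow> cutoff_exp \<kappa> \<tau> \<le> exp 1 * \<tau>"
proof -
  assume t: "0 \<le> \<tau>" and k: "\<kappa> \<ge> 0"
  have "- (min \<tau> 1 - 1) - \<kappa> / 2 * (sqrt (min \<tau> 1) - 1)\<^sup>2 \<le> 1"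
    using t k by (smt (verit, best) divide_nonneg_nonneg mult_nonneg_nonneg zero_le_power2)
  then have "cutoff_exp \<kappa> \<tau> \<le> min \<tau> 1 * exp 1"
    unfolding cutoff_exp_def using t by (intro mult_left_mono) auto
  also have "\<dots> \<le> exp 1 * \<tau>" by simp
  finally show ?thesis .
qed

lemma cutoff_exp_lower:
  assumes "0 \<le> \<tau>" "\<tau> \<le> 1" "\<kappa> \<ge> 0"
  shows "\<tau> * exp (- \<kappa> / 2) \<le> cutoff_exp \<kappa> \<tau>"
proof -
  have "0 \<le> sqrt \<tau>" "sqrt \<tau> \<le> 1" using assms by auto
  then have "\<bar>sqrt \<tau> - 1\<bar> \<le> 1" by linarith
  then have "(sqrt \<tau> - 1)\<^sup>2 \<le> 1" by (simp add: abs_square_le_1)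
  then have "\<kappa> / 2 * (sqrt \<tau> - 1)\<^sup>2 \<le> \<kappa> / 2 * 1" using assms by (intro mult_left_mono) auto
  then show ?thesis unfolding cutoff_exp_def using assms by (auto intro!: mult_left_mono)
qed

text \<open>At points with \<open>\<tau> = 1\<close> the extended function has no second derivative. This smooth minorant touches
it there and serves as a substitute.\<close>

lemma cutoff_log_lower_at_1:
  assumes "1 / 2 \<le> \<tau>" "\<kappa> \<ge> 0"
  shows "- (2 + \<kappa> / 2) * (\<tau> - 1)\<^sup>2 \<le> cutoff_log \<kappa> \<tau>"
proof -
  have t: "\<tau> > 0" using assms by simp
  have "ln (inverse \<tau>) \<le> inverse \<tau> - 1" by (rule ln_le_minus_one) (use t in simp)
  then have "ln \<tau> - (\<tau> - 1) \<ge> 1 - inverse \<tau> - (\<tau> - 1)" using t by (simp add: ln_inverse)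
  also have "1 - inverse \<tau> - (\<tau> - 1) = - ((\<tau> - 1)\<^sup>2 * inverse \<tau>)"
    using t by (simp add: field_simps power2_eq_square)
  finally have "ln \<tau> - (\<tau> - 1) \<ge> - ((\<tau> - 1)\<^sup>2 * inverse \<tau>)" .
  moreover have "(\<tau> - 1)\<^sup>2 * inverse \<tau> \<le> (\<tau> - 1)\<^sup>2 * 2"
    using assms(1) t by (intro mult_left_mono) (auto simp: field_simps)
  moreover have "(sqrt \<tau> - 1)\<^sup>2 \<le> (\<tau> - 1)\<^sup>2"
  proof -
    have "\<tau> - 1 = (sqrt \<tau> - 1) * (sqrt \<tau> + 1)" using t by (simp add: algebra_simps)
    then have "(\<tau> - 1)\<^sup>2 = (sqrt \<tau> - 1)\<^sup>2 * (sqrt \<tau> + 1)\<^sup>2" by (simp add: power_mult_distrib)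
    moreover have "(sqrt \<tau> + 1)\<^sup>2 \<ge> 1" using t by (simp add: one_le_power)
    ultimately show ?thesis by (metis mult_left_mono mult.right_neutral zero_le_power2)
  qed
  then have "\<kappa> / 2 * (sqrt \<tau> - 1)\<^sup>2 \<le> \<kappa> / 2 * (\<tau> - 1)\<^sup>2" using assms by (intro mult_left_mono) auto
  ultimately show ?thesis unfolding cutoff_log_def by (simp add: algebra_simps)
qed

lemma cutoff_log_derivs:
  assumes r: "r > 0" and t: "t > 0"
  shows "((\<lambda>t. cutoff_log (2 * a * r) (t / r\<^sup>2)) has_real_derivative (1 / t + a / sqrt t - (1 + a * r) / r\<^sup>2)) (at t)"
    and "((\<lambda>t. 1 / t + a / sqrt t - (1 + a * r) / r\<^sup>2) has_real_derivative (- (1 / t\<^sup>2) - a / (2 * (t * sqrt t)))) (at t)"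
proof -
  define s where "s = sqrt t"
  have s: "s > 0" "t = s\<^sup>2" using t by (auto simp: s_def)
  have sq: "sqrt (t / r\<^sup>2) = s / r" using r by (simp add: real_sqrt_divide s_def)
  have sq': "sqrt (x / r\<^sup>2) = sqrt x / r" for x using r by (simp add: real_sqrt_divide)
  define c d where "c = 1 / r\<^sup>2" and "d = 1 / r"
  have cd: "c > 0" "c = d * d" "d * r = 1" using r by (auto simp: c_def d_def power2_eq_square)
  have "((\<lambda>t. ln (t * c) - (t * c - 1) - a * r * (sqrt t * d - 1)\<^sup>2) has_real_derivative
     (inverse (t * c) * c - c - a * r * (2 * (sqrt t * d - 1) * (inverse (sqrt t) / 2 * d)))) (at t)"
    using r t cd(1) by (auto intro!: derivative_eq_intros simp: field_simps)
  also have "inverse (t * c) * c - c - a * r * (2 * (sqrt t * d - 1) * (inverse (sqrt t) / 2 * d)) =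
     1 / t - c - a * (d * r) * d + a * (d * r) / s"
    unfolding s_def[symmetric] using s cd(1) by (simp add: field_simps)
  also have "\<dots> = 1 / t + a / sqrt t - (1 + a * r) / r\<^sup>2"
    unfolding cd(3) using r by (simp add: c_def d_def s_def field_simps power2_eq_square)
  also have "(\<lambda>t. ln (t * c) - (t * c - 1) - a * r * (sqrt t * d - 1)\<^sup>2) =
     (\<lambda>t. ln (t / r\<^sup>2) - (t / r\<^sup>2 - 1) - 2 * a * r / 2 * (sqrt t / r - 1)\<^sup>2)"
    by (simp add: c_def d_def fun_eq_iff)
  finally show "((\<lambda>t. cutoff_log (2 * a * r) (t / r\<^sup>2)) has_real_derivative (1 / t + a / sqrt t - (1 + a * r) / r\<^sup>2)) (at t)"
    unfolding cutoff_log_def sq' .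
  have "((\<lambda>t. 1 / t + a / sqrt t - (1 + a * r) / r\<^sup>2) has_real_derivative
      (- 1 / (t * t) + - (a * (inverse (sqrt t) / 2)) / (sqrt t * sqrt t))) (at t)"
    using t by (auto intro!: derivative_eq_intros)
  also have "- 1 / (t * t) + - (a * (inverse (sqrt t) / 2)) / (sqrt t * sqrt t) = - (1 / t\<^sup>2) - a / (2 * (t * sqrt t))"
    unfolding s_def[symmetric] using s by (simp add: field_simps power2_eq_square)
  finally show "((\<lambda>t. 1 / t + a / sqrt t - (1 + a * r) / r\<^sup>2) has_real_derivative (- (1 / t\<^sup>2) - a / (2 * (t * sqrt t)))) (at t)" .
qed

text \<open>With \<open>s = sqrt h\<close>, the left-hand side is the Laplacian of the cut-off logarithm of \<open>h / r\<^sup>2\<close>. Its terms of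
order \<open>1 / s\<^sup>2\<close> cancel as in Euclidean space. Those of order \<open>1 / s\<close> come from the errors in \<open>\<Delta>h\<close> and
\<open>N\<close> and from the root, whose coefficient is chosen such that they cancel as well.\<close>

lemma log_laplacian_lower:
  fixes a r s l \<Delta>h N :: real
  assumes a: "a > 0" and r: "0 < r" "r \<le> 1" and s: "0 < s" "s \<le> r" and l: "l > 0"
    and lo: "\<Delta>h \<ge> (4 - a * s) * l" and up: "\<Delta>h \<le> (4 + a * s) * l" and N: "N \<le> (4 + a * s) * s\<^sup>2 * l"
  shows "(1 / s\<^sup>2 + a / s - (1 + a * r) / r\<^sup>2) * \<Delta>h + (- (1 / (s\<^sup>2)\<^sup>2) - a / (2 * (s\<^sup>2 * s))) * N \<ge>
    - ((3/2) * a\<^sup>2 + (1 + a) * (4 + a)) * l / r\<^sup>2"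
proof -
  have 1: "(1 / s\<^sup>2 + a / s) * \<Delta>h \<ge> (1 / s\<^sup>2 + a / s) * ((4 - a * s) * l)"
    using a s lo by (intro mult_left_mono) auto
  have 2: "(1 / (s\<^sup>2)\<^sup>2 + a / (2 * (s\<^sup>2 * s))) * N \<le> (1 / (s\<^sup>2)\<^sup>2 + a / (2 * (s\<^sup>2 * s))) * ((4 + a * s) * s\<^sup>2 * l)"
    using a s N by (intro mult_left_mono) auto
  have 3: "(1 / s\<^sup>2 + a / s) * ((4 - a * s) * l) - (1 / (s\<^sup>2)\<^sup>2 + a / (2 * (s\<^sup>2 * s))) * ((4 + a * s) * s\<^sup>2 * l) = - (3/2) * a\<^sup>2 * l"
    using s by (simp add: field_simps power2_eq_square)
  have as: "a * s \<le> a" "a * r \<le> a" using a s r by (auto simp: mult_left_le)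
  have 4: "(1 + a * r) / r\<^sup>2 * \<Delta>h \<le> (1 + a) * (4 + a) * l / r\<^sup>2"
  proof -
    have "(1 + a * r) / r\<^sup>2 * \<Delta>h \<le> (1 + a * r) / r\<^sup>2 * ((4 + a * s) * l)"
      using a r up by (intro mult_left_mono) auto
    also have "\<dots> \<le> (1 + a) / r\<^sup>2 * ((4 + a) * l)"
      using as a r s l by (intro mult_mono divide_right_mono) auto
    finally show ?thesis by (simp add: mult_ac)
  qed
  have 5: "(3/2) * a\<^sup>2 * l \<le> (3/2) * a\<^sup>2 * l / r\<^sup>2"
  proof -
    have "r\<^sup>2 \<le> 1" using r by (simp add: power_le_one)
    then show ?thesis using a l r by (simp add: le_divide_eq mult_left_le)
  qed
  have "(1 / s\<^sup>2 + a / s - (1 + a * r) / r\<^sup>2) * \<Delta>h + (- (1 / (s\<^sup>2)\<^sup>2) - a / (2 * (s\<^sup>2 * s))) * N =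
    (1 / s\<^sup>2 + a / s) * \<Delta>h - (1 / (s\<^sup>2)\<^sup>2 + a / (2 * (s\<^sup>2 * s))) * N - (1 + a * r) / r\<^sup>2 * \<Delta>h"
    by (simp add: algebra_simps)
  also have "\<dots> \<ge> - (3/2) * a\<^sup>2 * l - (1 + a) * (4 + a) * l / r\<^sup>2"
    using 1 2 3 4 by linarith
  finally have 6: "- (3/2) * a\<^sup>2 * l - (1 + a) * (4 + a) * l / r\<^sup>2 \<le>
      (1 / s\<^sup>2 + a / s - (1 + a * r) / r\<^sup>2) * \<Delta>h + (- (1 / (s\<^sup>2)\<^sup>2) - a / (2 * (s\<^sup>2 * s))) * N" .
  have "- ((3/2) * a\<^sup>2 + (1 + a) * (4 + a)) * l / r\<^sup>2 = - ((3/2) * a\<^sup>2 * l / r\<^sup>2) - (1 + a) * (4 + a) * l / r\<^sup>2"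
    using r by (simp add: field_simps)
  then show ?thesis using 5 6 by linarith
qed

text \<open>The function \<open>- ln \<bar>z\<bar>\<^sup>2\<close>, perturbed in two ways: the additional \<open>\<eta> ln \<bar>z\<bar>\<close> leaves a negative
singularity at \<open>0\<close> once the pole is compensated by the logarithm of \<open>h\<close>, and the last summand makes the
Laplacian positive.\<close>

definition punctured_log :: "real \<Rightarrow> complex \<Rightarrow> real" where
  "punctured_log \<eta> z = (\<eta> / 2 - 1) * ln (z \<bullet> z) + \<eta> * (z \<bullet> z - 1)"

lemma punctured_log_jet:
  assumes z: "z \<noteq> 0"
  obtains l B where "jet2 (punctured_log \<eta>) z l B" "B 1 1 + B \<i> \<i> = 4 * \<eta>"
proof -
  define t where "t = z \<bullet> z"
  have t: "t > 0" using z by (simp add: t_def)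
  have q: "jet2 (\<lambda>w. w \<bullet> w) z (\<lambda>a. z \<bullet> a + a \<bullet> z) (\<lambda>b a. z \<bullet> 0 + b \<bullet> a + (a \<bullet> b + 0 \<bullet> z))"
    by (rule jet2_bilinear[OF bounded_bilinear_inner jet2_ident jet2_ident])
  have ln: "jet2 (\<lambda>w. ln (w \<bullet> w)) z (\<lambda>a. 1 / t * (z \<bullet> a + a \<bullet> z))
     (\<lambda>b a. 1 / t * (z \<bullet> 0 + b \<bullet> a + (a \<bullet> b + 0 \<bullet> z)) + (- 1 / t\<^sup>2) * (z \<bullet> b + b \<bullet> z) * (z \<bullet> a + a \<bullet> z))"
    unfolding t_def
    by (rule jet2_compose[OF q, of "{0<..}"])
      (use t in \<open>auto simp: t_def power2_eq_square intro!: derivative_eq_intros\<close>)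
  note j = jet2_add[OF jet2_linear[OF bounded_linear_mult_right ln, of "\<eta> / 2 - 1"]
      jet2_linear[OF bounded_linear_mult_right jet2_add[OF q jet2_const[of "-1"]], of \<eta>]]
  have 1: "z \<bullet> 1 = Re z" "1 \<bullet> z = Re z" "z \<bullet> \<i> = Im z" "\<i> \<bullet> z = Im z" "t = Re z * Re z + Im z * Im z"
    by (simp_all add: inner_complex_def t_def)
  have tt: "4 / t - (4 * (Re z * Re z) + 4 * (Im z * Im z)) / t\<^sup>2 = 0"
  proof -
    have "4 * (Re z * Re z) + 4 * (Im z * Im z) = 4 * t" by (simp add: 1(5))
    then show ?thesis using t by (simp add: power2_eq_square)
  qed
  show ?thesis
  proof (rule that)
    show "jet2 (punctured_log \<eta>) z
      (\<lambda>a. (\<eta> / 2 - 1) * (1 / t * (z \<bullet> a + a \<bullet> z)) + \<eta> * (z \<bullet> a + a \<bullet> z + 0))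
      (\<lambda>b a. (\<eta> / 2 - 1) * (1 / t * (z \<bullet> 0 + b \<bullet> a + (a \<bullet> b + 0 \<bullet> z)) + (- 1 / t\<^sup>2) * (z \<bullet> b + b \<bullet> z) * (z \<bullet> a + a \<bullet> z)) +
        \<eta> * (z \<bullet> 0 + b \<bullet> a + (a \<bullet> b + 0 \<bullet> z) + 0))"
      using j unfolding punctured_log_def[abs_def] by simp
    have "1 / t * 2 + - 1 / t\<^sup>2 * (2 * Re z) * (2 * Re z) + (1 / t * 2 + - 1 / t\<^sup>2 * (2 * Im z) * (2 * Im z)) =
       4 / t - (4 * (Re z * Re z) + 4 * (Im z * Im z)) / t\<^sup>2" by (simp add: add_divide_distrib)
    then have lap0: "1 / t * 2 + - 1 / t\<^sup>2 * (2 * Re z) * (2 * Re z) + (1 / t * 2 + - 1 / t\<^sup>2 * (2 * Im z) * (2 * Im z)) = 0"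
      using tt by simp
    have "(\<eta> / 2 - 1) * (1 / t * (z \<bullet> 0 + (1::complex) \<bullet> 1 + ((1::complex) \<bullet> 1 + 0 \<bullet> z)) + (- 1 / t\<^sup>2) * (z \<bullet> 1 + 1 \<bullet> z) * (z \<bullet> 1 + 1 \<bullet> z)) +
        \<eta> * (z \<bullet> 0 + (1::complex) \<bullet> 1 + ((1::complex) \<bullet> 1 + 0 \<bullet> z) + 0) +
      ((\<eta> / 2 - 1) * (1 / t * (z \<bullet> 0 + \<i> \<bullet> \<i> + (\<i> \<bullet> \<i> + 0 \<bullet> z)) + (- 1 / t\<^sup>2) * (z \<bullet> \<i> + \<i> \<bullet> z) * (z \<bullet> \<i> + \<i> \<bullet> z)) +
        \<eta> * (z \<bullet> 0 + \<i> \<bullet> \<i> + (\<i> \<bullet> \<i> + 0 \<bullet> z) + 0)) =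
      (\<eta> / 2 - 1) * (1 / t * 2 + - 1 / t\<^sup>2 * (2 * Re z) * (2 * Re z) + (1 / t * 2 + - 1 / t\<^sup>2 * (2 * Im z) * (2 * Im z))) + 4 * \<eta>"
    proof -
      have e: "(1::complex) \<bullet> 1 = 1" "\<i> \<bullet> \<i> = 1" "z \<bullet> 0 = 0" "0 \<bullet> z = 0" by (simp_all add: inner_complex_def)
      have gen: "(\<eta> / 2 - 1) * (P * (0 + 1 + (1 + 0)) + Q * (x + x) * (x + x)) + \<eta> * (0 + 1 + (1 + 0) + 0) +
        ((\<eta> / 2 - 1) * (P * (0 + 1 + (1 + 0)) + Q * (y + y) * (y + y)) + \<eta> * (0 + 1 + (1 + 0) + 0)) =
        (\<eta> / 2 - 1) * (P * 2 + Q * (2 * x) * (2 * x) + (P * 2 + Q * (2 * y) * (2 * y))) + 4 * \<eta>" for P Q x y :: real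
        by (simp add: algebra_simps)
      show ?thesis unfolding 1(1-4) e by (rule gen)
    qed
    then show "(\<eta> / 2 - 1) * (1 / t * (z \<bullet> 0 + (1::complex) \<bullet> 1 + ((1::complex) \<bullet> 1 + 0 \<bullet> z)) + (- 1 / t\<^sup>2) * (z \<bullet> 1 + 1 \<bullet> z) * (z \<bullet> 1 + 1 \<bullet> z)) +
        \<eta> * (z \<bullet> 0 + (1::complex) \<bullet> 1 + ((1::complex) \<bullet> 1 + 0 \<bullet> z) + 0) +
      ((\<eta> / 2 - 1) * (1 / t * (z \<bullet> 0 + \<i> \<bullet> \<i> + (\<i> \<bullet> \<i> + 0 \<bullet> z)) + (- 1 / t\<^sup>2) * (z \<bullet> \<i> + \<i> \<bullet> z) * (z \<bullet> \<i> + \<i> \<bullet> z)) +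
        \<eta> * (z \<bullet> 0 + \<i> \<bullet> \<i> + (\<i> \<bullet> \<i> + 0 \<bullet> z) + 0)) = 4 * \<eta>"
      unfolding lap0 by simp
  qed
qed

text \<open>With the value \<open>0\<close> at \<open>-\<infinity>\<close>, upper semicontinuity of \<open>v\<close> passes to \<open>exp_ereal \<alpha> \<circ> v\<close>.\<close>

definition exp_ereal :: "real \<Rightarrow> ereal \<Rightarrow> real" where
  "exp_ereal \<alpha> x = (if x = -\<infinity> then 0 else exp (\<alpha> * real_of_ereal x))"

lemma exp_ereal_nonneg: "exp_ereal \<alpha> x \<ge> 0"
  by (simp add: exp_ereal_def)

lemma exp_ereal_less_1: "\<alpha> > 0 \<Longrightarrow> x < 0 \<Longrightarrow> exp_ereal \<alpha> x < 1"
  by (cases x) (auto simp: exp_ereal_def mult_pos_neg)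

lemma exp_ereal_less_iff:
  assumes "\<alpha> > 0" "c > 0" "x < 0"
  shows "exp_ereal \<alpha> x < c \<longleftrightarrow> x < ereal (ln c / \<alpha>)"
proof (cases x)
  case (real y)
  have "exp (\<alpha> * y) < c \<longleftrightarrow> \<alpha> * y < ln c"
    using exp_less_cancel_iff[of "\<alpha> * y" "ln c"] assms(2) by simp
  then show ?thesis using assms(1) real by (simp add: exp_ereal_def pos_less_divide_eq mult.commute)
qed (use assms in \<open>auto simp: exp_ereal_def\<close>)

text \<open>In the application \<open>v\<close> is \<open>\<rho> \<circ> f\<close>, \<open>h\<close> is a squared distance to \<open>f 0\<close>, \<open>n\<close> is \<open>\<bar>x\<bar>\<^sup>2\<close> along the
disc, and \<open>O'\<close> consists of the points that are mapped into the chart. If the inequality failed, the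
quotient of its two sides, slightly perturbed by \<open>punctured_log\<close>, would attain a maximum on the punctured
disc, since it is small near \<open>0\<close> and near the boundary. At the maximum point the Laplacians contradict
each other. For \<open>h \<le> r\<^sup>2\<close> the gain \<open>\<alpha> \<epsilon> c1 l\<close> exceeds the loss of the cut-off logarithm; elsewhere the
cut-off is locally constant.\<close>

lemma schwarz_lemma:
  fixes v :: "complex \<Rightarrow> ereal" and h n :: "complex \<Rightarrow> real"
  assumes \<alpha>: "\<alpha> > 0" and a: "a > 0" and r: "0 < r" "r \<le> 1" and \<epsilon>: "\<epsilon> > 0" and c1: "c1 > 0"
    and neg: "\<And>z. z \<in> ball 0 1 \<Longrightarrow> v z < 0"
    and usc: "\<And>c. open {z \<in> ball 0 1. v z < ereal c}"
    and O': "open O'" "O' \<subseteq> ball 0 1" "continuous_on O' h" "\<And>z. z \<in> O' \<Longrightarrow> h z \<ge> 0"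
    and far: "open (ball 0 1 - {z \<in> O'. h z \<le> r\<^sup>2})"
    and sub: "\<And>z. z \<in> ball 0 1 \<Longrightarrow> \<exists>R>0. \<forall>\<rho>. 0 < \<rho> \<and> \<rho> < R \<longrightarrow> v z \<le> circle_mean v z \<rho>"
    and subn: "\<And>z. z \<in> O' \<Longrightarrow> h z \<le> r\<^sup>2 \<Longrightarrow> \<exists>R>0. \<forall>\<rho>. 0 < \<rho> \<and> \<rho> < R \<longrightarrow>
        v z - ereal (\<epsilon> * n z) \<le> circle_mean (\<lambda>w. v w - ereal (\<epsilon> * n w)) z \<rho>"
    and jets: "\<And>z. z \<in> O' \<Longrightarrow> 0 < h z \<Longrightarrow> h z \<le> r\<^sup>2 \<Longrightarrow> \<exists>l lh Bh ln Bn. l > 0 \<and> jet2 h z lh Bh \<and> jet2 n z ln Bn \<and>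
        c1 * l \<le> Bn 1 1 + Bn \<i> \<i> \<and>
        (4 - a * sqrt (h z)) * l \<le> Bh 1 1 + Bh \<i> \<i> \<and> Bh 1 1 + Bh \<i> \<i> \<le> (4 + a * sqrt (h z)) * l \<and>
        (lh 1)\<^sup>2 + (lh \<i>)\<^sup>2 \<le> (4 + a * sqrt (h z)) * h z * l"
    and big: "\<alpha> * \<epsilon> * c1 \<ge> ((3/2) * a\<^sup>2 + 2 * (2 + a) * (4 + a)) / r\<^sup>2"
    and origin: "r0 > 0" "\<And>z. norm z < r0 \<Longrightarrow> z \<in> O' \<and> h z \<le> C * (norm z)\<^sup>2"
    and z1: "z1 \<in> ball 0 1" "z1 \<noteq> 0"
  defines "\<Theta> \<equiv> \<lambda>z. if z \<in> O' then cutoff_exp (2 * a * r) (h z / r\<^sup>2) else 1"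
  shows "exp_ereal \<alpha> (v z1) * \<Theta> z1 \<le> (norm z1)\<^sup>2"
proof (rule ccontr)
  assume "\<not> ?thesis"
  then have contra: "(norm z1)\<^sup>2 < exp_ereal \<alpha> (v z1) * \<Theta> z1" by simp
  let ?D = "ball (0::complex) 1"
  define \<kappa> where "\<kappa> = 2 * a * r"
  have \<kappa>: "\<kappa> \<ge> 0" using a r by (simp add: \<kappa>_def)
  define V where "V z = exp_ereal \<alpha> (v z)" for z
  have V: "V z \<ge> 0" "z \<in> ?D \<Longrightarrow> V z < 1" for z
    using exp_ereal_nonneg exp_ereal_less_1[OF \<alpha> neg] by (auto simp: V_def)
  have \<tau>0: "0 \<le> h z / r\<^sup>2" if "z \<in> O'" for z using O'(4)[OF that] by simp
  have \<Theta>: "0 \<le> \<Theta> z" "\<Theta> z \<le> 1" for z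
  proof -
    show "\<Theta> z \<le> 1" using cutoff_exp_le_1[OF \<tau>0 \<kappa>] by (simp add: \<Theta>_def \<kappa>_def)
    show "0 \<le> \<Theta> z" using \<tau>0[of z] by (simp add: \<Theta>_def cutoff_exp_def)
  qed
  have \<Theta>far: "\<Theta> z = 1" if "z \<in> ?D - {z \<in> O'. h z \<le> r\<^sup>2}" for z
    using that r cutoff_exp_eq_1[of "h z / r\<^sup>2"] by (auto simp: \<Theta>_def le_divide_eq)
  have \<Theta>c: "continuous_on ?D \<Theta>"
  proof -
    have "continuous_on O' (\<lambda>z. cutoff_exp (2 * a * r) (h z / r\<^sup>2))"
      unfolding cutoff_exp_def using O'(3) r by (intro continuous_intros) auto
    then have 1: "continuous_on O' \<Theta>" by (rule continuous_on_eq) (simp add: \<Theta>_def)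
    have 2: "continuous_on (?D - {z \<in> O'. h z \<le> r\<^sup>2}) \<Theta>"
      by (rule continuous_on_eq[OF continuous_on_const[of _ 1]]) (use \<Theta>far in auto)
    have "O' \<union> (?D - {z \<in> O'. h z \<le> r\<^sup>2}) = ?D" using O'(2) by auto
    then show ?thesis using continuous_on_open_Un[OF O'(1) far 1 2] by simp
  qed
  define t1 where "t1 = z1 \<bullet> z1"
  have t1: "0 < t1" "t1 < 1" "t1 = (norm z1)\<^sup>2"
    using z1 by (auto simp: t1_def power2_norm_eq_inner[symmetric] power_less_one_iff)
  define \<sigma> where "\<sigma> = (V z1 * \<Theta> z1 / t1 - 1) / 2"
  have \<sigma>: "\<sigma> > 0" "V z1 * \<Theta> z1 = (1 + 2 * \<sigma>) * t1"
    using contra t1 by (auto simp: \<sigma>_def V_def field_simps)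
  define X where "X = - (ln t1 / 2 + t1 - 1)"
  have "ln t1 < 0" using t1(1,2) by simp
  then have X: "X > 0" unfolding X_def using t1(2) by linarith
  \<comment> \<open>So small that the perturbation leaves \<open>E z1\<close> above \<open>1 + \<sigma>\<close>.\<close>
  define \<eta> where "\<eta> = \<sigma> / ((1 + 2 * \<sigma>) * (X + 1))"
  have \<eta>: "\<eta> > 0" using \<sigma> X by (simp add: \<eta>_def)
  have \<eta>X: "\<eta> * X * (1 + 2 * \<sigma>) < \<sigma>"
  proof -
    have "\<eta> * X * (1 + 2 * \<sigma>) = \<sigma> * (X / (X + 1))" using \<sigma> X by (simp add: \<eta>_def)
    also have "\<dots> < \<sigma> * 1" using \<sigma> X by (intro mult_strict_left_mono) auto
    finally show ?thesis by simp
  qed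
  define P where "P = punctured_log \<eta>"
  have Pexp: "exp (P z) = exp (\<eta> / 2 * ln (z \<bullet> z) + \<eta> * (z \<bullet> z - 1)) / (z \<bullet> z)" if "z \<noteq> 0" for z
  proof -
    have "P z = (\<eta> / 2 * ln (z \<bullet> z) + \<eta> * (z \<bullet> z - 1)) - ln (z \<bullet> z)"
      by (simp add: P_def punctured_log_def algebra_simps)
    then show ?thesis using that by (simp add: exp_diff)
  qed
  have Ple: "exp (P z) \<le> exp (\<eta> / 2 * ln (z \<bullet> z)) / (z \<bullet> z)" if "z \<noteq> 0" "z \<in> ?D" for z
  proof -
    have "z \<bullet> z \<le> 1" using that by (simp add: power2_norm_eq_inner[symmetric] power_le_one)
    then have "\<eta> * (z \<bullet> z - 1) \<le> 0" using \<eta> by (simp add: mult_nonneg_nonpos)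
    then show ?thesis unfolding Pexp[OF that(1)] by (intro divide_right_mono) auto
  qed
  define E where "E z = V z * (\<Theta> z * exp (P z))" for z
  have E1: "E z1 > 1 + \<sigma>"
  proof -
    have "\<eta> / 2 * ln t1 + \<eta> * (t1 - 1) = - \<eta> * X" by (simp add: X_def algebra_simps)
    then have "exp (P z1) = exp (- \<eta> * X) / t1" using Pexp[OF z1(2)] unfolding t1_def[symmetric] by simp
    then have "E z1 = (V z1 * \<Theta> z1) * (exp (- \<eta> * X) / t1)" by (simp add: E_def)
    also have "\<dots> = (1 + 2 * \<sigma>) * exp (- \<eta> * X)" unfolding \<sigma>(2) using t1(1) by simp
    finally have "E z1 = (1 + 2 * \<sigma>) * exp (- \<eta> * X)" .
    moreover have "exp (- \<eta> * X) \<ge> 1 + (- \<eta> * X)" by (rule exp_ge_add_one_self)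
    ultimately have "E z1 \<ge> (1 + 2 * \<sigma>) * (1 + (- \<eta> * X))" using \<sigma> by (simp add: mult_left_mono)
    then show ?thesis using \<eta>X \<sigma> by (simp add: algebra_simps)
  qed
  \<comment> \<open>Outside the disc of radius \<open>R0\<close> the bound \<open>V * \<Theta> \<le> 1\<close> gives \<open>E \<le> 1 + \<sigma>\<close>.\<close>
  define R0 where "R0 = 1 / sqrt (1 + \<sigma>)"
  have R0: "0 < R0" "R0 < 1" "R0\<^sup>2 = 1 / (1 + \<sigma>)"
    using \<sigma> by (auto simp: R0_def power_divide)
  have outer: "E z \<le> 1 + \<sigma>" if z: "z \<in> ?D" "norm z \<ge> R0" for z
  proof -
    have z0: "z \<noteq> 0" using z R0 by auto
    have zz: "z \<bullet> z \<ge> R0\<^sup>2" "z \<bullet> z \<le> 1" "z \<bullet> z > 0"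
      using z z0 power_mono[OF z(2), of 2] R0(1)
      by (simp_all add: power2_norm_eq_inner[symmetric] power_le_one)
    have "exp (P z) \<le> exp (\<eta> / 2 * ln (z \<bullet> z)) / (z \<bullet> z)" by (rule Ple[OF z0 z(1)])
    also have "\<dots> \<le> 1 / (z \<bullet> z)" using \<eta> zz by (intro divide_right_mono) (auto simp: mult_nonneg_nonpos)
    also have "\<dots> \<le> 1 / R0\<^sup>2" using zz(1,3) R0(1) by (intro divide_left_mono mult_pos_pos zero_less_power) auto
    also have "\<dots> = 1 + \<sigma>" using R0 by simp
    finally have "exp (P z) \<le> 1 + \<sigma>" .
    moreover have "V z * \<Theta> z \<le> 1" using V[of z] \<Theta>[of z] z by (simp add: mult_le_one)
    ultimately have "(V z * \<Theta> z) * exp (P z) \<le> 1 * (1 + \<sigma>)"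
      using \<sigma> by (intro mult_mono) auto
    then show ?thesis by (simp add: E_def mult_ac)
  qed
  \<comment> \<open>Near \<open>0\<close> the quadratic growth of \<open>h\<close> cancels the pole, and the surplus power of \<open>\<bar>z\<bar>\<close> makes \<open>E\<close> small.\<close>
  define C' where "C' = exp 1 * \<bar>C\<bar> / r\<^sup>2"
  have C': "C' \<ge> 0" by (simp add: C'_def)
  define r1 where "r1 = min (min (r0 / 2) (1 / 2)) (sqrt (exp (- (2 / \<eta>) * ln (C' + 1))))"
  have r1: "0 < r1" "r1 < r0" "r1 < 1" "r1\<^sup>2 \<le> exp (- (2 / \<eta>) * ln (C' + 1))"
  proof -
    show "0 < r1" "r1 < r0" "r1 < 1" using origin(1) by (auto simp: r1_def)
    have "r1 \<le> sqrt (exp (- (2 / \<eta>) * ln (C' + 1)))" by (simp add: r1_def)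
    from power_mono[OF this, of 2] \<open>0 < r1\<close> show "r1\<^sup>2 \<le> exp (- (2 / \<eta>) * ln (C' + 1))" by simp
  qed
  have inner: "E z \<le> 1" if z: "z \<noteq> 0" "norm z \<le> r1" for z
  proof -
    have zD: "z \<in> ?D" and zO: "z \<in> O'" "h z \<le> C * (norm z)\<^sup>2" using z r1 origin(2)[of z] by auto
    have zz: "z \<bullet> z > 0" "z \<bullet> z \<le> exp (- (2 / \<eta>) * ln (C' + 1))"
    proof -
      have "z \<bullet> z \<le> r1\<^sup>2" unfolding power2_norm_eq_inner[symmetric] by (rule power_mono[OF z(2)]) simp
      then show "z \<bullet> z \<le> exp (- (2 / \<eta>) * ln (C' + 1))" using r1(4) by linarith
    qed (use z in simp)
    have "\<Theta> z \<le> exp 1 * (h z / r\<^sup>2)" using cutoff_exp_upper[OF \<tau>0[OF zO(1)] \<kappa>] zO by (simp add: \<Theta>_def \<kappa>_def)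
    also have "\<dots> \<le> C' * (z \<bullet> z)"
    proof -
      have "h z \<le> \<bar>C\<bar> * (z \<bullet> z)"
        using zO(2) unfolding power2_norm_eq_inner by (meson abs_ge_self inner_ge_zero mult_right_mono order_trans)
      then have "exp 1 * h z / r\<^sup>2 \<le> exp 1 * (\<bar>C\<bar> * (z \<bullet> z)) / r\<^sup>2" by (intro divide_right_mono mult_left_mono) auto
      then show ?thesis by (simp add: C'_def)
    qed
    finally have 1: "\<Theta> z \<le> C' * (z \<bullet> z)" .
    have "ln (z \<bullet> z) \<le> - (2 / \<eta>) * ln (C' + 1)"
      using zz by (metis ln_exp ln_le_cancel_iff exp_gt_zero)
    then have "\<eta> / 2 * ln (z \<bullet> z) \<le> \<eta> / 2 * (- (2 / \<eta>) * ln (C' + 1))" using \<eta> by (intro mult_left_mono) auto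
    also have "\<dots> = - ln (C' + 1)" using \<eta> by simp
    finally have "exp (\<eta> / 2 * ln (z \<bullet> z)) \<le> exp (- ln (C' + 1))" by simp
    also have "\<dots> = 1 / (C' + 1)" using C' by (simp add: exp_minus inverse_eq_divide)
    finally have "exp (P z) \<le> 1 / (C' + 1) / (z \<bullet> z)"
      using Ple[OF z(1) zD] zz(1) by (meson divide_right_mono less_imp_le order_trans)
    then have "\<Theta> z * exp (P z) \<le> (C' * (z \<bullet> z)) * (1 / (C' + 1) / (z \<bullet> z))"
      using 1 \<Theta> zz C' by (intro mult_mono) auto
    also have "\<dots> = C' / (C' + 1)" using zz(1) by simp
    also have "\<dots> \<le> 1" using C' by (simp add: divide_le_eq)
    finally have "\<Theta> z * exp (P z) \<le> 1" .
    then have "V z * (\<Theta> z * exp (P z)) \<le> 1 * 1" using V[of z] zD \<Theta>[of z] by (intro mult_mono) auto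
    then show ?thesis by (simp add: E_def)
  qed
  define K where "K = cball (0::complex) R0 - ball 0 r1"
  have KD: "K \<subseteq> ?D - {0}" using R0 r1 by (auto simp: K_def)
  have z1K: "z1 \<in> K"
    using outer[of z1] inner[of z1] E1 \<sigma> z1 by (auto simp: K_def not_le not_less) (smt (verit))+
  have Yc: "continuous_on (?D - {0}) (\<lambda>z. \<Theta> z * exp (P z))"
    unfolding P_def punctured_log_def
    by (intro continuous_intros continuous_on_subset[OF \<Theta>c]) auto
  have oD0: "open (?D - {0})" by (intro open_Diff) auto
  have usc_E: "\<exists>N. open N \<and> z \<in> N \<and> (\<forall>w\<in>N \<inter> K. E w < b)" if z: "z \<in> K" "E z < b" for z b
  proof -
    have zD: "z \<in> ?D" "z \<in> ?D - {0}" using z KD by auto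
    define Y where "Y w = \<Theta> w * exp (P w)" for w
    have Y0: "Y w \<ge> 0" for w using \<Theta>(1) by (simp add: Y_def)
    define e where "e = min 1 ((b - E z) / (V z + Y z + 2))"
    have den: "V z + Y z + 2 > 0" using V(1)[of z] Y0[of z] by linarith
    have e: "e > 0" using z den by (simp add: e_def)
    have ee: "e * (V z + Y z + 2) \<le> b - E z"
    proof -
      have "e \<le> (b - E z) / (V z + Y z + 2)" by (simp add: e_def)
      then show ?thesis using den by (simp add: pos_le_divide_eq)
    qed
    have "(V z + e) * (Y z + e) = E z + e * (V z + Y z + e)" by (simp add: E_def Y_def algebra_simps)
    also have "\<dots> < E z + e * (V z + Y z + 2)"
    proof -
      have "e \<le> 1" by (simp add: e_def)
      then have "e * (V z + Y z + e) < e * (V z + Y z + 2)" using e by (intro mult_strict_left_mono) auto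
      then show ?thesis by simp
    qed
    finally have lt: "(V z + e) * (Y z + e) < b" using ee by linarith
    define N1 where "N1 = {w \<in> ?D. v w < ereal (ln (V z + e) / \<alpha>)}"
    have Ve: "V z + e > 0" using V(1)[of z] e by linarith
    have N1: "open N1" "z \<in> N1" "\<And>w. w \<in> N1 \<Longrightarrow> V w < V z + e"
    proof -
      show "open N1" unfolding N1_def by (rule usc)
      have iff: "V w < V z + e \<longleftrightarrow> v w < ereal (ln (V z + e) / \<alpha>)" if "w \<in> ?D" for w
        unfolding V_def[of w] by (rule exp_ereal_less_iff[OF \<alpha> Ve neg[OF that]])
      show "z \<in> N1" using iff[OF zD(1)] zD e by (simp add: N1_def)
      show "V w < V z + e" if "w \<in> N1" for w using iff[of w] that by (simp add: N1_def)
    qed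
    define N2 where "N2 = (?D - {0}) \<inter> Y -` {..<Y z + e}"
    have N2: "open N2" "z \<in> N2"
      using continuous_open_preimage[OF Yc oD0 open_lessThan[of "Y z + e"]] zD e
      by (auto simp: N2_def Y_def[abs_def])
    have "E w < b" if "w \<in> N1 \<inter> N2" for w
    proof -
      have "V w * Y w \<le> (V z + e) * (Y z + e)"
        using that N1(3)[of w] V(1)[of w] Y0[of w] Ve by (intro mult_mono) (auto simp: N2_def)
      then show ?thesis using lt by (simp add: E_def Y_def)
    qed
    then show ?thesis using N1 N2 by (intro exI[of _ "N1 \<inter> N2"]) auto
  qed
  have "compact K" unfolding K_def by (intro compact_diff) auto
  then obtain z0 where z0K: "z0 \<in> K" and zmax: "\<And>w. w \<in> K \<Longrightarrow> E w \<le> E z0"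
    using usc_attains_max[of K E] z1K usc_E by blast
  have Ez0: "E z0 > 1 + \<sigma>" using zmax[OF z1K] E1 by linarith
  have zmax': "E w \<le> E z0" if "w \<in> ?D - {0}" for w
  proof (cases "w \<in> K")
    case False
    then have "norm w \<ge> R0 \<or> norm w \<le> r1" by (auto simp: K_def)
    then show ?thesis using outer[of w] inner[of w] that Ez0 \<sigma> by auto
  qed (use zmax in auto)
  have z0: "z0 \<in> ?D" "z0 \<noteq> 0" using z0K KD by auto
  have Vpos: "V z0 > 0" "\<Theta> z0 > 0"
    using Ez0 \<sigma> V(1)[of z0] \<Theta>(1)[of z0] unfolding E_def by (auto simp: less_le)
  then have "v z0 \<noteq> -\<infinity>" by (auto simp: V_def exp_ereal_def)
  then obtain v0 where v0: "v z0 = ereal v0" using neg[OF z0(1)] by (cases "v z0") auto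
  \<comment> \<open>At the maximum point, a minorant \<open>q\<close> of the logarithm of \<open>\<Theta>\<close> that is exact there yields a
    function of class \<open>C\<^sup>2\<close> touching \<open>v\<close> from above.\<close>
  have touch: "v w \<le> ereal (v0 - (q w + P w - q z0 - P z0) / \<alpha>)"
    if w: "w \<in> ?D - {0}" and q: "exp (q w) \<le> \<Theta> w" "\<Theta> z0 = exp (q z0)" for q w
  proof (cases "v w = -\<infinity>")
    case False
    then obtain vw where vw: "v w = ereal vw" using neg[of w] w by (cases "v w") auto
    have "exp (\<alpha> * vw + q w + P w) = V w * (exp (q w) * exp (P w))" by (simp add: V_def exp_ereal_def vw exp_add)
    also have "\<dots> \<le> E w" unfolding E_def using q V by (intro mult_left_mono mult_right_mono) auto
    also have "\<dots> \<le> E z0" by (rule zmax'[OF w])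
    also have "\<dots> = exp (\<alpha> * v0 + q z0 + P z0)" by (simp add: E_def V_def exp_ereal_def v0 exp_add q)
    finally have "\<alpha> * vw + q w + P w \<le> \<alpha> * v0 + q z0 + P z0" by simp
    then have "\<alpha> * (vw - v0) \<le> - (q w + P w - q z0 - P z0)" by (simp add: algebra_simps)
    then have "vw - v0 \<le> - (q w + P w - q z0 - P z0) / \<alpha>" using \<alpha> by (simp add: pos_le_divide_eq mult.commute)
    then have "vw \<le> v0 - (q w + P w - q z0 - P z0) / \<alpha>" unfolding minus_divide_left[symmetric] by linarith
    then show ?thesis using vw by simp
  qed simp
  obtain lP BP where PJ: "jet2 P z0 lP BP" "BP 1 1 + BP \<i> \<i> = 4 * \<eta>"
    using punctured_log_jet[OF z0(2)] unfolding P_def by metis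
  obtain d0 where d0: "d0 > 0" "ball z0 d0 \<subseteq> ?D - {0}" using oD0 z0 open_contains_ball by blast
  show False
  proof (cases "z0 \<in> O' \<and> h z0 \<le> r\<^sup>2")
    case False
    obtain d1 where d1: "d1 > 0" "ball z0 d1 \<subseteq> ?D - {z \<in> O'. h z \<le> r\<^sup>2}"
      using far False z0 open_contains_ball by blast
    obtain R where R: "R > 0" "\<And>\<rho>. 0 < \<rho> \<Longrightarrow> \<rho> < R \<Longrightarrow> v z0 \<le> circle_mean v z0 \<rho>" using sub[OF z0(1)] by blast
    have \<Theta>1: "\<Theta> w = 1" if "w \<in> ball z0 d1" for w using \<Theta>far that d1 by blast
    have J: "jet2 (\<lambda>w. (1/\<alpha>) * (P w + (- P z0))) z0 (\<lambda>a. (1/\<alpha>) * (lP a + 0)) (\<lambda>b a. (1/\<alpha>) * (BP b a + 0))"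
      by (intro jet2_linear[OF bounded_linear_mult_right] jet2_add PJ jet2_const)
    have "(1/\<alpha>) * (BP 1 1 + 0) + (1/\<alpha>) * (BP \<i> \<i> + 0) \<le> 0"
    proof (rule laplacian_nonpos_at_touching_point[OF J, of "Min {d0, d1, R}" v v0])
      fix w :: complex assume w: "norm w < Min {d0, d1, R}"
      then have w': "z0 + w \<in> ball z0 d0" "z0 + w \<in> ball z0 d1" by (auto simp: dist_norm)
      show "v (z0 + w) \<le> ereal (v0 - (1/\<alpha>) * (P (z0 + w) + (- P z0)))"
        using touch[of "z0 + w" "\<lambda>_. 0"] w' d0 \<Theta>1[OF w'(2)] \<Theta>1[of z0] d1(1) by (auto simp: subset_iff)
    qed (use d0 d1 R v0 in auto)
    then have "(1/\<alpha>) * (4 * \<eta>) \<le> 0" unfolding PJ(2)[symmetric] by (simp add: algebra_simps)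
    then show False using \<alpha> \<eta> by (simp add: divide_le_0_iff)
  next
    case True
    have hpos: "h z0 > 0"
      using Vpos(2) True O'(4)[of z0] by (auto simp: \<Theta>_def cutoff_exp_def less_le)
    obtain l lh Bh ln Bn where j: "l > 0" "jet2 h z0 lh Bh" "jet2 n z0 ln Bn"
        "c1 * l \<le> Bn 1 1 + Bn \<i> \<i>" "(4 - a * sqrt (h z0)) * l \<le> Bh 1 1 + Bh \<i> \<i>"
        "Bh 1 1 + Bh \<i> \<i> \<le> (4 + a * sqrt (h z0)) * l" "(lh 1)\<^sup>2 + (lh \<i>)\<^sup>2 \<le> (4 + a * sqrt (h z0)) * h z0 * l"
      using jets[of z0] True hpos by blast
    define s where "s = sqrt (h z0)"
    have s: "s > 0" "h z0 = s\<^sup>2" "s \<le> r"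
      using hpos True r by (auto simp: s_def real_le_lsqrt)
    have "\<exists>q lq Bq d. d > 0 \<and> (\<forall>w\<in>ball z0 d. exp (q w) \<le> \<Theta> w) \<and> \<Theta> z0 = exp (q z0) \<and> jet2 q z0 lq Bq \<and>
       Bq 1 1 + Bq \<i> \<i> \<ge> - ((3/2) * a\<^sup>2 + 2 * (2 + a) * (4 + a)) * l / r\<^sup>2"
    proof (cases "h z0 < r\<^sup>2")
      case lt: True
      have "open (O' \<inter> h -` {0<..<r\<^sup>2})" by (rule continuous_open_preimage[OF O'(3,1) open_greaterThanLessThan])
      moreover have "z0 \<in> O' \<inter> h -` {0<..<r\<^sup>2}" using True lt hpos by simp
      ultimately obtain d where d: "d > 0" "ball z0 d \<subseteq> O' \<inter> h -` {0<..<r\<^sup>2}" using open_contains_ball by blast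
      have \<Theta>q: "\<Theta> w = exp (cutoff_log (2 * a * r) (h w / r\<^sup>2))" if "w \<in> ball z0 d" for w
      proof -
        have "w \<in> O'" "0 < h w" "h w < r\<^sup>2" using d that by auto
        then show ?thesis using r cutoff_exp_eq[of "h w / r\<^sup>2" "2 * a * r"] by (simp add: \<Theta>_def)
      qed
      define F' where "F' t = 1 / t + a / sqrt t - (1 + a * r) / r\<^sup>2" for t
      define F'' where "F'' = - (1 / (h z0)\<^sup>2) - a / (2 * (h z0 * sqrt (h z0)))"
      have J: "jet2 (\<lambda>w. cutoff_log (2 * a * r) (h w / r\<^sup>2)) z0 (\<lambda>x. F' (h z0) * lh x) (\<lambda>b x. F' (h z0) * Bh b x + F'' * lh b * lh x)"
      proof (rule jet2_compose[OF j(2), of "{0<..}"])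
        show "((\<lambda>t. cutoff_log (2 * a * r) (t / r\<^sup>2)) has_real_derivative F' t) (at t)" if "t \<in> {0<..}" for t
          unfolding F'_def using cutoff_log_derivs(1)[OF r(1)] that by simp
        show "(F' has_real_derivative F'') (at (h z0))"
          unfolding F'_def[abs_def] F''_def by (rule cutoff_log_derivs(2)[OF r(1) hpos])
      qed (use hpos in auto)
      have "F' (h z0) * (Bh 1 1 + Bh \<i> \<i>) + F'' * ((lh 1)\<^sup>2 + (lh \<i>)\<^sup>2) \<ge> - ((3/2) * a\<^sup>2 + (1 + a) * (4 + a)) * l / r\<^sup>2"
        using log_laplacian_lower[OF a r s(1,3) j(1), of "Bh 1 1 + Bh \<i> \<i>" "(lh 1)\<^sup>2 + (lh \<i>)\<^sup>2"] j(5-7) s(1)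
        unfolding F'_def F''_def s_def[symmetric] s(2) by simp
      moreover have "((3/2) * a\<^sup>2 + (1 + a) * (4 + a)) * l / r\<^sup>2 \<le> ((3/2) * a\<^sup>2 + 2 * (2 + a) * (4 + a)) * l / r\<^sup>2"
        using a j(1) by (intro divide_right_mono mult_right_mono) (auto simp: algebra_simps)
      ultimately have "F' (h z0) * (Bh 1 1 + Bh \<i> \<i>) + F'' * ((lh 1)\<^sup>2 + (lh \<i>)\<^sup>2) \<ge>
          - ((3/2) * a\<^sup>2 + 2 * (2 + a) * (4 + a)) * l / r\<^sup>2"
        unfolding minus_mult_left[symmetric] minus_divide_left[symmetric] by linarith
      also have "F' (h z0) * (Bh 1 1 + Bh \<i> \<i>) + F'' * ((lh 1)\<^sup>2 + (lh \<i>)\<^sup>2) =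
          (F' (h z0) * Bh 1 1 + F'' * lh 1 * lh 1) + (F' (h z0) * Bh \<i> \<i> + F'' * lh \<i> * lh \<i>)"
        by (simp add: algebra_simps power2_eq_square)
      finally have "(F' (h z0) * Bh 1 1 + F'' * lh 1 * lh 1) + (F' (h z0) * Bh \<i> \<i> + F'' * lh \<i> * lh \<i>) \<ge>
          - ((3/2) * a\<^sup>2 + 2 * (2 + a) * (4 + a)) * l / r\<^sup>2" .
      then show ?thesis using J d(1) \<Theta>q
        by (intro exI[of _ "\<lambda>w. cutoff_log (2 * a * r) (h w / r\<^sup>2)"] exI[of _ "\<lambda>x. F' (h z0) * lh x"]
            exI[of _ "\<lambda>b x. F' (h z0) * Bh b x + F'' * lh b * lh x"] exI[of _ d] conjI ballI) (auto simp: d(1))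
    next
      case False
      then have eq: "h z0 = r\<^sup>2" using True by simp
      then have sr: "s = r" using s r by (simp add: power2_eq_iff)
      define \<mu> where "\<mu> = 2 + a * r"
      have \<mu>: "\<mu> > 0" "\<mu> \<le> 2 + a" using a r by (auto simp: \<mu>_def mult_left_le add_pos_pos)
      define q where "q w = - \<mu> * (h w / r\<^sup>2 - 1)\<^sup>2" for w
      have "open (O' \<inter> h -` {r\<^sup>2 / 2<..})" by (rule continuous_open_preimage[OF O'(3,1) open_greaterThan])
      moreover have "z0 \<in> O' \<inter> h -` {r\<^sup>2 / 2<..}" using True eq r by simp
      ultimately obtain d where d: "d > 0" "ball z0 d \<subseteq> O' \<inter> h -` {r\<^sup>2 / 2<..}" using open_contains_ball by blast
      have le: "exp (q w) \<le> \<Theta> w" if "w \<in> ball z0 d" for w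
      proof -
        have w: "w \<in> O'" "h w / r\<^sup>2 \<ge> 1 / 2" using d that r by (auto simp: field_simps)
        have ql: "q w \<le> 0" using \<mu> by (simp add: q_def)
        show ?thesis
        proof (cases "h w / r\<^sup>2 \<le> 1")
          case True
          have "q w \<le> cutoff_log (2 * a * r) (h w / r\<^sup>2)"
            using cutoff_log_lower_at_1[OF w(2), of "2 * a * r"] a r by (simp add: q_def \<mu>_def)
          then show ?thesis using cutoff_exp_eq[of "h w / r\<^sup>2" "2 * a * r"] w True by (simp add: \<Theta>_def)
        next
          case False
          then show ?thesis using cutoff_exp_eq_1[of "h w / r\<^sup>2"] w ql by (simp add: \<Theta>_def)
        qed
      qed
      have q0: "q z0 = 0" "\<Theta> z0 = 1" using eq r True by (auto simp: q_def \<Theta>_def cutoff_exp_eq_1)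
      have J: "jet2 q z0 (\<lambda>x. (- \<mu> * (2 * (h z0 / r\<^sup>2 - 1)) / r\<^sup>2) * lh x)
          (\<lambda>b x. (- \<mu> * (2 * (h z0 / r\<^sup>2 - 1)) / r\<^sup>2) * Bh b x + (- 2 * \<mu> / (r\<^sup>2)\<^sup>2) * lh b * lh x)"
        unfolding q_def
        by (rule jet2_compose[OF j(2), of UNIV "\<lambda>t. - \<mu> * (t / r\<^sup>2 - 1)\<^sup>2"])
          (use r in \<open>auto intro!: derivative_eq_intros simp: field_simps power2_eq_square\<close>)
      have 1: "- \<mu> * (2 * (h z0 / r\<^sup>2 - 1)) / r\<^sup>2 = 0" using eq r by simp
      have ar: "a * r \<le> a" using a r by (simp add: mult_left_le)
      have "2 * \<mu> / (r\<^sup>2)\<^sup>2 * ((lh 1)\<^sup>2 + (lh \<i>)\<^sup>2) \<le> 2 * \<mu> / (r\<^sup>2)\<^sup>2 * ((4 + a * r) * r\<^sup>2 * l)"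
        using j(7) \<mu> r(1) unfolding s_def[symmetric] eq sr by (intro mult_left_mono) auto
      also have "\<dots> = 2 * \<mu> * (4 + a * r) * l / r\<^sup>2" using r by (simp add: field_simps power2_eq_square)
      also have "\<dots> \<le> 2 * (2 + a) * (4 + a) * l / r\<^sup>2"
        using \<mu> ar a j(1) r by (intro divide_right_mono mult_right_mono mult_mono) auto
      also have "\<dots> \<le> ((3/2) * a\<^sup>2 + 2 * (2 + a) * (4 + a)) * l / r\<^sup>2"
        using a j(1) by (intro divide_right_mono mult_right_mono) auto
      finally have 2: "(- 2 * \<mu> / (r\<^sup>2)\<^sup>2) * ((lh 1)\<^sup>2 + (lh \<i>)\<^sup>2) \<ge> - ((3/2) * a\<^sup>2 + 2 * (2 + a) * (4 + a)) * l / r\<^sup>2"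
        unfolding minus_mult_left[symmetric] minus_divide_left[symmetric] by linarith
      have "(- 2 * \<mu> / (r\<^sup>2)\<^sup>2) * lh 1 * lh 1 + (- 2 * \<mu> / (r\<^sup>2)\<^sup>2) * lh \<i> * lh \<i> =
        (- 2 * \<mu> / (r\<^sup>2)\<^sup>2) * ((lh 1)\<^sup>2 + (lh \<i>)\<^sup>2)"
        by (simp only: power2_eq_square distrib_left mult.assoc)
      with 2 have 3: "(- 2 * \<mu> / (r\<^sup>2)\<^sup>2) * lh 1 * lh 1 + (- 2 * \<mu> / (r\<^sup>2)\<^sup>2) * lh \<i> * lh \<i> \<ge>
         - ((3/2) * a\<^sup>2 + 2 * (2 + a) * (4 + a)) * l / r\<^sup>2" by simp
      have J': "jet2 q z0 (\<lambda>x. 0) (\<lambda>b x. (- 2 * \<mu> / (r\<^sup>2)\<^sup>2) * lh b * lh x)"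
        using J unfolding 1 by simp
      have "\<forall>w\<in>ball z0 d. exp (q w) \<le> \<Theta> w" "\<Theta> z0 = exp (q z0)" using le q0 by auto
      then show ?thesis using d(1) J' 3
        by (intro exI[of _ q] exI[of _ "\<lambda>x. 0"] exI[of _ "\<lambda>b x. (- 2 * \<mu> / (r\<^sup>2)\<^sup>2) * lh b * lh x"] exI[of _ d] conjI)
    qed
    then obtain q lq Bq d where q: "d > 0" "\<And>w. w \<in> ball z0 d \<Longrightarrow> exp (q w) \<le> \<Theta> w" "\<Theta> z0 = exp (q z0)"
      "jet2 q z0 lq Bq" "Bq 1 1 + Bq \<i> \<i> \<ge> - ((3/2) * a\<^sup>2 + 2 * (2 + a) * (4 + a)) * l / r\<^sup>2" by blast
    obtain R where R: "R > 0" "\<And>\<rho>. 0 < \<rho> \<Longrightarrow> \<rho> < R \<Longrightarrow>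
        v z0 - ereal (\<epsilon> * n z0) \<le> circle_mean (\<lambda>w. v w - ereal (\<epsilon> * n w)) z0 \<rho>"
      using subn[of z0] True by blast
    define k where "k w = (1/\<alpha>) * ((q w + P w) + (- (q z0 + P z0))) + \<epsilon> * (n w + (- n z0))" for w
    have J: "jet2 k z0 (\<lambda>x. (1/\<alpha>) * ((lq x + lP x) + 0) + \<epsilon> * (ln x + 0)) (\<lambda>b x. (1/\<alpha>) * ((Bq b x + BP b x) + 0) + \<epsilon> * (Bn b x + 0))"
      unfolding k_def by (intro jet2_linear[OF bounded_linear_mult_right] jet2_add PJ(1) q(4) j(3) jet2_const)
    have "((1/\<alpha>) * ((Bq 1 1 + BP 1 1) + 0) + \<epsilon> * (Bn 1 1 + 0)) + ((1/\<alpha>) * ((Bq \<i> \<i> + BP \<i> \<i>) + 0) + \<epsilon> * (Bn \<i> \<i> + 0)) \<le> 0"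
    proof (rule laplacian_nonpos_at_touching_point[OF J, of "Min {d0, d, R}" "\<lambda>w. v w - ereal (\<epsilon> * n w)" "v0 - \<epsilon> * n z0"])
      fix w :: complex assume w: "norm w < Min {d0, d, R}"
      then have w': "z0 + w \<in> ball z0 d0" "z0 + w \<in> ball z0 d" by (auto simp: dist_norm)
      have "v (z0 + w) \<le> ereal (v0 - (q (z0 + w) + P (z0 + w) - q z0 - P z0) / \<alpha>)"
        using touch[of "z0 + w" q] w' d0 q(2)[OF w'(2)] q(3) by blast
      then have "v (z0 + w) - ereal (\<epsilon> * n (z0 + w)) \<le> ereal (v0 - (q (z0 + w) + P (z0 + w) - q z0 - P z0) / \<alpha>) - ereal (\<epsilon> * n (z0 + w))"
        by (rule ereal_minus_mono) simp
      also have "\<dots> = ereal (v0 - \<epsilon> * n z0 - k (z0 + w))" using \<alpha> by (simp add: k_def field_simps)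
      finally show "v (z0 + w) - ereal (\<epsilon> * n (z0 + w)) \<le> ereal (v0 - \<epsilon> * n z0 - k (z0 + w))" .
    qed (use d0 q(1) R v0 in \<open>auto simp: k_def\<close>)
    from mult_nonneg_nonpos[OF less_imp_le[OF \<alpha>] this]
    have "(Bq 1 1 + Bq \<i> \<i>) + (BP 1 1 + BP \<i> \<i>) + \<alpha> * \<epsilon> * (Bn 1 1 + Bn \<i> \<i>) \<le> 0"
      using \<alpha> by (simp add: distrib_left)
    moreover have "\<alpha> * \<epsilon> * (Bn 1 1 + Bn \<i> \<i>) \<ge> \<alpha> * \<epsilon> * (c1 * l)" using j(4) \<alpha> \<epsilon> by (intro mult_left_mono) auto
    moreover have "\<alpha> * \<epsilon> * (c1 * l) \<ge> ((3/2) * a\<^sup>2 + 2 * (2 + a) * (4 + a)) * l / r\<^sup>2"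
      using mult_right_mono[OF big, of l] j(1) by (simp add: mult_ac)
    ultimately have "4 * \<eta> \<le> 0"
      using q(5)[unfolded minus_mult_left[symmetric] minus_divide_left[symmetric]] PJ(2) by linarith
    then show False using \<eta> by simp
  qed
qed

section \<open>Conformal harmonic discs in a chart\<close>

definition laplacian_error :: "real \<Rightarrow> real \<Rightarrow> real \<Rightarrow> real \<Rightarrow> real" where
  "laplacian_error m M L \<Gamma> = (4 * L / m + 4 * M * \<Gamma> / m) / sqrt m +
     4 * (L + (2 * M * L + 4 * L\<^sup>2) * (2 / m)) / (m * sqrt m)"

lemma laplacian_error_pos: "m > 0 \<Longrightarrow> M > 0 \<Longrightarrow> L > 0 \<Longrightarrow> \<Gamma> \<ge> 0 \<Longrightarrow> laplacian_error m M L \<Gamma> > 0"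
  unfolding laplacian_error_def
  by (intro add_nonneg_pos divide_pos_pos divide_nonneg_pos mult_pos_pos add_pos_nonneg add_nonneg_nonneg mult_nonneg_nonneg) auto

text \<open>Here \<open>p\<close>, \<open>q\<close> and \<open>W\<close> are the partial derivatives and the Laplacian of \<open>y\<close>, and \<open>V = y - y 0\<close>; then \<open>\<Delta>\<close>
and \<open>N\<close> are the Laplacian and the squared gradient of \<open>h\<close>. If \<open>G1 = G0\<close> and \<open>W = 0\<close>, they are \<open>4 l\<close> and at
most \<open>4 h l\<close>, the latter by Bessel's inequality. The differences are linear in the norm of \<open>V\<close>, which is
comparable to \<open>sqrt h\<close>.\<close>

lemma conformal_laplacian_estimates:
  fixes G0 G1 :: "real^'n^'n" and V p q W :: "real^'n"
  assumes pos: "m > 0" "M > 0" "L > 0" "\<Gamma> \<ge> 0" "l > 0"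
    and sym: "\<And>a b. a \<bullet> (G1 *v b) = b \<bullet> (G1 *v a)"
    and low: "\<And>a. m * (norm a)\<^sup>2 \<le> a \<bullet> (G0 *v a)" "\<And>a. m * (norm a)\<^sup>2 \<le> a \<bullet> (G1 *v a)"
    and up: "\<And>a b. \<bar>a \<bullet> (G0 *v b)\<bar> \<le> M * norm a * norm b" "\<And>a b. \<bar>a \<bullet> (G1 *v b)\<bar> \<le> M * norm a * norm b"
    and dif: "\<And>a b. \<bar>a \<bullet> ((G1 - G0) *v b)\<bar> \<le> L * norm V * norm a * norm b"
    and conf: "p \<bullet> (G1 *v p) = l" "q \<bullet> (G1 *v q) = l" "p \<bullet> (G1 *v q) = 0"
    and W: "norm W \<le> \<Gamma> * ((norm p)\<^sup>2 + (norm q)\<^sup>2)" and V4: "norm V \<le> 4"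
  defines "h \<equiv> V \<bullet> (G0 *v V)" and "a \<equiv> laplacian_error m M L \<Gamma>"
    and "\<Delta> \<equiv> 2 * (V \<bullet> (G0 *v W)) + 2 * (p \<bullet> (G0 *v p) + q \<bullet> (G0 *v q))"
    and "N \<equiv> (2 * (V \<bullet> (G0 *v p)))\<^sup>2 + (2 * (V \<bullet> (G0 *v q)))\<^sup>2"
  shows "(4 - a * sqrt h) * l \<le> \<Delta>" "\<Delta> \<le> (4 + a * sqrt h) * l" "N \<le> (4 + a * sqrt h) * h * l"
proof -
  define n where "n = norm V"
  have n: "0 \<le> n" "n \<le> 4" using V4 by (auto simp: n_def)
  have h1: "m * n\<^sup>2 \<le> h" using low(1)[of V] unfolding h_def n_def .
  have "0 \<le> m * n\<^sup>2" using pos(1) by simp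
  then have h: "m * n\<^sup>2 \<le> h" "h \<ge> 0" using h1 by linarith+
  have sm: "sqrt m > 0" using pos by simp
  have nh: "n \<le> sqrt h / sqrt m"
  proof -
    have "sqrt (m * n\<^sup>2) \<le> sqrt h" using h(1) by simp
    then have "sqrt m * n \<le> sqrt h" using n by (simp add: real_sqrt_mult)
    then show ?thesis using sm by (simp add: pos_le_divide_eq mult.commute)
  qed
  have n3: "n * n\<^sup>2 \<le> h * sqrt h / (m * sqrt m)"
  proof -
    have "n\<^sup>2 \<le> h / m" using h(1) pos(1) by (simp add: pos_le_divide_eq mult.commute)
    then have "n * n\<^sup>2 \<le> sqrt h / sqrt m * (h / m)" using nh n h by (intro mult_mono) auto
    then show ?thesis by (simp add: mult_ac)
  qed
  have pl: "(norm p)\<^sup>2 \<le> l / m" "(norm q)\<^sup>2 \<le> l / m"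
    using low(2)[of p] low(2)[of q] conf pos(1) by (auto simp: pos_le_divide_eq mult.commute)
  have G0: "x \<bullet> (G0 *v b) = x \<bullet> (G1 *v b) - x \<bullet> ((G1 - G0) *v b)" for x b
    by (simp add: matrix_vector_mult_diff_rdistrib inner_diff_right)
  have f1: "\<bar>p \<bullet> ((G1 - G0) *v p)\<bar> \<le> L * n * (l / m)" "\<bar>q \<bullet> ((G1 - G0) *v q)\<bar> \<le> L * n * (l / m)"
  proof -
    have "L * n * (norm p)\<^sup>2 \<le> L * n * (l / m)" "L * n * (norm q)\<^sup>2 \<le> L * n * (l / m)"
      using pl pos n by (intro mult_left_mono; simp)+
    then show "\<bar>p \<bullet> ((G1 - G0) *v p)\<bar> \<le> L * n * (l / m)" "\<bar>q \<bullet> ((G1 - G0) *v q)\<bar> \<le> L * n * (l / m)"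
      using dif[of p p] dif[of q q] by (simp_all add: n_def power2_eq_square mult.assoc)
  qed
  have f2: "\<bar>V \<bullet> (G0 *v W)\<bar> \<le> M * n * (\<Gamma> * (2 * (l / m)))"
  proof -
    have "\<Gamma> * ((norm p)\<^sup>2 + (norm q)\<^sup>2) \<le> \<Gamma> * (2 * (l / m))" using pl pos by (intro mult_left_mono) auto
    then have "norm W \<le> \<Gamma> * (2 * (l / m))" using W by linarith
    then have "M * n * norm W \<le> M * n * (\<Gamma> * (2 * (l / m)))" using pos n by (intro mult_left_mono) auto
    then show ?thesis using up(1)[of V W] by (simp add: n_def)
  qed
  have "\<bar>\<Delta> - 4 * l\<bar> \<le> 2 * (M * n * (\<Gamma> * (2 * (l / m)))) + 4 * (L * n * (l / m))"
  proof -
    have lin: "\<bar>2 * x + 2 * (l - y1 + (l - y2)) - 4 * l\<bar> \<le> 2 * X + 4 * Y"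
      if "\<bar>y1\<bar> \<le> Y" "\<bar>y2\<bar> \<le> Y" "\<bar>x\<bar> \<le> X" for x y1 y2 X Y :: real
      using abs_le_D1[OF that(1)] abs_le_D2[OF that(1)] abs_le_D1[OF that(2)] abs_le_D2[OF that(2)]
        abs_le_D1[OF that(3)] abs_le_D2[OF that(3)]
      by (intro abs_leI) (simp_all add: algebra_simps)
    show ?thesis unfolding \<Delta>_def G0[of p p] G0[of q q] conf(1,2) by (rule lin[OF f1 f2])
  qed
  also have "\<dots> = (4 * L / m + 4 * M * \<Gamma> / m) * n * l" by (simp add: algebra_simps)
  also have "\<dots> \<le> (4 * L / m + 4 * M * \<Gamma> / m) * (sqrt h / sqrt m) * l"
    using nh pos by (intro mult_right_mono mult_left_mono) auto
  also have "\<dots> \<le> a * sqrt h * l"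
  proof -
    have "(4 * L / m + 4 * M * \<Gamma> / m) / sqrt m \<le> a"
      unfolding a_def laplacian_error_def using pos by simp
    then have "(4 * L / m + 4 * M * \<Gamma> / m) / sqrt m * (sqrt h * l) \<le> a * (sqrt h * l)"
      using h pos by (intro mult_right_mono) auto
    then show ?thesis by (simp add: mult_ac)
  qed
  finally have "\<bar>\<Delta> - 4 * l\<bar> \<le> a * sqrt h * l" .
  then show "(4 - a * sqrt h) * l \<le> \<Delta>" "\<Delta> \<le> (4 + a * sqrt h) * l"
    by (auto simp: algebra_simps abs_le_iff)
  have bessel: "(V \<bullet> (G1 *v p))\<^sup>2 + (V \<bullet> (G1 *v q))\<^sup>2 \<le> l * (V \<bullet> (G1 *v V))"
  proof -
    define x y where "x = V \<bullet> (G1 *v p)" and "y = V \<bullet> (G1 *v q)"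
    let ?Z = "V - (x / l) *\<^sub>R p - (y / l) *\<^sub>R q"
    have s: "p \<bullet> (G1 *v V) = x" "q \<bullet> (G1 *v V) = y" "q \<bullet> (G1 *v p) = 0"
      unfolding x_def y_def using sym conf(3) by metis+
    have "0 \<le> m * (norm ?Z)\<^sup>2" using pos by simp
    also have "\<dots> \<le> ?Z \<bullet> (G1 *v ?Z)" by (rule low(2))
    also have "\<dots> = V \<bullet> (G1 *v V) - (x\<^sup>2 + y\<^sup>2) / l"
      unfolding matrix_vector_mult_diff_distrib matrix_vector_mult_scaleR inner_diff_left inner_diff_right
        inner_scaleR_left inner_scaleR_right x_def[symmetric] y_def[symmetric] s conf
      using pos(5) by (simp add: field_simps power2_eq_square)
    finally show ?thesis using pos(5) unfolding x_def[symmetric] y_def[symmetric] by (simp add: field_simps)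
  qed
  have G1V: "V \<bullet> (G1 *v V) \<le> h + L * (n * n\<^sup>2)"
    using dif[of V V] G0[of V V] unfolding h_def n_def by (simp add: power2_eq_square mult.assoc abs_le_iff)
  have sq: "(V \<bullet> (G0 *v b))\<^sup>2 \<le> (V \<bullet> (G1 *v b))\<^sup>2 + (2 * M * L + 4 * L\<^sup>2) * (n * n\<^sup>2) * (l / m)"
    if b: "(norm b)\<^sup>2 \<le> l / m" for b
  proof -
    define x \<delta> where "x = V \<bullet> (G1 *v b)" and "\<delta> = V \<bullet> ((G1 - G0) *v b)"
    have x: "\<bar>x\<bar> \<le> M * n * norm b" using up(2)[of V b] by (simp add: x_def n_def)
    have d: "\<bar>\<delta>\<bar> \<le> L * n * n * norm b" using dif[of V b] by (simp add: \<delta>_def n_def)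
    have 1: "\<bar>x\<bar> * \<bar>\<delta>\<bar> \<le> (M * n * norm b) * (L * n * n * norm b)" using x d pos n by (intro mult_mono) auto
    have 2: "\<bar>\<delta>\<bar> * \<bar>\<delta>\<bar> \<le> (L * n * n * norm b) * (L * n * n * norm b)" using d pos n by (intro mult_mono) auto
    have 3: "n * (L\<^sup>2 * (n * n\<^sup>2) * (norm b)\<^sup>2) \<le> 4 * (L\<^sup>2 * (n * n\<^sup>2) * (norm b)\<^sup>2)"
      using n by (intro mult_right_mono) auto
    have "(x - \<delta>)\<^sup>2 \<le> x\<^sup>2 + 2 * (\<bar>x\<bar> * \<bar>\<delta>\<bar>) + \<bar>\<delta>\<bar> * \<bar>\<delta>\<bar>"
    proof -
      have "(x - \<delta>)\<^sup>2 = x\<^sup>2 - 2 * (x * \<delta>) + \<bar>\<delta>\<bar> * \<bar>\<delta>\<bar>" by (simp add: power2_eq_square algebra_simps)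
      moreover have "- (x * \<delta>) \<le> \<bar>x\<bar> * \<bar>\<delta>\<bar>" by (metis abs_ge_minus_self abs_mult)
      ultimately show ?thesis by linarith
    qed
    also have "\<dots> \<le> x\<^sup>2 + 2 * ((M * n * norm b) * (L * n * n * norm b)) + (L * n * n * norm b) * (L * n * n * norm b)"
      using 1 2 by linarith
    also have "\<dots> = x\<^sup>2 + 2 * M * L * (n * n\<^sup>2) * (norm b)\<^sup>2 + n * (L\<^sup>2 * (n * n\<^sup>2) * (norm b)\<^sup>2)"
      by (simp add: power2_eq_square mult_ac)
    also have "\<dots> \<le> x\<^sup>2 + (2 * M * L + 4 * L\<^sup>2) * (n * n\<^sup>2) * (norm b)\<^sup>2"
      using 3 by (simp add: algebra_simps)
    also have "\<dots> \<le> x\<^sup>2 + (2 * M * L + 4 * L\<^sup>2) * (n * n\<^sup>2) * (l / m)"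
      using b pos n by (intro add_left_mono mult_left_mono) auto
    finally show ?thesis unfolding G0[of V b] x_def \<delta>_def .
  qed
  define E where "E = L + (2 * M * L + 4 * L\<^sup>2) * (2 / m)"
  have E: "E \<ge> 0" using pos by (simp add: E_def)
  have "N = 4 * ((V \<bullet> (G0 *v p))\<^sup>2 + (V \<bullet> (G0 *v q))\<^sup>2)" by (simp add: N_def power_mult_distrib)
  also have "\<dots> \<le> 4 * (l * (V \<bullet> (G1 *v V)) + 2 * ((2 * M * L + 4 * L\<^sup>2) * (n * n\<^sup>2) * (l / m)))"
  proof -
    have "(V \<bullet> (G0 *v p))\<^sup>2 + (V \<bullet> (G0 *v q))\<^sup>2 \<le> l * (V \<bullet> (G1 *v V)) + 2 * ((2 * M * L + 4 * L\<^sup>2) * (n * n\<^sup>2) * (l / m))"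
      using add_mono[OF sq[OF pl(1)] sq[OF pl(2)]] bessel by (simp add: algebra_simps)
    then show ?thesis by simp
  qed
  also have "\<dots> \<le> 4 * (l * (h + L * (n * n\<^sup>2)) + 2 * ((2 * M * L + 4 * L\<^sup>2) * (n * n\<^sup>2) * (l / m)))"
    using mult_left_mono[OF G1V, of l] pos(5) by simp
  also have "\<dots> = 4 * (h * l) + 4 * E * l * (n * n\<^sup>2)" by (simp add: E_def algebra_simps)
  also have "\<dots> \<le> 4 * (h * l) + 4 * E * l * (h * sqrt h / (m * sqrt m))"
    using n3 E pos by (intro add_left_mono mult_left_mono) auto
  also have "\<dots> = 4 * (h * l) + (4 * E / (m * sqrt m)) * (h * sqrt h * l)" by (simp add: mult_ac)
  also have "\<dots> \<le> 4 * (h * l) + a * (h * sqrt h * l)"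
  proof -
    have "4 * E / (m * sqrt m) \<le> a" unfolding a_def laplacian_error_def E_def using pos by simp
    then show ?thesis using h pos by (intro add_left_mono mult_right_mono) auto
  qed
  also have "\<dots> = (4 + a * sqrt h) * h * l" by (simp add: algebra_simps)
  finally show "N \<le> (4 + a * sqrt h) * h * l" .
qed

lemma smooth_on_jet2:
  fixes y :: "complex \<Rightarrow> 'b::euclidean_space"
  assumes y: "smooth_on y S" and S: "open S" "z \<in> S"
  shows "jet2 y z (\<lambda>a. frechet_derivative y (at z) a)
    (\<lambda>b a. frechet_derivative (\<lambda>w. frechet_derivative y (at w) a) (at z) b)"
  unfolding jet2_def
proof (intro exI[of _ "\<lambda>w a. frechet_derivative y (at w) a"] conjI allI)
  have "\<forall>\<^sub>F w in nhds z. w \<in> S" using S by (rule eventually_nhds_in_open)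
  then show "\<forall>\<^sub>F w in nhds z. (y has_derivative (\<lambda>a. frechet_derivative y (at w) a)) (at w)"
    by eventually_elim (use smooth_on_imp_has_derivative[OF y] in simp)
  show "((\<lambda>w. frechet_derivative y (at w) a) has_derivative
      (\<lambda>b. frechet_derivative (\<lambda>w. frechet_derivative y (at w) a) (at z) b)) (at z)" for a
    using smooth_on_imp_has_derivative[OF smooth_on_derivative[OF y] S(2), of a] by simp
qed simp

lemma jet2_quadratic_form:
  fixes y :: "complex \<Rightarrow> real^'n"
  assumes "jet2 y z l B"
  shows "jet2 (\<lambda>w. (y w - y0) \<bullet> (H *v (y w - y0))) z
    (\<lambda>a. (y z - y0) \<bullet> (H *v l a) + l a \<bullet> (H *v (y z - y0)))
    (\<lambda>b a. (y z - y0) \<bullet> (H *v B b a) + l b \<bullet> (H *v l a) + (l a \<bullet> (H *v l b) + B b a \<bullet> (H *v (y z - y0))))"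
proof -
  have "jet2 (\<lambda>w. y w + (- y0)) z (\<lambda>a. l a + 0) (\<lambda>b a. B b a + 0)"
    by (rule jet2_add[OF assms jet2_const])
  then have d: "jet2 (\<lambda>w. y w - y0) z l B" by simp
  have "bounded_linear (\<lambda>v. H *v v)" by (rule matrix_vector_mul_bounded_linear)
  from jet2_bilinear[OF bounded_bilinear_inner d jet2_linear[OF this d]] show ?thesis .
qed

context riemannian begin

definition chart_bounds :: "('m, 'n) chart \<Rightarrow> (real^'n) set \<Rightarrow> real \<Rightarrow> real \<Rightarrow> real \<Rightarrow> bool" where
  "chart_bounds c K m M L \<longleftrightarrow> m > 0 \<and> M > 0 \<and> L > 0 \<and>
    (\<forall>y\<in>K. \<forall>a. m * (norm a)\<^sup>2 \<le> a \<bullet> (G c y *v a)) \<and>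
    (\<forall>y\<in>K. \<forall>a b. \<bar>a \<bullet> (G c y *v b)\<bar> \<le> M * norm a * norm b) \<and>
    (\<forall>y\<in>K. \<forall>x a b. \<bar>a \<bullet> (frechet_derivative (G c) (at y) x *v b)\<bar> \<le> L * norm x * norm a * norm b) \<and>
    (\<forall>y\<in>K. \<forall>z\<in>K. \<forall>a b. \<bar>a \<bullet> ((G c y - G c z) *v b)\<bar> \<le> L * norm (y - z) * norm a * norm b)"

lemma chart_bounds_exist:
  assumes c: "c \<in> A" and K: "compact K" "convex K" "K \<subseteq> snd c ` fst c"
  shows "\<exists>m M L. chart_bounds c K m M L"
proof -
  have Gs: "smooth_on (G c) (snd c ` fst c)" by (rule G_smooth[OF c])
  have Gc: "continuous_on K (G c)" by (rule continuous_on_subset[OF smooth_on_imp_continuous_on[OF Gs] K(3)])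
  obtain C where C: "C > 0" "\<And>(H::real^'n^'n) b. norm (H *v b) \<le> C * norm H * norm b"
    using matrix_vector_mult_bound by metis
  have ip: "\<bar>a \<bullet> (H *v b)\<bar> \<le> C * norm H * norm a * norm b" for a b and H :: "real^'n^'n"
  proof -
    have "\<bar>a \<bullet> (H *v b)\<bar> \<le> norm a * norm (H *v b)" by (rule Cauchy_Schwarz_ineq2)
    also have "\<dots> \<le> norm a * (C * norm H * norm b)" by (intro mult_left_mono C(2)) simp
    finally show ?thesis by (simp add: mult_ac)
  qed
  obtain m where m: "m > 0" "\<And>y a. y \<in> K \<Longrightarrow> a \<bullet> (G c y *v a) \<ge> m * (norm a)\<^sup>2"
    using pos_def_uniform_on_compact[OF Gc K(1)] G_pos[OF c] K(3) by (metis subsetD)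
  have "bounded (G c ` K)" by (intro compact_imp_bounded compact_continuous_image Gc K(1))
  then obtain M where M: "M > 0" "\<And>y. y \<in> K \<Longrightarrow> norm (G c y) \<le> M" unfolding bounded_pos by auto
  obtain L1 where L1: "L1 > 0" "\<And>y v. y \<in> K \<Longrightarrow> norm (frechet_derivative (G c) (at y) v) \<le> L1 * norm v"
    using smooth_on_derivative_bound[OF Gs K(1,3)] by metis
  obtain L2 where L2: "L2 > 0" "\<And>y z. y \<in> K \<Longrightarrow> z \<in> K \<Longrightarrow> norm (G c y - G c z) \<le> L2 * norm (y - z)"
    using smooth_on_lipschitz[OF Gs K(1,3,2)] by metis
  have mono: "\<bar>a \<bullet> (H *v b)\<bar> \<le> C * X * norm a * norm b" if "norm H \<le> X" for a b X and H :: "real^'n^'n"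
  proof -
    have "C * norm H * norm a * norm b \<le> C * X * norm a * norm b"
      using that C(1) by (intro mult_right_mono mult_left_mono) auto
    then show ?thesis using ip[of a H b] by linarith
  qed
  have "chart_bounds c K m (C * M) (C * (L1 + L2))"
    unfolding chart_bounds_def
  proof (intro conjI ballI allI)
    show "m > 0" "C * M > 0" "C * (L1 + L2) > 0" using m C M L1 L2 by auto
    show "m * (norm a)\<^sup>2 \<le> a \<bullet> (G c y *v a)" if "y \<in> K" for y a using m(2)[OF that] .
    show "\<bar>a \<bullet> (G c y *v b)\<bar> \<le> C * M * norm a * norm b" if "y \<in> K" for y a b
      by (rule mono[OF M(2)[OF that]])
    show "\<bar>a \<bullet> (frechet_derivative (G c) (at y) x *v b)\<bar> \<le> C * (L1 + L2) * norm x * norm a * norm b" if "y \<in> K" for y x a b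
    proof -
      have "norm (frechet_derivative (G c) (at y) x) \<le> (L1 + L2) * norm x"
        using L1(2)[OF that, of x] L2(1) by (simp add: distrib_right add_increasing2)
      from mono[OF this] show ?thesis by (simp add: mult.assoc)
    qed
    show "\<bar>a \<bullet> ((G c y - G c z) *v b)\<bar> \<le> C * (L1 + L2) * norm (y - z) * norm a * norm b" if "y \<in> K" "z \<in> K" for y z a b
    proof -
      have "norm (G c y - G c z) \<le> (L1 + L2) * norm (y - z)"
        using L2(2)[OF that] L1(1) by (simp add: distrib_right add_increasing)
      from mono[OF this] show ?thesis by (simp add: mult.assoc)
    qed
  qed
  then show ?thesis by blast
qed

text \<open>The harmonic map equation tested with the Laplacian of the disc itself bounds that Laplacian by the
square of the gradient.\<close>

lemma CHI_disc_jet: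
  assumes u: "CHI_disc T A g D u" and c: "(V, \<phi>) \<in> A" and z: "z \<in> unit_disc" "u z \<in> V"
    and bd: "chart_bounds (V, \<phi>) K m M L" and K: "\<phi> (u z) \<in> K"
  obtains l B where "l > 0" "jet2 (\<phi> \<circ> u) z (\<lambda>a. frechet_derivative (\<phi> \<circ> u) (at z) a) B"
    "\<And>a b. frechet_derivative (\<phi> \<circ> u) (at z) a \<bullet> (G (V, \<phi>) (\<phi> (u z)) *v frechet_derivative (\<phi> \<circ> u) (at z) b) = l * (a \<bullet> b)"
    "norm (B 1 1 + B \<i> \<i>) \<le> 3 * L / (2 * m) *
       ((norm (frechet_derivative (\<phi> \<circ> u) (at z) 1))\<^sup>2 + (norm (frechet_derivative (\<phi> \<circ> u) (at z) \<i>))\<^sup>2)"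
proof -
  let ?G = "G (V, \<phi>)"
  define y where "y = \<phi> \<circ> u"
  define Y where "Y a w = frechet_derivative y (at w) a" for a w
  define B where "B b a = frechet_derivative (\<lambda>w. frechet_derivative y (at w) a) (at z) b" for b a
  have harm: "harmonic_disc T A g u" using u by (simp add: CHI_disc_def)
  then have us: "smooth_map_on T A unit_disc u" by (simp add: harmonic_disc_def)
  define O' where "O' = {z \<in> unit_disc. u z \<in> V}"
  have oO: "open O'" unfolding O'_def by (rule smooth_map_domain_open[OF us open_ball c])
  have ysm: "smooth_on y O'" unfolding y_def O'_def by (rule smooth_map_coord[OF us c])
  have "conformal_disc A g u" using u by (simp add: CHI_disc_def)
  then obtain f where ff: "smooth_on f unit_disc \<and>
        (\<forall>z\<in>unit_disc. \<forall>a c. g (u z) (differential A u z a) (differential A u z c) = exp (f z) * (a \<bullet> c))"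
    unfolding conformal_disc_def ..
  have conf: "Y a z \<bullet> (?G (y z) *v Y b z) = exp (f z) * (a \<bullet> b)" for a b
  proof -
    have "g (u z) (differential A u z a) (differential A u z b) = exp (f z) * (a \<bullet> b)"
      using conjunct2[OF ff] z(1) by blast
    then show ?thesis using metric_differential[OF us open_ball z(1) c z(2), of a b] by (simp add: Y_def y_def)
  qed
  have J: "jet2 y z (\<lambda>a. Y a z) B"
    using smooth_on_jet2[OF ysm oO, of z] z unfolding Y_def B_def[abs_def] O'_def by simp
  define W where "W = B 1 1 + B \<i> \<i>"
  let ?DG = "\<lambda>v. frechet_derivative ?G (at (y z)) v"
  have yK: "y z \<in> K" using K by (simp add: y_def)
  have el: "2 * (W \<bullet> (?G (y z) *v W)) = (\<Sum>a\<in>{1, \<i>}. Y a z \<bullet> (?DG W *v Y a z) - 2 * (W \<bullet> (?DG (Y a z) *v Y a z)))"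
    using harmonic_map_equation[OF harm c z, of W] unfolding W_def B_def Y_def y_def by (simp add: comp_def)
  have m: "m > 0" "L > 0" "m * (norm W)\<^sup>2 \<le> W \<bullet> (?G (y z) *v W)"
    "\<And>x a b. \<bar>a \<bullet> (?DG x *v b)\<bar> \<le> L * norm x * norm a * norm b"
    using bd yK unfolding chart_bounds_def by blast+
  define S where "S = (norm (Y 1 z))\<^sup>2 + (norm (Y \<i> z))\<^sup>2"
  have tm: "\<bar>Y a z \<bullet> (?DG W *v Y a z) - 2 * (W \<bullet> (?DG (Y a z) *v Y a z))\<bar> \<le> 3 * L * norm W * (norm (Y a z))\<^sup>2" for a
    using m(4)[of "Y a z" W "Y a z"] m(4)[of W "Y a z" "Y a z"] by (simp add: power2_eq_square algebra_simps abs_le_iff)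
  have "2 * (m * (norm W)\<^sup>2) \<le> 3 * L * norm W * S"
  proof -
    have "2 * (m * (norm W)\<^sup>2) \<le> 2 * (W \<bullet> (?G (y z) *v W))" using m(3) by simp
    also have "\<dots> \<le> 3 * L * norm W * (norm (Y 1 z))\<^sup>2 + 3 * L * norm W * (norm (Y \<i> z))\<^sup>2"
    proof -
      have "(1::complex) \<noteq> \<i>" using complex_i_not_one by metis
      then have two: "(\<Sum>a\<in>{1, \<i>}. F a) = F 1 + F \<i>" for F :: "complex \<Rightarrow> real" by simp
      show ?thesis unfolding el two by (rule add_mono[OF abs_le_D1[OF tm] abs_le_D1[OF tm]])
    qed
    finally show ?thesis by (simp add: S_def algebra_simps)
  qed
  then have "2 * m * norm W \<le> 3 * L * S"
    by (cases "W = 0") (use m(2) in \<open>auto simp: power2_eq_square S_def\<close>)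
  then have Wb: "norm W \<le> 3 * L / (2 * m) * S" using m(1) by (simp add: field_simps)
  show ?thesis
    using that[of "exp (f z)" B] J conf Wb unfolding Y_def y_def W_def S_def by simp
qed

end

section \<open>The derivative estimate\<close>

context riemannian begin

text \<open>The disc \<open>f\<close> need not stay in \<open>E\<close>; a rescaled disc around \<open>z\<close> does, and its circles are circles
around \<open>z\<close>.\<close>

lemma MPSH_submean_along_disc:
  assumes f: "CHI_disc T A g D f" and E: "openin T E"
    and mp: "MPSH T A g E \<psi>" and z: "z \<in> unit_disc" "f z \<in> E"
  shows "\<exists>R>0. \<forall>\<rho>. 0 < \<rho> \<and> \<rho> < R \<longrightarrow>
    (\<forall>w\<in>cball z \<rho>. w \<in> unit_disc \<and> f w \<in> E) \<and> \<psi> (f z) \<le> circle_mean (\<lambda>w. \<psi> (f w)) z \<rho>"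
proof -
  have "smooth_map_on T A unit_disc f" using f by (simp add: CHI_disc_def harmonic_disc_def)
  then have fc: "continuous_map (top_of_set unit_disc) T f" by (simp add: smooth_map_on_def)
  have "open {w \<in> unit_disc. f w \<in> E}" by (rule open_topology_preimage[OF fc open_ball E])
  then obtain b where b: "b > 0" "ball z b \<subseteq> {w \<in> unit_disc. f w \<in> E}"
    using z open_contains_ball by blast
  have "CHI_disc T A g E (\<lambda>\<zeta>. f (z + b *\<^sub>R \<zeta>))"
    by (rule CHI_disc_rescale[OF f b(1)]) (use b(2) in auto)
  then have sub: "subharmonic_on unit_disc (\<psi> \<circ> (\<lambda>\<zeta>. f (z + b *\<^sub>R \<zeta>)))" using mp by (simp add: MPSH_def)
  have "(\<forall>w\<in>cball z \<rho>. w \<in> unit_disc \<and> f w \<in> E) \<and> \<psi> (f z) \<le> circle_mean (\<lambda>w. \<psi> (f w)) z \<rho>"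
    if \<rho>: "0 < \<rho>" "\<rho> < b" for \<rho>
  proof
    show "\<forall>w\<in>cball z \<rho>. w \<in> unit_disc \<and> f w \<in> E"
    proof
      fix w assume "w \<in> cball z \<rho>"
      then have "w \<in> ball z b" using \<rho> by simp
      then show "w \<in> unit_disc \<and> f w \<in> E" using b(2) by blast
    qed
    have "cball 0 (\<rho> / b) \<subseteq> unit_disc" using \<rho> b(1) by (simp add: subset_iff divide_less_eq) (smt (verit) divide_less_eq_1_pos)
    moreover have "\<rho> / b > 0" using \<rho> b by simp
    ultimately have "(\<psi> \<circ> (\<lambda>\<zeta>. f (z + b *\<^sub>R \<zeta>))) 0 \<le> circle_mean (\<psi> \<circ> (\<lambda>\<zeta>. f (z + b *\<^sub>R \<zeta>))) 0 (\<rho> / b)"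
      using sub unfolding subharmonic_on_def by blast
    moreover have "circle_mean (\<psi> \<circ> (\<lambda>\<zeta>. f (z + b *\<^sub>R \<zeta>))) 0 (\<rho> / b) = circle_mean (\<lambda>w. \<psi> (f w)) z \<rho>"
    proof -
      have "z + b *\<^sub>R (0 + complex_of_real (\<rho> / b) * cis t) = z + complex_of_real \<rho> * cis t" for t
        using b(1) by (simp add: scaleR_conv_of_real)
      then show ?thesis unfolding circle_mean_def comp_def by presburger
    qed
    ultimately show "\<psi> (f z) \<le> circle_mean (\<lambda>w. \<psi> (f w)) z \<rho>" by simp
  qed
  then show ?thesis using b(1) by blast
qed

definition schwarz_const :: "real \<Rightarrow> real" where
  "schwarz_const a = (3/2) * a\<^sup>2 + 2 * (2 + a) * (4 + a)"

text \<open>Here \<open>rm\<close> is the largest admissible cut-off radius, and \<open>2 / M\<close> times the conformal factor bounds the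
Laplacian of \<open>\<bar>x\<bar>\<^sup>2\<close> from below. The exponent bounds the sum of two losses in the Schwarz lemma:
\<open>\<kappa> / 2 \<le> a\<close> from the cut-off and \<open>2 \<alpha> \<delta>\<close> from the weight of \<open>\<rho>\<close>.\<close>

definition derivative_const :: "real \<Rightarrow> real \<Rightarrow> real \<Rightarrow> real \<Rightarrow> real \<Rightarrow> real \<Rightarrow> real" where
  "derivative_const a M rm \<epsilon> B m =
     2 * rm\<^sup>2 / B * exp (a + 2 * (schwarz_const a * B / (\<epsilon> * (2 / M) * rm\<^sup>2))) / m"

text \<open>The cut-off radius is \<open>r = rm * sqrt (\<delta> / B)\<close>, so that \<open>r\<^sup>2\<close> is proportional to \<open>\<delta>\<close> while \<open>\<delta> \<le> B\<close> keeps
\<open>r\<close> below \<open>rm\<close>. The weight \<open>\<alpha>\<close> of \<open>\<rho>\<close> is then inversely proportional to \<open>\<delta>\<close>, and the exponential of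
\<open>2 \<alpha> \<delta>\<close> in the Schwarz lemma becomes a constant.\<close>

lemma disc_derivative_estimate:
  fixes B \<delta> \<epsilon> k r0 m M L :: real
  assumes c0: "(U0, x0) \<in> A" "x0 ` U0 = ball 0 3"
    and bd: "chart_bounds (U0, x0) (cball 0 2) m M L"
    and r0: "r0 \<le> 1" "r0 * (3 * L / (2 * m)) \<le> 1 / 2"
    and k: "k > 0" "3 * k \<le> r0" and U: "U = {q \<in> U0. norm (x0 q) < 3 * k}"
    and \<epsilon>: "\<epsilon> > 0" and B: "B > 0" and D: "openin T D"
    and mp: "MPSH T A g D \<rho>" and neg: "\<And>q. q \<in> D \<Longrightarrow> \<rho> q < 0"
    and mpU: "MPSH T A g (D \<inter> U) (\<lambda>q. \<rho> q - ereal (N q))" and N: "\<And>q. q \<in> U \<Longrightarrow> N q = \<epsilon> * (norm (x0 q))\<^sup>2"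
    and \<delta>: "\<rho> w = ereal (- \<delta>)" "0 < \<delta>" "\<delta> \<le> B"
    and f: "CHI_disc T A g D f" "f 0 = w" and w: "w \<in> U0" "norm (x0 w) < k"
  defines "a \<equiv> laplacian_error m M L (3 * L / (2 * m))" and "rm \<equiv> min 1 (k * sqrt m)"
  shows "(norm (frechet_derivative (x0 \<circ> f) (at 0) 1))\<^sup>2 \<le> derivative_const a M rm \<epsilon> B m * \<delta>"
proof -
  define \<Gamma> where "\<Gamma> = 3 * L / (2 * m)"
  let ?K = "cball (0::real^'n) 2" and ?G = "G (U0, x0)"
  have mML: "m > 0" "M > 0" "L > 0" using bd by (auto simp: chart_bounds_def)
  have low: "m * (norm b)\<^sup>2 \<le> b \<bullet> (?G y *v b)" if "y \<in> ?K" for y b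
    using bd that unfolding chart_bounds_def by blast
  have up: "\<bar>b \<bullet> (?G y *v c)\<bar> \<le> M * norm b * norm c" if "y \<in> ?K" for y b c
    using bd that unfolding chart_bounds_def by blast
  have dif: "\<bar>b \<bullet> ((?G y - ?G z) *v c)\<bar> \<le> L * norm (y - z) * norm b * norm c" if "y \<in> ?K" "z \<in> ?K" for y z b c
    using bd that unfolding chart_bounds_def by blast
  have sym: "b \<bullet> (?G y *v c) = c \<bullet> (?G y *v b)" if "y \<in> ?K" for y b c
    using G_sym[OF c0(1), of y b c] that c0(2) by (auto simp: subset_iff)
  have \<Gamma>: "\<Gamma> > 0" using mML by (simp add: \<Gamma>_def)
  have a: "a > 0" unfolding a_def by (rule laplacian_error_pos) (use mML in auto)
  have rm: "rm > 0" "rm \<le> 1" "rm \<le> k * sqrt m" using k mML by (auto simp: rm_def)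
  define r where "r = rm * sqrt (\<delta> / B)"
  have r: "0 < r" "r \<le> rm" "r \<le> 1" "r\<^sup>2 = rm\<^sup>2 * \<delta> / B"
  proof -
    have "sqrt (\<delta> / B) \<le> 1" using \<delta> B by simp
    then show "r \<le> rm" using rm by (simp add: r_def mult_left_le)
    then show "r \<le> 1" using rm by simp
    show "0 < r" using \<delta> B rm by (simp add: r_def)
    show "r\<^sup>2 = rm\<^sup>2 * \<delta> / B" using \<delta> B by (simp add: r_def power_mult_distrib)
  qed
  define c1 where "c1 = 2 / M"
  have c1: "c1 > 0" using mML by (simp add: c1_def)
  define C3 where "C3 = schwarz_const a"
  have C3: "C3 > 0" using a by (simp add: C3_def schwarz_const_def add_nonneg_pos)
  define \<alpha> where "\<alpha> = C3 / (\<epsilon> * c1 * r\<^sup>2)"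
  have \<alpha>: "\<alpha> > 0" using C3 \<epsilon> c1 r(1) by (simp add: \<alpha>_def)
  have big: "\<alpha> * \<epsilon> * c1 \<ge> ((3/2) * a\<^sup>2 + 2 * (2 + a) * (4 + a)) / r\<^sup>2"
    using \<epsilon> c1 r(1) unfolding \<alpha>_def C3_def schwarz_const_def by (simp add: field_simps)
  define y where "y = x0 \<circ> f"
  define y0 where "y0 = x0 w"
  have y0: "norm y0 < k" "y0 \<in> ?K" using w k r0 by (auto simp: y0_def)
  define O' where "O' = {z \<in> unit_disc. f z \<in> U0}"
  have fs: "smooth_map_on T A unit_disc f" using f by (simp add: CHI_disc_def harmonic_disc_def)
  have fc: "continuous_map (top_of_set unit_disc) T f" using fs by (simp add: smooth_map_on_def)
  have fD: "f z \<in> D" if "z \<in> unit_disc" for z using f that unfolding CHI_disc_def by blast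
  have oO: "open O'" unfolding O'_def by (rule smooth_map_domain_open[OF fs open_ball c0(1)])
  have OD: "O' \<subseteq> unit_disc" by (auto simp: O'_def)
  have zO: "0 \<in> O'" using f w by (simp add: O'_def)
  have ysm: "smooth_on y O'" unfolding y_def O'_def by (rule smooth_map_coord[OF fs c0(1)])
  define hq where "hq v = (v - y0) \<bullet> (?G y0 *v (v - y0))" for v
  define h where "h z = hq (y z)" for z
  have hlow: "m * (norm (v - y0))\<^sup>2 \<le> hq v" for v unfolding hq_def by (rule low[OF y0(2)])
  have hnn: "hq v \<ge> 0" for v
  proof -
    have "0 \<le> m * (norm (v - y0))\<^sup>2" using mML by simp
    then show ?thesis using hlow[of v] by linarith
  qed
  have hqc: "continuous_on S hq" for S
    unfolding hq_def
    by (intro continuous_on_inner continuous_on_diff continuous_on_id continuous_on_const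
        bounded_linear.continuous_on[OF matrix_vector_mul_bounded_linear])
  have hc: "continuous_on O' h"
    unfolding h_def by (rule continuous_on_compose2[OF hqc[of UNIV] smooth_on_imp_continuous_on[OF ysm]]) auto
  have near: "norm (v - y0) \<le> k \<and> norm v < 2 * k" if "hq v \<le> r\<^sup>2" for v
  proof -
    have "m * (norm (v - y0))\<^sup>2 \<le> (k * sqrt m)\<^sup>2"
      using hlow[of v] that power_mono[OF order_trans[OF r(2) rm(3)], of 2] r(1) by simp
    also have "\<dots> = m * k\<^sup>2" using mML by (simp add: power_mult_distrib)
    finally have "(norm (v - y0))\<^sup>2 \<le> k\<^sup>2" using mML by simp
    then have 1: "norm (v - y0) \<le> k" using k by (simp add: power2_le_iff_abs_le)
    have "norm v \<le> norm (v - y0) + norm y0" by (metis diff_add_cancel norm_triangle_ineq)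
    then show ?thesis using 1 y0 by simp
  qed
  have nearU: "f z \<in> U" "norm (y z) < 2 * k" "norm (y z - y0) \<le> k" "y z \<in> ?K" if "z \<in> O'" "h z \<le> r\<^sup>2" for z
    using near[of "y z"] that k r0 unfolding h_def U O'_def y_def by auto
  have far: "open (unit_disc - {z \<in> O'. h z \<le> r\<^sup>2})"
  proof -
    let ?N = "{v \<in> ?K. hq v \<le> r\<^sup>2}"
    have "closed ?N"
      using continuous_closed_preimage[OF hqc[of ?K] closed_cball closed_atMost, of "r\<^sup>2"]
      by (simp add: vimage_def Int_def)
    moreover have "bounded ?N" by (rule bounded_subset[OF bounded_cball[of 0 2]]) auto
    ultimately have cN: "compact ?N" by (simp add: compact_eq_bounded_closed)
    have N3: "?N \<subseteq> x0 ` U0" unfolding c0(2) by auto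
    have "compactin (top_of_set (x0 ` U0)) ?N" using cN N3 by (simp add: compactin_subtopology)
    then have "compactin T (inv_into U0 x0 ` ?N)" using image_compactin[OF _ chart_inv_continuous[OF c0(1)]] by blast
    then have "closedin T (inv_into U0 x0 ` ?N)" by (rule compactin_imp_closedin[OF hausdorff])
    then have "openin T (topspace T - inv_into U0 x0 ` ?N)" by blast
    then have "open {z \<in> unit_disc. f z \<in> topspace T - inv_into U0 x0 ` ?N}"
      by (rule open_topology_preimage[OF fc open_ball])
    moreover have "{z \<in> unit_disc. f z \<in> topspace T - inv_into U0 x0 ` ?N} = unit_disc - {z \<in> O'. h z \<le> r\<^sup>2}"
    proof -
      have "f z \<in> topspace T" if "z \<in> unit_disc" for z using fc that by (auto simp: continuous_map_def)
      moreover have "f z \<in> inv_into U0 x0 ` ?N \<longleftrightarrow> z \<in> O' \<and> h z \<le> r\<^sup>2" if "z \<in> unit_disc" for z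
      proof
        assume "f z \<in> inv_into U0 x0 ` ?N"
        then obtain v where v: "v \<in> ?N" "f z = inv_into U0 x0 v" by blast
        then have "f z \<in> U0" "x0 (f z) = v" using N3 by (auto intro: inv_into_into f_inv_into_f)
        then show "z \<in> O' \<and> h z \<le> r\<^sup>2" using v that by (auto simp: O'_def h_def y_def)
      next
        assume z: "z \<in> O' \<and> h z \<le> r\<^sup>2"
        then have "y z \<in> ?N" using nearU(4)[of z] by (auto simp: h_def)
        moreover have "f z = inv_into U0 x0 (y z)" using z chart_inv[OF c0(1)] by (simp add: y_def O'_def)
        ultimately show "f z \<in> inv_into U0 x0 ` ?N" by blast
      qed
      ultimately show ?thesis by blast
    qed
    ultimately show ?thesis by simp
  qed
  define v where "v z = \<rho> (f z)" for z
  have usc: "open {z \<in> unit_disc. v z < ereal c}" for c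
  proof -
    have "subharmonic_on unit_disc (\<rho> \<circ> f)" using mp f by (simp add: MPSH_def)
    then have "openin (top_of_set unit_disc) {q \<in> topspace euclidean \<inter> unit_disc. (\<rho> \<circ> f) q < ereal c}"
      unfolding subharmonic_on_def usc_on_def by blast
    then have "open {q \<in> topspace euclidean \<inter> unit_disc. (\<rho> \<circ> f) q < ereal c}"
      using openin_open_eq[OF open_ball] by blast
    then show ?thesis by (simp add: v_def)
  qed
  have sub: "\<exists>R>0. \<forall>\<omega>. 0 < \<omega> \<and> \<omega> < R \<longrightarrow> v z \<le> circle_mean v z \<omega>" if "z \<in> unit_disc" for z
    using MPSH_submean_along_disc[OF f(1) D mp that fD[OF that]] unfolding v_def by blast
  define n where "n z = (y z - 0) \<bullet> (mat 1 *v (y z - 0))" for z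
  have nN: "n z = (norm (x0 (f z)))\<^sup>2" for z by (simp add: n_def y_def power2_norm_eq_inner)
  have subn: "\<exists>R>0. \<forall>\<omega>. 0 < \<omega> \<and> \<omega> < R \<longrightarrow> v z - ereal (\<epsilon> * n z) \<le> circle_mean (\<lambda>w. v w - ereal (\<epsilon> * n w)) z \<omega>"
    if z: "z \<in> O'" "h z \<le> r\<^sup>2" for z
  proof -
    have oU: "openin T U" unfolding U using chart_preimage_open[OF c0(1) open_ball[of 0 "3 * k"]] by simp
    have zE: "z \<in> unit_disc" "f z \<in> D \<inter> U" using nearU[OF z] z OD fD by auto
    obtain R where R: "R > 0" "\<And>\<omega>. 0 < \<omega> \<Longrightarrow> \<omega> < R \<Longrightarrow>
        (\<forall>w\<in>cball z \<omega>. w \<in> unit_disc \<and> f w \<in> D \<inter> U) \<and>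
        \<rho> (f z) - ereal (N (f z)) \<le> circle_mean (\<lambda>w. \<rho> (f w) - ereal (N (f w))) z \<omega>"
      using MPSH_submean_along_disc[OF f(1) openin_Int[OF D oU] mpU zE] by blast
    have "v z - ereal (\<epsilon> * n z) \<le> circle_mean (\<lambda>w. v w - ereal (\<epsilon> * n w)) z \<omega>" if \<omega>: "0 < \<omega>" "\<omega> < R" for \<omega>
    proof -
      have eq: "\<rho> (f w) - ereal (N (f w)) = v w - ereal (\<epsilon> * n w)" if "f w \<in> U" for w
        using N[OF that] by (simp add: v_def nN)
      have "circle_mean (\<lambda>w. \<rho> (f w) - ereal (N (f w))) z \<omega> = circle_mean (\<lambda>w. v w - ereal (\<epsilon> * n w)) z \<omega>"
        by (rule circle_mean_cong[OF _ \<omega>(1)]) (use R(2)[OF \<omega>] eq in blast)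
      then show ?thesis using R(2)[OF \<omega>] eq[of z] zE by simp
    qed
    then show ?thesis using R(1) by blast
  qed
  let ?l = "\<lambda>z b. frechet_derivative y (at z) b"
  have jets: "\<exists>l lh Bh ln Bn. l > 0 \<and> jet2 h z lh Bh \<and> jet2 n z ln Bn \<and> c1 * l \<le> Bn 1 1 + Bn \<i> \<i> \<and>
        (4 - a * sqrt (h z)) * l \<le> Bh 1 1 + Bh \<i> \<i> \<and> Bh 1 1 + Bh \<i> \<i> \<le> (4 + a * sqrt (h z)) * l \<and>
        (lh 1)\<^sup>2 + (lh \<i>)\<^sup>2 \<le> (4 + a * sqrt (h z)) * h z * l"
    if z: "z \<in> O'" "0 < h z" "h z \<le> r\<^sup>2" for z
  proof -
    have zU: "z \<in> unit_disc" "f z \<in> U0" using z by (auto simp: O'_def)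
    have yK: "y z \<in> ?K" "norm (y z) < 2 * k" "norm (y z - y0) \<le> k" using nearU z by auto
    have yz: "x0 (f z) = y z" by (simp add: y_def)
    then have "x0 (f z) \<in> ?K" using yK(1) by simp
    from CHI_disc_jet[OF f(1) c0(1) zU bd this, folded y_def \<Gamma>_def, unfolded yz]
    obtain l Bf where l: "l > 0" "jet2 y z (?l z) Bf"
      "\<And>b c. ?l z b \<bullet> (?G (y z) *v ?l z c) = l * (b \<bullet> c)"
      "norm (Bf 1 1 + Bf \<i> \<i>) \<le> \<Gamma> * ((norm (?l z 1))\<^sup>2 + (norm (?l z \<i>))\<^sup>2)"
      by blast
    define p q W where "p = ?l z 1" and "q = ?l z \<i>" and "W = Bf 1 1 + Bf \<i> \<i>"
    let ?V = "y z - y0"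
    have conf: "p \<bullet> (?G (y z) *v p) = l" "q \<bullet> (?G (y z) *v q) = l" "p \<bullet> (?G (y z) *v q) = 0"
      unfolding p_def q_def l(3) by (simp_all add: inner_complex_def)
    have W: "norm W \<le> \<Gamma> * ((norm p)\<^sup>2 + (norm q)\<^sup>2)" using l(4) by (simp add: p_def q_def W_def)
    have V4: "norm ?V \<le> 4" using yK k r0 by linarith
    have hz: "h z = ?V \<bullet> (?G y0 *v ?V)" by (simp add: h_def hq_def)
    note est = conformal_laplacian_estimates[OF mML less_imp_le[OF \<Gamma>] l(1) sym[OF yK(1)] low[OF y0(2)] low[OF yK(1)]
        up[OF y0(2)] up[OF yK(1)] dif[OF yK(1) y0(2)] conf W V4]
    have a': "laplacian_error m M L \<Gamma> = a" by (simp add: a_def \<Gamma>_def)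
    let ?lh = "\<lambda>b. ?V \<bullet> (?G y0 *v ?l z b) + ?l z b \<bullet> (?G y0 *v ?V)"
    let ?Bh = "\<lambda>b c. ?V \<bullet> (?G y0 *v Bf b c) + ?l z b \<bullet> (?G y0 *v ?l z c) + (?l z c \<bullet> (?G y0 *v ?l z b) + Bf b c \<bullet> (?G y0 *v ?V))"
    have Jh: "jet2 h z ?lh ?Bh" unfolding h_def[abs_def] hq_def by (rule jet2_quadratic_form[OF l(2)])
    let ?Bn = "\<lambda>b c. (y z - 0) \<bullet> (mat 1 *v Bf b c) + ?l z b \<bullet> (mat 1 *v ?l z c) + (?l z c \<bullet> (mat 1 *v ?l z b) + Bf b c \<bullet> (mat 1 *v (y z - 0)))"
    have Jn: "jet2 n z (\<lambda>b. (y z - 0) \<bullet> (mat 1 *v ?l z b) + ?l z b \<bullet> (mat 1 *v (y z - 0))) ?Bn"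
      unfolding n_def[abs_def] by (rule jet2_quadratic_form[OF l(2)])
    have s: "b \<bullet> (?G y0 *v ?V) = ?V \<bullet> (?G y0 *v b)" for b by (rule sym[OF y0(2)])
    have lap: "?Bh 1 1 + ?Bh \<i> \<i> = 2 * (?V \<bullet> (?G y0 *v W)) + 2 * (p \<bullet> (?G y0 *v p) + q \<bullet> (?G y0 *v q))"
      unfolding s W_def p_def q_def by (simp add: matrix_vector_right_distrib inner_add_right)
    have grad: "(?lh 1)\<^sup>2 + (?lh \<i>)\<^sup>2 = (2 * (?V \<bullet> (?G y0 *v p)))\<^sup>2 + (2 * (?V \<bullet> (?G y0 *v q)))\<^sup>2"
      unfolding s p_def q_def by simp
    have lapn: "?Bn 1 1 + ?Bn \<i> \<i> = 2 * (y z \<bullet> W) + 2 * ((norm p)\<^sup>2 + (norm q)\<^sup>2)"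
      unfolding W_def p_def q_def by (simp add: power2_norm_eq_inner inner_add_right inner_commute)
    have c1l: "c1 * l \<le> ?Bn 1 1 + ?Bn \<i> \<i>"
    proof -
      define S where "S = (norm p)\<^sup>2 + (norm q)\<^sup>2"
      have S0: "S \<ge> 0" by (simp add: S_def)
      have "l \<le> M * (norm p)\<^sup>2" "l \<le> M * (norm q)\<^sup>2"
        using up[OF yK(1), of p p] up[OF yK(1), of q q] conf by (auto simp: power2_eq_square mult.assoc)
      then have "2 * l \<le> M * S" by (simp add: S_def distrib_left)
      then have 1: "c1 * l \<le> S" using mML by (simp add: c1_def field_simps)
      have "\<bar>y z \<bullet> W\<bar> \<le> norm (y z) * norm W" by (rule Cauchy_Schwarz_ineq2)
      also have "\<dots> \<le> r0 * (\<Gamma> * S)" using yK(2) k W by (intro mult_mono) (auto simp: S_def)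
      also have "\<dots> \<le> 1 / 2 * S" using mult_right_mono[OF r0(2) S0] by (simp add: \<Gamma>_def mult.assoc)
      finally have "- (1 / 2 * S) \<le> y z \<bullet> W" by linarith
      then show ?thesis using 1 unfolding lapn S_def[symmetric] by linarith
    qed
    show ?thesis
      using l(1) Jh Jn c1l est[unfolded a', folded hz, folded lap grad]
      by (intro exI[of _ l] exI[of _ ?lh] exI[of _ ?Bh] exI[of _ "\<lambda>b. (y z - 0) \<bullet> (mat 1 *v ?l z b) + ?l z b \<bullet> (mat 1 *v (y z - 0))"]
          exI[of _ ?Bn] conjI) assumption+
  qed
  have zd: "(0::complex) \<in> unit_disc" by simp
  have y00: "y 0 = y0" using f(2) by (simp add: y_def y0_def)
  have f0: "f 0 \<in> U0" "x0 (f 0) \<in> ?K" "x0 (f 0) = y 0" using f(2) w y0 by (auto simp: y0_def y_def)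
  from CHI_disc_jet[OF f(1) c0(1) zd f0(1) bd f0(2), folded y_def, unfolded f0(3)]
  obtain l Bf where l: "l > 0" "jet2 y 0 (?l 0) Bf"
    "\<And>b c. ?l 0 b \<bullet> (?G (y 0) *v ?l 0 c) = l * (b \<bullet> c)"
    "norm (Bf 1 1 + Bf \<i> \<i>) \<le> 3 * L / (2 * m) * ((norm (?l 0 1))\<^sup>2 + (norm (?l 0 \<i>))\<^sup>2)"
    by blast
  have h0: "h 0 = 0" by (simp add: h_def hq_def y00)
  define Bh where "Bh b c = 2 * l * (b \<bullet> c)" for b c :: complex
  have Jh0: "jet2 h 0 (\<lambda>b. 0) Bh"
  proof -
    have "jet2 h 0 (\<lambda>b. (y 0 - y0) \<bullet> (?G y0 *v ?l 0 b) + ?l 0 b \<bullet> (?G y0 *v (y 0 - y0)))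
      (\<lambda>b c. (y 0 - y0) \<bullet> (?G y0 *v Bf b c) + ?l 0 b \<bullet> (?G y0 *v ?l 0 c) + (?l 0 c \<bullet> (?G y0 *v ?l 0 b) + Bf b c \<bullet> (?G y0 *v (y 0 - y0))))"
      unfolding h_def[abs_def] hq_def by (rule jet2_quadratic_form[OF l(2)])
    moreover have "?l 0 b \<bullet> (?G y0 *v ?l 0 c) = l * (b \<bullet> c)" for b c using l(3)[of b c] by (simp add: y00)
    ultimately show ?thesis by (simp add: y00 Bh_def[abs_def] inner_commute mult.assoc)
  qed
  \<comment> \<open>By conformality the second derivative of \<open>h\<close> at \<open>0\<close> is \<open>2 l\<close> times the inner product.\<close>
  obtain d1 where d1: "d1 > 0" "\<And>z. norm z < d1 \<Longrightarrow> h z \<ge> l / 2 * (norm z)\<^sup>2"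
  proof -
    obtain d where "d > 0" "\<And>z. norm z < d \<Longrightarrow> h (0 + z) \<ge> h 0 + 0 + Bh z z / 2 - l / 2 * (norm z)\<^sup>2"
      using jet2_taylor[OF Jh0, of "l / 2"] l(1) by auto
    then show ?thesis using that[of d] by (simp add: h0 Bh_def power2_norm_eq_inner)
  qed
  obtain d2 where d2: "d2 > 0" "\<And>z. norm z < d2 \<Longrightarrow> h z \<le> (3 / 2 * l) * (norm z)\<^sup>2"
  proof -
    have "jet2 (\<lambda>z. (-1) * h z) 0 (\<lambda>b. (-1) * 0) (\<lambda>b c. (-1) * Bh b c)"
      by (rule jet2_linear[OF bounded_linear_mult_right Jh0])
    from jet2_taylor[OF this, of "l / 2"] l(1) obtain d where
      "d > 0" "\<And>z. norm z < d \<Longrightarrow> (-1) * h (0 + z) \<ge> (-1) * h 0 + (-1) * 0 + (-1) * Bh z z / 2 - l / 2 * (norm z)\<^sup>2"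
      by auto
    then show ?thesis using that[of d] by (simp add: h0 Bh_def power2_norm_eq_inner algebra_simps)
  qed
  obtain d3 where d3: "d3 > 0" "ball 0 d3 \<subseteq> O'" using oO zO open_contains_ball by blast
  define \<Theta> where "\<Theta> z = (if z \<in> O' then cutoff_exp (2 * a * r) (h z / r\<^sup>2) else 1)" for z
  have schwarz: "exp_ereal \<alpha> (v z) * \<Theta> z \<le> (norm z)\<^sup>2" if "z \<in> unit_disc" "z \<noteq> 0" for z
    unfolding \<Theta>_def
  proof (rule schwarz_lemma[of \<alpha> a r \<epsilon> c1 v O' h n "min d2 d3" "3 / 2 * l" z])
    show "\<alpha> > 0" "a > 0" "0 < r" "r \<le> 1" "\<epsilon> > 0" "c1 > 0" "open O'" "O' \<subseteq> unit_disc" "continuous_on O' h"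
      by (fact \<alpha> a r \<epsilon> c1 oO OD hc)+
    show "open (unit_disc - {z \<in> O'. h z \<le> r\<^sup>2})" by (rule far)
    show "((3/2) * a\<^sup>2 + 2 * (2 + a) * (4 + a)) / r\<^sup>2 \<le> \<alpha> * \<epsilon> * c1" by (rule big)
    show "z \<in> unit_disc" "z \<noteq> 0" by (fact that)+
    show "open {z \<in> unit_disc. v z < ereal c}" for c by (rule usc)
    show "\<exists>R>0. \<forall>\<rho>. 0 < \<rho> \<and> \<rho> < R \<longrightarrow> v z \<le> circle_mean v z \<rho>" if "z \<in> unit_disc" for z by (rule sub[OF that])
    show "\<exists>R>0. \<forall>\<rho>. 0 < \<rho> \<and> \<rho> < R \<longrightarrow> v z - ereal (\<epsilon> * n z) \<le> circle_mean (\<lambda>w. v w - ereal (\<epsilon> * n w)) z \<rho>"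
      if "z \<in> O'" "h z \<le> r\<^sup>2" for z by (rule subn[OF that])
    show "\<exists>l lh Bh ln Bn. l > 0 \<and> jet2 h z lh Bh \<and> jet2 n z ln Bn \<and> c1 * l \<le> Bn 1 1 + Bn \<i> \<i> \<and>
        (4 - a * sqrt (h z)) * l \<le> Bh 1 1 + Bh \<i> \<i> \<and> Bh 1 1 + Bh \<i> \<i> \<le> (4 + a * sqrt (h z)) * l \<and>
        (lh 1)\<^sup>2 + (lh \<i>)\<^sup>2 \<le> (4 + a * sqrt (h z)) * h z * l"
      if "z \<in> O'" "0 < h z" "h z \<le> r\<^sup>2" for z by (rule jets[OF that])
    show "v z < 0" if "z \<in> unit_disc" for z unfolding v_def by (rule neg[OF fD[OF that]])
    show "0 \<le> h z" if "z \<in> O'" for z by (simp add: h_def hnn)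
    show "0 < min d2 d3" using d2 d3 by simp
    show "z \<in> O' \<and> h z \<le> (3 / 2 * l) * (norm z)\<^sup>2" if "norm z < min d2 d3" for z
      using that d2 d3 by (auto simp: subset_iff)
  qed
  have rl: "r\<^sup>2 > 0" using r(1) by simp
  obtain \<omega> where \<omega>: "0 < \<omega>" "\<omega> < d1" "\<omega> < d2" "\<omega> < d3" "\<omega> < 1" "(3 / 2 * l) * \<omega>\<^sup>2 \<le> r\<^sup>2" "v 0 \<le> circle_mean v 0 \<omega>"
  proof -
    obtain R where R: "R > 0" "\<And>\<omega>. 0 < \<omega> \<Longrightarrow> \<omega> < R \<Longrightarrow> v 0 \<le> circle_mean v 0 \<omega>" using sub[OF zd] by blast
    define \<omega> where "\<omega> = Min {d1, d2, d3, 1, R, r / sqrt (3 / 2 * l)} / 2"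
    have l32: "sqrt (3 / 2 * l) > 0" using l(1) by simp
    have rq: "r / sqrt (3 / 2 * l) > 0" using r(1) l32 by simp
    have \<omega>0: "\<omega> > 0" using d1 d2 d3 R rq by (simp add: \<omega>_def)
    have lt: "\<omega> < x" if "x \<in> {d1, d2, d3, 1, R, r / sqrt (3 / 2 * l)}" for x
    proof -
      have "2 * \<omega> \<le> x" using Min_le[OF _ that] by (simp add: \<omega>_def)
      then show ?thesis using \<omega>0 by linarith
    qed
    have le: "\<omega> < d1" "\<omega> < d2" "\<omega> < d3" "\<omega> < 1" "\<omega> < R" "\<omega> < r / sqrt (3 / 2 * l)"
      by (rule lt; simp)+
    have "\<omega> * sqrt (3 / 2 * l) \<le> r" using le(6) l32 by (simp add: pos_less_divide_eq)
    then have "(\<omega> * sqrt (3 / 2 * l))\<^sup>2 \<le> r\<^sup>2" using \<omega>0 l32 by (intro power_mono) auto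
    then have "(3 / 2 * l) * \<omega>\<^sup>2 \<le> r\<^sup>2" using l(1) by (simp add: power_mult_distrib mult.commute)
    then show ?thesis using that[of \<omega>] \<omega>0 le R(2) by blast
  qed
  \<comment> \<open>Semicontinuity gives no lower bound for \<open>v\<close> near \<open>0\<close>, but the sub-mean value property gives a point on
    each small circle at which \<open>v\<close> is above \<open>2 * v 0\<close>.\<close>
  have "\<exists>t. v (0 + of_real \<omega> * cis t) > ereal (2 * (- \<delta>))"
  proof (rule ccontr)
    assume "\<not> ?thesis"
    then have "circle_mean v 0 \<omega> \<le> ereal (2 * (- \<delta>))" by (intro circle_mean_le_const) (auto simp: not_less)
    then have "v 0 \<le> ereal (2 * (- \<delta>))" using \<omega>(7) by (rule order_trans[rotated])
    then show False using \<delta> f(2) by (simp add: v_def)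
  qed
  then obtain t where t: "v (0 + of_real \<omega> * cis t) > ereal (2 * (- \<delta>))" ..
  define z where "z = 0 + of_real \<omega> * cis t"
  have z: "norm z = \<omega>" "v z > ereal (2 * (- \<delta>))" using t \<omega>(1) by (simp_all add: z_def norm_mult)
  have zD: "z \<in> unit_disc" "z \<noteq> 0" "z \<in> O'" using z \<omega> d3 by (auto simp: subset_iff)
  have hz: "l / 2 * \<omega>\<^sup>2 \<le> h z" "h z \<le> r\<^sup>2" using d1(2)[of z] d2(2)[of z] z(1) \<omega> by auto
  obtain vz where vz: "v z = ereal vz" "vz > 2 * (- \<delta>)" using z(2) neg[OF fD[OF zD(1)]] by (cases "v z") (auto simp: v_def)
  have 1: "exp_ereal \<alpha> (v z) \<ge> exp (- 2 * \<alpha> * \<delta>)"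
    using vz \<alpha> mult_left_mono[of "2 * (- \<delta>)" vz \<alpha>] by (simp add: exp_ereal_def mult_ac)
  have 2: "\<Theta> z \<ge> (l / 2 * \<omega>\<^sup>2 / r\<^sup>2) * exp (- a)"
  proof -
    have \<tau>: "0 \<le> h z / r\<^sup>2" "h z / r\<^sup>2 \<le> 1" using hz(2) rl hnn by (auto simp: h_def)
    have "\<Theta> z \<ge> h z / r\<^sup>2 * exp (- (2 * a * r) / 2)"
      using cutoff_exp_lower[OF \<tau>, of "2 * a * r"] zD(3) a r(1) by (simp add: \<Theta>_def)
    moreover have "exp (- (2 * a * r) / 2) \<ge> exp (- a)" using a r(1,3) by (simp add: mult_left_le)
    moreover have "h z / r\<^sup>2 \<ge> l / 2 * \<omega>\<^sup>2 / r\<^sup>2" using hz(1) rl by (intro divide_right_mono) auto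
    ultimately show ?thesis using \<tau>(1) by (meson exp_ge_zero mult_mono order_trans)
  qed
  have nn2: "(l / 2 * \<omega>\<^sup>2 / r\<^sup>2) * exp (- a) \<ge> 0" using l(1) rl by simp
  have "exp (- 2 * \<alpha> * \<delta>) * ((l / 2 * \<omega>\<^sup>2 / r\<^sup>2) * exp (- a)) \<le> exp_ereal \<alpha> (v z) * \<Theta> z"
    using 1 2 nn2 by (intro mult_mono) (auto simp: exp_ereal_nonneg)
  also have "\<dots> \<le> \<omega>\<^sup>2" using schwarz[OF zD(1,2)] z(1) by simp
  finally have "(l / 2 / r\<^sup>2 * (exp (- 2 * \<alpha> * \<delta>) * exp (- a))) * \<omega>\<^sup>2 \<le> 1 * \<omega>\<^sup>2" by (simp add: mult_ac)
  then have "l / 2 / r\<^sup>2 * (exp (- 2 * \<alpha> * \<delta>) * exp (- a)) \<le> 1" using \<omega>(1) by (simp only: mult_le_cancel_right) simp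
  moreover have "exp (- 2 * \<alpha> * \<delta>) * exp (- a) = inverse (exp (a + 2 * (\<alpha> * \<delta>)))"
    by (simp add: exp_add[symmetric] exp_minus[symmetric])
  ultimately have "l / (2 * r\<^sup>2) * inverse (exp (a + 2 * (\<alpha> * \<delta>))) \<le> 1" by (simp add: mult_ac)
  then have lb: "l \<le> 2 * r\<^sup>2 * exp (a + 2 * (\<alpha> * \<delta>))"
    using rl by (simp add: divide_le_eq inverse_eq_divide mult_ac)
  have \<alpha>\<delta>: "\<alpha> * \<delta> = C3 * B / (\<epsilon> * (2 / M) * rm\<^sup>2)"
    using \<delta> B rm unfolding \<alpha>_def r(4) c1_def by (simp add: mult_ac)
  have "m * (norm (?l 0 1))\<^sup>2 \<le> l"
    using low[OF y0(2), of "?l 0 1"] l(3)[of 1 1] by (simp add: y00 inner_complex_def)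
  then have "(norm (?l 0 1))\<^sup>2 \<le> l / m" using mML by (simp add: pos_le_divide_eq mult.commute)
  also have "\<dots> \<le> 2 * r\<^sup>2 * exp (a + 2 * (\<alpha> * \<delta>)) / m" using lb mML by (intro divide_right_mono) auto
  also have "\<dots> = derivative_const a M rm \<epsilon> B m * \<delta>"
    unfolding derivative_const_def \<alpha>\<delta> r(4) C3_def by simp
  finally show ?thesis unfolding y_def .
qed

end

section \<open>The lower bound for the Kobayashi--Royden pseudometric\<close>

theorem theorem3p1:
  fixes T :: "'m topology"
    and A :: "('m, 'n::finite) chart set"
    and g :: "('m, 'n) metric"
    and p :: 'm
  assumes "riemannian_manifold T A g"
    and "CARD('n) \<ge> 2"
    and "p \<in> topspace T"
  shows "\<exists>W. openin T W \<and> p \<in> W \<and>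
    (\<forall>U x s. normal_coordinates T A g p s U x \<and> U \<subseteq> W \<and>
        MPSH T A g U (\<lambda>q. ereal ((norm (x q))\<^sup>2)) \<longrightarrow>
      (\<forall>\<epsilon>>0. \<forall>B>0. \<exists>C>0. \<forall>D \<rho>.
        openin T D \<and> connectedin T D \<and> p \<in> D \<and>
        MPSH T A g D \<rho> \<and> (\<forall>q\<in>D. \<rho> q < 0) \<and>
        MPSH T A g (D \<inter> U) (\<lambda>q. \<rho> q - ereal (\<epsilon> * (norm (x q))\<^sup>2)) \<and>
        (\<forall>q\<in>D \<inter> U. x q \<in> ball 0 2 \<longrightarrow> \<bar>\<rho> q\<bar> \<le> ereal B) \<longrightarrow>
        (\<forall>w\<in>D \<inter> U. x w \<in> ball 0 1 \<longrightarrow>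
          (\<forall>\<xi>\<in>tangent_space A w.
             ereal (C * norm (\<xi> (U, x)) * \<bar>real_of_ereal (\<rho> w)\<bar> powr (-1/2))
               \<le> kobayashi T A g D w \<xi>))))"
proof -
  interpret riemannian T A g by unfold_locales (rule assms(1))
  show ?thesis
  proof (cases "\<exists>U0 x0 s0. normal_coordinates T A g p s0 U0 x0")
    case False
    then show ?thesis using assms(3) by (intro exI[of _ "topspace T"]) blast
  next
    case True
    then obtain U0 x0 s0 where N0: "normal_coordinates T A g p s0 U0 x0" by blast
    then have c0: "(U0, x0) \<in> A" "x0 ` U0 = ball 0 3" "p \<in> U0" "x0 p = 0" "s0 > 0"
      by (auto simp: normal_coordinates_def)
    have "cball 0 2 \<subseteq> snd (U0, x0) ` fst (U0, x0)" using c0(2) by auto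
    from chart_bounds_exist[OF c0(1) compact_cball convex_cball this]
    obtain m M L where bd: "chart_bounds (U0, x0) (cball 0 2) m M L" by blast
    have mML: "m > 0" "M > 0" "L > 0" using bd by (auto simp: chart_bounds_def)
    \<comment> \<open>On this ball the nonlinear term of the harmonic map equation takes away at most half of the Laplacian
      that \<open>\<bar>x0\<bar>\<^sup>2\<close> would have along the disc in Euclidean space.\<close>
    define r0 where "r0 = min 1 (m / (3 * L))"
    have r0: "0 < r0" "r0 \<le> 1" "r0 * (3 * L / (2 * m)) \<le> 1 / 2"
    proof -
      show "0 < r0" "r0 \<le> 1" using mML by (auto simp: r0_def)
      have "r0 * (3 * L / (2 * m)) \<le> m / (3 * L) * (3 * L / (2 * m))"
        using mML by (intro mult_right_mono) (auto simp: r0_def)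
      then show "r0 * (3 * L / (2 * m)) \<le> 1 / 2" using mML by simp
    qed
    define W where "W = {q \<in> U0. norm (x0 q) < r0}"
    have oW: "openin T W" unfolding W_def using chart_preimage_open[OF c0(1) open_ball[of 0 r0]] by simp
    have pW: "p \<in> W" using c0 r0 by (simp add: W_def)
    have main: "\<exists>C>0. \<forall>D \<rho>.
        openin T D \<and> connectedin T D \<and> p \<in> D \<and>
        MPSH T A g D \<rho> \<and> (\<forall>q\<in>D. \<rho> q < 0) \<and>
        MPSH T A g (D \<inter> U) (\<lambda>q. \<rho> q - ereal (\<epsilon> * (norm (x q))\<^sup>2)) \<and>
        (\<forall>q\<in>D \<inter> U. x q \<in> ball 0 2 \<longrightarrow> \<bar>\<rho> q\<bar> \<le> ereal B) \<longrightarrow>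
        (\<forall>w\<in>D \<inter> U. x w \<in> ball 0 1 \<longrightarrow>
          (\<forall>\<xi>\<in>tangent_space A w.
             ereal (C * norm (\<xi> (U, x)) * \<bar>real_of_ereal (\<rho> w)\<bar> powr (-1/2)) \<le> kobayashi T A g D w \<xi>))"
      if N: "normal_coordinates T A g p s U x" and UW: "U \<subseteq> W" and \<epsilon>: "\<epsilon> > 0" and B: "B > 0" for U x s \<epsilon> B
    proof -
      have c: "(U, x) \<in> A" "s > 0" using N by (auto simp: normal_coordinates_def)
      obtain R where R: "linear R" "\<And>y. norm (R y) = norm y" "\<And>q. q \<in> U \<Longrightarrow> x0 q = (s / s0) *\<^sub>R R (x q)"
        "U = {q \<in> U0. norm (x0 q) < 3 * (s / s0)}" "3 * (s / s0) \<le> r0"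
        using normal_coordinates_similar[OF N0 N UW[unfolded W_def] r0(2)] by blast
      define k where "k = s / s0"
      have k: "k > 0" using c c0 by (simp add: k_def)
      have xn: "norm (x0 q) = k * norm (x q)" if "q \<in> U" for q
        using R(3)[OF that] R(2) k by (simp add: k_def[symmetric])
      define a where "a = laplacian_error m M L (3 * L / (2 * m))"
      define rm where "rm = min 1 (k * sqrt m)"
      define Q where "Q = derivative_const a M rm (\<epsilon> / k\<^sup>2) B m"
      have "rm > 0" using k mML by (simp add: rm_def)
      then have Q: "Q > 0" using B mML by (simp add: Q_def derivative_const_def)
      define C where "C = k / sqrt Q"
      have C: "C > 0" using k Q by (simp add: C_def)
      have "ereal (C * norm (\<xi> (U, x)) * \<bar>real_of_ereal (\<rho> w)\<bar> powr (-1/2)) \<le> kobayashi T A g D w \<xi>"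
        if D: "openin T D" and mp: "MPSH T A g D \<rho>" and neg: "\<forall>q\<in>D. \<rho> q < 0"
          and mpU: "MPSH T A g (D \<inter> U) (\<lambda>q. \<rho> q - ereal (\<epsilon> * (norm (x q))\<^sup>2))"
          and bnd: "\<forall>q\<in>D \<inter> U. x q \<in> ball 0 2 \<longrightarrow> \<bar>\<rho> q\<bar> \<le> ereal B"
          and w: "w \<in> D \<inter> U" "x w \<in> ball 0 1" and \<xi>: "\<xi> \<in> tangent_space A w" for D \<rho> w \<xi>
      proof (cases "\<xi> = (\<lambda>_. 0)")
        case True
        then show ?thesis by (simp add: kobayashi_def)
      next
        case False
        have \<rho>w: "\<rho> w < 0" "\<bar>\<rho> w\<bar> \<le> ereal B" using neg bnd w by auto
        define \<delta> where "\<delta> = - real_of_ereal (\<rho> w)"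
        have \<delta>: "\<rho> w = ereal (- \<delta>)" "0 < \<delta>" "\<delta> \<le> B"
          using \<rho>w by (cases "\<rho> w"; simp add: \<delta>_def)+
        have pw: "\<bar>real_of_ereal (\<rho> w)\<bar> powr (-1/2) = 1 / sqrt \<delta>"
          using \<delta> by (simp add: powr_minus powr_half_sqrt inverse_eq_divide)
        have \<xi>0: "norm (\<xi> (U0, x0)) = k * norm (\<xi> (U, x))"
          by (rule tangent_norm_similar[OF c0(1) c(1) _ R(1,2) k _ _ \<xi>])
            (use UW R(3) w in \<open>auto simp: W_def k_def\<close>)
        have "C * norm (\<xi> (U, x)) * (1 / sqrt \<delta>) \<le> \<alpha>"
          if \<alpha>: "\<alpha> > 0" and f: "CHI_disc T A g D f" "f 0 = w" "differential A f 0 1 = (\<lambda>c. (1 / \<alpha>) *\<^sub>R \<xi> c)" for \<alpha> f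
        proof -
          have wU0: "w \<in> U0" "norm (x0 w) < k" using w UW xn[of w] k by (auto simp: W_def)
          have "(norm (frechet_derivative (x0 \<circ> f) (at 0) 1))\<^sup>2 \<le> Q * \<delta>"
            unfolding Q_def a_def rm_def
          proof (rule disc_derivative_estimate[OF c0(1,2) bd r0(2,3) k _ _ _ B D mp _ mpU _ \<delta> f(1,2) wU0])
            show "3 * k \<le> r0" "U = {q \<in> U0. norm (x0 q) < 3 * k}" using R(4,5) by (simp_all add: k_def)
            show "0 < \<epsilon> / k\<^sup>2" using \<epsilon> k by simp
            show "\<rho> q < 0" if "q \<in> D" for q using neg that by blast
            show "\<epsilon> * (norm (x q))\<^sup>2 = \<epsilon> / k\<^sup>2 * (norm (x0 q))\<^sup>2" if "q \<in> U" for q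
              using xn[OF that] k by (simp add: power_mult_distrib)
          qed
          moreover have "frechet_derivative (x0 \<circ> f) (at 0) 1 = (1 / \<alpha>) *\<^sub>R \<xi> (U0, x0)"
            using fun_cong[OF f(3), of "(U0, x0)"] c0(1) wU0 f(2) by (simp add: differential_def)
          ultimately have "(k * norm (\<xi> (U, x)) / \<alpha>)\<^sup>2 \<le> Q * \<delta>"
            using \<alpha> by (simp add: \<xi>0 power_divide power_mult_distrib)
          then have "k * norm (\<xi> (U, x)) / \<alpha> \<le> sqrt (Q * \<delta>)" by (rule real_le_rsqrt)
          then have "k * norm (\<xi> (U, x)) \<le> \<alpha> * (sqrt Q * sqrt \<delta>)"
            using \<alpha> by (simp add: pos_divide_le_eq real_sqrt_mult mult_ac)
          moreover have "sqrt Q * sqrt \<delta> > 0" using Q \<delta> by simp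
          ultimately have "k * norm (\<xi> (U, x)) / (sqrt Q * sqrt \<delta>) \<le> \<alpha>" by (simp add: pos_divide_le_eq)
          then show ?thesis by (simp add: C_def)
        qed
        then show ?thesis
          unfolding kobayashi_def pw using False by (auto intro!: Inf_greatest)
      qed
      then show ?thesis using C by blast
    qed
    show ?thesis
      by (intro exI[of _ W] conjI oW pW allI impI main) auto
  qed
qed

end
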